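(* Every non-parabolic rotational surface of constant mean curvature $H$ (with $H\ge0$) satisfying $H^2<1$ in $\mathbb{H}^3\subset\mathbb{R}^{3,1}$ is given, with respect to a suitable orthonormal basis $(e_0,e_1,e_2,e_3)$ of $\mathbb{R}^{3,1}$ with $e_0$ timelike, by one of the following parametrizations: (elliptic rotations, $\kappa_1=1$) $$(\theta,t)\mapsto\Big(\sqrt{1+r^2(t)}\cosh\psi(t),\ \sqrt{1+r^2(t)}\sinh\psi(t),\ r(t)\cos\theta,\ r(t)\sin\theta\Big),$$ (hyperbolic rotations, $\kappa_1=-1$) $$(\theta,t)\mapsto\Big(r(t)\cosh\theta,\ r(t)\sinh\theta,\ \sqrt{r^2(t)-1}\cos\psi(t),\ \sqrt{r^2(t)-1}\sin\psi(t)\Big),$$ with $$r(t)=\frac{\sqrt{C^+}}{\operatorname{cn}_p(\Xi t)},\qquad p^2=-\frac{C^-}{C^+-C^-}\in[0,1],$$ $$\psi(t)=Ct-\frac{C^+(C+\kappa_1H)}{C^++\kappa_1}\,\frac1\Xi\,\Pi_p\!\left(\frac{1}{\kappa_1C^++1};\,\Xi t\right)$$ (where $\psi(t)=Ht$ in the special case $C^++\kappa_1=0$). Here $\Xi=\sqrt{-(H^2-1)(C^+-C^-)}$, $C\in\mathbb{R}$ is a constant, and $C^+>0\ge C^-$ are the (real) roots of $$p_C(x)=(H^2-1)x^2-(\kappa_1+2HC)x+C^2.$$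
   Context: $\mathbb{R}^{3,1}$ is Minkowski space with inner product $-x_0y_0+x_1y_1+x_2y_2+x_3y_3$ in an orthonormal basis, and $\mathbb{H}^3=\{x:(x,x)=-1,\ x_0>0\}$ is hyperbolic space of curvature $-1$. Mean curvature is the mean of the two principal curvatures; the orientation of the unit normal is always chosen such that $H\ge0$. A surface in $\mathbb{H}^3$ is rotational if it is invariant under a 1-parameter group of isometries that acts as the identity on the orthogonal complement of a 2-plane $\Pi_1\subset\mathbb{R}^{3,1}$; the rotation is elliptic, parabolic or hyperbolic if $\Pi_1$ has signature $(++)$, $(+0)$ or $(+-)$, respectively. The sign $\kappa_1\in\{\pm1\}$ in the claim encodes the type of rotation. $\operatorname{sn}_p,\operatorname{cn}_p,\operatorname{dn}_p$ denote the Jacobi elliptic functions with modulus $p$, and $\Pi_p(k;s)=\int_0^s\frac{du}{1-k\,\operatorname{sn}_p^2(u)}$ is the incomplete elliptic integral of the third kind.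
   Formalization: If κ₁=−1 and C⁺=1, √(r²−1) is read as its smooth branch sgn(t)√(r²−1), since the literal root gives only half of a geodesic plane; elliptic rotational surfaces with C=0 (where C⁺=0) are given by the hyperbolic parametrization; surfaces are immersions of connected planar domains. *)

theory Defs
  imports "HOL-Analysis.Analysis"
begin

subsection \<open>Minkowski space and hyperbolic space\<close>

text \<open>The index type \<open>4\<close> is the ring of integers modulo 4, so \<open>0, 1, 2, 3\<close> are its four
  distinct elements.\<close>

definition mink :: "real^4 \<Rightarrow> real^4 \<Rightarrow> real" where
  "mink x y = - (x$0 * y$0) + x$1 * y$1 + x$2 * y$2 + x$3 * y$3"

definition hyperbolic_space :: "(real^4) set" where
  "hyperbolic_space = {x. mink x x = -1 \<and> x$0 > 0}"

definition orthonormal_basis :: "(4 \<Rightarrow> real^4) \<Rightarrow> bool" where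
  "orthonormal_basis e \<longleftrightarrow>
     (\<forall>i j. mink (e i) (e j) = (if i \<noteq> j then 0 else if i = 0 then -1 else 1))"

definition in_basis :: "(4 \<Rightarrow> real^4) \<Rightarrow> real \<Rightarrow> real \<Rightarrow> real \<Rightarrow> real \<Rightarrow> real^4" where
  "in_basis e x0 x1 x2 x3 = x0 *\<^sub>R e 0 + x1 *\<^sub>R e 1 + x2 *\<^sub>R e 2 + x3 *\<^sub>R e 3"

subsection \<open>Immersed surfaces in hyperbolic space and their mean curvature\<close>

definition D1 :: "(real \<times> real \<Rightarrow> real^4) \<Rightarrow> real \<times> real \<Rightarrow> real \<times> real \<Rightarrow> real^4" where
  "D1 f u v = frechet_derivative f (at u) v"

definition D2 :: "(real \<times> real \<Rightarrow> real^4) \<Rightarrow> real \<times> real \<Rightarrow> real \<times> real \<Rightarrow> real \<times> real \<Rightarrow> real^4" where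
  "D2 f u v w = frechet_derivative (\<lambda>x. D1 f x w) (at u) v"

definition twice_cont_diff_on :: "(real \<times> real) set \<Rightarrow> (real \<times> real \<Rightarrow> real^4) \<Rightarrow> bool" where
  "twice_cont_diff_on U f \<longleftrightarrow>
     f differentiable_on U \<and>
     (\<forall>w. (\<lambda>u. D1 f u w) differentiable_on U) \<and>
     (\<forall>v w. continuous_on U (\<lambda>u. D2 f u v w))"

text \<open>A surface is a connected immersed surface; it need not be embedded, since the profile
  curves of rotational surfaces may intersect themselves.\<close>

definition immersed_surface :: "(real \<times> real \<Rightarrow> real^4) \<Rightarrow> (real \<times> real) set \<Rightarrow> bool" where
  "immersed_surface f U \<longleftrightarrow>
     open U \<and> connected U \<and> U \<noteq> {} \<and>
     twice_cont_diff_on U f \<and>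
     (\<forall>u\<in>U. inj (D1 f u)) \<and>
     f ` U \<subseteq> hyperbolic_space"

definition unit_normal_field ::
    "(real \<times> real \<Rightarrow> real^4) \<Rightarrow> (real \<times> real) set \<Rightarrow> (real \<times> real \<Rightarrow> real^4) \<Rightarrow> bool" where
  "unit_normal_field f U n \<longleftrightarrow>
     continuous_on U n \<and>
     (\<forall>u\<in>U. mink (n u) (n u) = 1 \<and> mink (n u) (f u) = 0 \<and> (\<forall>v. mink (n u) (D1 f u v) = 0))"

definition first_form ::
    "(real \<times> real \<Rightarrow> real^4) \<Rightarrow> real \<times> real \<Rightarrow> real \<times> real \<Rightarrow> real \<times> real \<Rightarrow> real" where
  "first_form f u v w = mink (D1 f u v) (D1 f u w)"

text \<open>The normal component in \<open>\<real>\<^sup>4\<close> of the second derivative along \<open>n\<close> is the second fundamental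
  form in hyperbolic space, because \<open>n u\<close> is orthogonal to the position vector \<open>f u\<close>.\<close>

definition second_form ::
    "(real \<times> real \<Rightarrow> real^4) \<Rightarrow> (real \<times> real \<Rightarrow> real^4) \<Rightarrow>
     real \<times> real \<Rightarrow> real \<times> real \<Rightarrow> real \<times> real \<Rightarrow> real" where
  "second_form f n u v w = mink (D2 f u v w) (n u)"

text \<open>The principal curvatures are the eigenvalues of the shape operator, listed with
  multiplicity: a basis of eigenvectors is required.\<close>

definition principal_curvatures ::
    "(real \<times> real \<Rightarrow> real^4) \<Rightarrow> (real \<times> real \<Rightarrow> real^4) \<Rightarrow> real \<times> real \<Rightarrow> real \<Rightarrow> real \<Rightarrow> bool" where
  "principal_curvatures f n u k1 k2 \<longleftrightarrow>
     (\<exists>v1 v2. v1 \<noteq> v2 \<and> independent {v1, v2} \<and>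
        (\<forall>w. second_form f n u v1 w = k1 * first_form f u v1 w) \<and>
        (\<forall>w. second_form f n u v2 w = k2 * first_form f u v2 w))"

definition constant_mean_curvature ::
    "(real \<times> real \<Rightarrow> real^4) \<Rightarrow> (real \<times> real) set \<Rightarrow> real \<Rightarrow> bool" where
  "constant_mean_curvature f U H \<longleftrightarrow>
     (\<exists>n. unit_normal_field f U n \<and>
        (\<forall>u\<in>U. \<exists>k1 k2. principal_curvatures f n u k1 k2 \<and> H = (k1 + k2) / 2))"

definition diffeomorphism :: "(real \<times> real) set \<Rightarrow> (real \<times> real) set \<Rightarrow> (real \<times> real \<Rightarrow> real \<times> real) \<Rightarrow> bool"
  where
  "diffeomorphism U V h \<longleftrightarrow>
     (\<exists>h'. homeomorphism U V h h' \<and> h differentiable_on U \<and> h' differentiable_on V)"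

text \<open>Two parametrizations describe the same surface if they have the same image and one is
  locally a reparametrization of the other. (A global reparametrization need not exist:
  one domain may be an annulus and the other its universal cover.)\<close>

definition same_surface ::
    "(real \<times> real \<Rightarrow> real^4) \<Rightarrow> (real \<times> real) set \<Rightarrow> (real \<times> real \<Rightarrow> real^4) \<Rightarrow> (real \<times> real) set \<Rightarrow> bool"
  where
  "same_surface f U F W \<longleftrightarrow>
     f ` U = F ` W \<and>
     (\<forall>u\<in>U. \<exists>V h. open V \<and> u \<in> V \<and> V \<subseteq> U \<and> open (h ` V) \<and> h ` V \<subseteq> W \<and>
        diffeomorphism V (h ` V) h \<and> (\<forall>x\<in>V. f x = F (h x)))"

subsection \<open>Rotational surfaces\<close>

definition one_parameter_isometry_group :: "(real \<Rightarrow> real^4 \<Rightarrow> real^4) \<Rightarrow> bool" where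
  "one_parameter_isometry_group G \<longleftrightarrow>
     G 0 = id \<and> (\<forall>s t. G (s + t) = G s \<circ> G t) \<and> (\<exists>s. G s \<noteq> id) \<and>
     (\<forall>x. continuous_on UNIV (\<lambda>s. G s x)) \<and>
     (\<forall>s. linear (G s) \<and> (\<forall>x y. mink (G s x) (G s y) = mink x y) \<and>
          G s ` hyperbolic_space \<subseteq> hyperbolic_space)"

definition plane_of_signature :: "real \<Rightarrow> real \<Rightarrow> (real^4) set \<Rightarrow> bool" where
  "plane_of_signature \<sigma> \<tau> P \<longleftrightarrow>
     (\<exists>a b. a \<noteq> b \<and> independent {a, b} \<and> P = span {a, b} \<and>
        mink a a = \<sigma> \<and> mink b b = \<tau> \<and> mink a b = 0)"

definition rotations_in :: "(real^4) set \<Rightarrow> (real \<Rightarrow> real^4 \<Rightarrow> real^4) \<Rightarrow> bool" where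
  "rotations_in P G \<longleftrightarrow>
     one_parameter_isometry_group G \<and>
     (\<forall>x. (\<forall>y\<in>P. mink x y = 0) \<longrightarrow> (\<forall>s. G s x = x))"

text \<open>An isometry leaves an immersed surface invariant if it maps the surface to a
  reparametrization of itself.\<close>

definition invariant_under ::
    "(real \<Rightarrow> real^4 \<Rightarrow> real^4) \<Rightarrow> (real \<times> real \<Rightarrow> real^4) \<Rightarrow> (real \<times> real) set \<Rightarrow> bool" where
  "invariant_under G f U \<longleftrightarrow>
     (\<forall>s. \<exists>\<phi>. diffeomorphism U U \<phi> \<and> (\<forall>u\<in>U. f (\<phi> u) = G s (f u)))"

definition elliptic_rotational :: "(real \<times> real \<Rightarrow> real^4) \<Rightarrow> (real \<times> real) set \<Rightarrow> bool" where
  "elliptic_rotational f U \<longleftrightarrow>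
     (\<exists>P G. plane_of_signature 1 1 P \<and> rotations_in P G \<and> invariant_under G f U)"

definition hyperbolic_rotational :: "(real \<times> real \<Rightarrow> real^4) \<Rightarrow> (real \<times> real) set \<Rightarrow> bool" where
  "hyperbolic_rotational f U \<longleftrightarrow>
     (\<exists>P G. plane_of_signature 1 (-1) P \<and> rotations_in P G \<and> invariant_under G f U)"

subsection \<open>Jacobi elliptic functions and elliptic integrals\<close>

text \<open>The amplitude is the inverse of the elliptic integral of the first kind with modulus \<open>p\<close>.
  The integrability condition is automatic if \<open>0 \<le> p < 1\<close>; for \<open>p = 1\<close> it amounts to
  \<open>\<bar>\<phi>\<bar> < pi / 2\<close> and makes the amplitude the Gudermannian.\<close>

definition jacobi_am :: "real \<Rightarrow> real \<Rightarrow> real" where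
  "jacobi_am p u =
     (THE \<phi>. interval_lebesgue_integrable lborel (ereal 0) (ereal \<phi>) (\<lambda>x. 1 / sqrt (1 - p\<^sup>2 * (sin x)\<^sup>2)) \<and>
             (LBINT x=ereal 0..ereal \<phi>. 1 / sqrt (1 - p\<^sup>2 * (sin x)\<^sup>2)) = u)"

definition jacobi_sn :: "real \<Rightarrow> real \<Rightarrow> real" where
  "jacobi_sn p u = sin (jacobi_am p u)"

definition jacobi_cn :: "real \<Rightarrow> real \<Rightarrow> real" where
  "jacobi_cn p u = cos (jacobi_am p u)"

text \<open>The quarter period, i.e. the first positive zero of \<open>jacobi_cn p\<close> (for \<open>0 \<le> p < 1\<close>).\<close>

definition elliptic_K :: "real \<Rightarrow> real" where
  "elliptic_K p = (LBINT x=ereal 0..ereal (pi / 2). 1 / sqrt (1 - p\<^sup>2 * (sin x)\<^sup>2))"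

definition elliptic_Pi :: "real \<Rightarrow> real \<Rightarrow> real \<Rightarrow> real" where
  "elliptic_Pi p k s = (LBINT u=ereal 0..ereal s. 1 / (1 - k * (jacobi_sn p u)\<^sup>2))"

subsection \<open>The parametrizations\<close>

text \<open>Throughout, \<open>\<kappa> = 1\<close> for elliptic and \<open>\<kappa> = -1\<close> for hyperbolic rotations, \<open>Cp\<close> and \<open>Cm\<close> are
  the two roots \<open>C\<^sup>+\<close> and \<open>C\<^sup>-\<close>, and \<open>p\<close> is the modulus.\<close>

definition poly_C :: "real \<Rightarrow> real \<Rightarrow> real \<Rightarrow> real \<Rightarrow> real" where
  "poly_C \<kappa> H C x = (H\<^sup>2 - 1) * x\<^sup>2 - (\<kappa> + 2 * H * C) * x + C\<^sup>2"

definition Xi :: "real \<Rightarrow> real \<Rightarrow> real \<Rightarrow> real" where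
  "Xi H Cp Cm = sqrt (- (H\<^sup>2 - 1) * (Cp - Cm))"

definition profile_r :: "real \<Rightarrow> real \<Rightarrow> real \<Rightarrow> real \<Rightarrow> real \<Rightarrow> real" where
  "profile_r H Cp Cm p t = sqrt Cp / jacobi_cn p (Xi H Cp Cm * t)"

definition profile_\<psi> :: "real \<Rightarrow> real \<Rightarrow> real \<Rightarrow> real \<Rightarrow> real \<Rightarrow> real \<Rightarrow> real \<Rightarrow> real" where
  "profile_\<psi> \<kappa> H C Cp Cm p t =
     (if Cp + \<kappa> = 0 then H * t
      else C * t - Cp * (C + \<kappa> * H) / (Cp + \<kappa>) * (1 / Xi H Cp Cm) *
             elliptic_Pi p (1 / (\<kappa> * Cp + 1)) (Xi H Cp Cm * t))"

text \<open>For hyperbolic rotations with \<open>Cp = 1\<close> the profile curve passes at \<open>t = 0\<close> through the fixed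
  point \<open>r = 1\<close> of the polar coordinates, where \<open>sqrt (r\<^sup>2 - 1)\<close> has a corner in \<open>t\<close>. The square
  root then has to be read as its smooth branch, which is negative for \<open>t < 0\<close>: with the
  nonnegative one, the curve would turn back at \<open>t = 0\<close>.\<close>

definition profile_\<rho> :: "real \<Rightarrow> real \<Rightarrow> real \<Rightarrow> real \<Rightarrow> real \<Rightarrow> real" where
  "profile_\<rho> H Cp Cm p t =
     (if Cp = 1 then sgn t else 1) * sqrt ((profile_r H Cp Cm p t)\<^sup>2 - 1)"

definition elliptic_param ::
    "(4 \<Rightarrow> real^4) \<Rightarrow> real \<Rightarrow> real \<Rightarrow> real \<Rightarrow> real \<Rightarrow> real \<Rightarrow> real \<times> real \<Rightarrow> real^4" where
  "elliptic_param e H C Cp Cm p = (\<lambda>(\<theta>, t).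
     let r = profile_r H Cp Cm p t; \<psi> = profile_\<psi> 1 H C Cp Cm p t
     in in_basis e (sqrt (1 + r\<^sup>2) * cosh \<psi>) (sqrt (1 + r\<^sup>2) * sinh \<psi>) (r * cos \<theta>) (r * sin \<theta>))"

definition hyperbolic_param ::
    "(4 \<Rightarrow> real^4) \<Rightarrow> real \<Rightarrow> real \<Rightarrow> real \<Rightarrow> real \<Rightarrow> real \<Rightarrow> real \<times> real \<Rightarrow> real^4" where
  "hyperbolic_param e H C Cp Cm p = (\<lambda>(\<theta>, t).
     let r = profile_r H Cp Cm p t; \<psi> = profile_\<psi> (-1) H C Cp Cm p t; \<rho> = profile_\<rho> H Cp Cm p t
     in in_basis e (r * cosh \<theta>) (r * sinh \<theta>) (\<rho> * cos \<psi>) (\<rho> * sin \<psi>))"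

text \<open>The angle \<open>\<theta>\<close> ranges over all reals, and \<open>t\<close> over the interval around \<open>0\<close> between the
  poles of \<open>r\<close>.\<close>

definition param_domain :: "real \<Rightarrow> real \<Rightarrow> real \<Rightarrow> real \<Rightarrow> (real \<times> real) set" where
  "param_domain H Cp Cm p = {(\<theta>, t). \<bar>Xi H Cp Cm * t\<bar> < elliptic_K p}"

definition admissible :: "real \<Rightarrow> real \<Rightarrow> real \<Rightarrow> real \<Rightarrow> real \<Rightarrow> real \<Rightarrow> bool" where
  "admissible \<kappa> H C Cp Cm p \<longleftrightarrow>
     0 < Cp \<and> Cm \<le> 0 \<and> poly_C \<kappa> H C Cp = 0 \<and> poly_C \<kappa> H C Cm = 0 \<and>
     0 \<le> p \<and> p \<le> 1 \<and> p\<^sup>2 = - Cm / (Cp - Cm)"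

text \<open>A rotational surface need not be complete, so it is described by the restriction of the
  parametrization to a connected open part \<open>W\<close> of its domain.\<close>

definition given_by_elliptic_param ::
    "real \<Rightarrow> real \<Rightarrow> (real \<times> real \<Rightarrow> real^4) \<Rightarrow> (real \<times> real) set \<Rightarrow> bool" where
  "given_by_elliptic_param H C f U \<longleftrightarrow>
     (\<exists>e Cp Cm p W. orthonormal_basis e \<and> admissible 1 H C Cp Cm p \<and>
        open W \<and> connected W \<and> W \<subseteq> param_domain H Cp Cm p \<and>
        same_surface f U (elliptic_param e H C Cp Cm p) W)"

definition given_by_hyperbolic_param ::
    "real \<Rightarrow> real \<Rightarrow> (real \<times> real \<Rightarrow> real^4) \<Rightarrow> (real \<times> real) set \<Rightarrow> bool" where
  "given_by_hyperbolic_param H C f U \<longleftrightarrow>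
     (\<exists>e Cp Cm p W. orthonormal_basis e \<and> admissible (-1) H C Cp Cm p \<and>
        open W \<and> connected W \<and> W \<subseteq> param_domain H Cp Cm p \<and>
        same_surface f U (hyperbolic_param e H C Cp Cm p) W)"

end

theory Submission
  imports Defs
begin

text \<open>Since the infinitesimal rotation \<open>\<xi>\<close> is tangent to the surface, it gives an orthonormal frame of
  position, normal, \<open>\<xi>\<close> and a fourth vector, in which all derivatives of \<open>f\<close> and of the normal \<open>n\<close> are
  determined by the mean curvature. With \<open>\<kappa> r\<^sup>2\<close> the square of the component of \<open>f\<close> in the plane of
  rotation and \<open>a\<close> its product with \<open>n\<close>, the Weingarten equations say that
  \<open>C = \<kappa> a + H r\<^sup>2\<close> is constant. Hence the derivative of \<open>r\<^sup>2\<close> along the profile curve is given by the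
  polynomial \<open>p_C\<close>, and it is integrated by \<open>cn\<close> in terms of the arc length divided by \<open>r\<close>; the polar angle
  in the orthogonal plane has derivative \<open>a / (r\<^sup>2 + \<kappa>)\<close>, which is that of \<open>\<psi>\<close>, so both differ by a
  constant that a change of basis absorbs. An elliptic rotational surface with \<open>C = 0\<close> is totally
  umbilic, therefore also a hyperbolic rotational surface.\<close>

text \<open>No profile curve is ever chosen. The differential of \<open>f\<close> is
  \<open>\<beta>\<close> times \<open>xi\<close> plus \<open>\<tau>\<close> times \<open>T\<close>,
  and the parameters are functions on \<open>U\<close> with differentials \<open>\<beta>\<close> and
  \<open>\<tau>\<close>, so that \<open>(\<theta>, t)\<close> is a local diffeomorphism. Time is
  read off from \<open>b\<close>, half the logarithmic derivative of \<open>r2\<close>, because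
  \<open>r2\<close> itself is critical where it is minimal and determines \<open>t\<close> only up
  to sign. Tangency of \<open>xi\<close> is not immediate: invariance provides for every
  \<open>s\<close> some diffeomorphism, with no relation between different \<open>s\<close>. Nor is
  the normal assumed differentiable; this has to come from the regularity of \<open>f\<close>. The
  case distinctions stem from degenerations. For \<open>k = -1\<close> and \<open>Cp = 1\<close> the
  polar angle in the complement is undefined at \<open>r2 = 1\<close>. For elliptic rotations
  \<open>U\<close> may be an annulus, so \<open>\<theta>\<close> exists only locally, and invariance
  is needed again to fill whole circles.\<close>

section \<open>Linear algebra of Minkowski space\<close>

lemma mink_commute: "mink x y = mink y x"
  by (simp add: mink_def mult.commute)

lemma mink_add_left: "mink (x + y) z = mink x z + mink y z"
  and mink_add_right: "mink x (y + z) = mink x y + mink x z"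
  and mink_diff_left: "mink (x - y) z = mink x z - mink y z"
  and mink_diff_right: "mink x (y - z) = mink x y - mink x z"
  and mink_minus_left: "mink (- x) z = - mink x z"
  and mink_minus_right: "mink x (- z) = - mink x z"
  and mink_scaleR_left: "mink (c *\<^sub>R x) y = c * mink x y"
  and mink_scaleR_right: "mink x (c *\<^sub>R y) = c * mink x y"
  and mink_zero_left: "mink 0 x = 0"
  and mink_zero_right: "mink x 0 = 0"
  by (simp_all add: mink_def algebra_simps)

lemmas mink_simps = mink_add_left mink_add_right mink_diff_left mink_diff_right
  mink_minus_left mink_minus_right mink_scaleR_left mink_scaleR_right mink_zero_left mink_zero_right

text \<open>\<open>sum_4\<close> and \<open>forall_4\<close> list the indices as 1, 2, 3, 4, whereas
  \<open>mink\<close> starts at 0; in the type \<open>4\<close> these ends coincide.\<close>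

lemma vec_nth_4: "x $ (4 :: 4) = x $ 0"
  by (rule arg_cong[where f = "($) x"]) simp

text \<open>Transfers facts about the Euclidean product, such as definiteness and componentwise
  differentiability, to \<open>mink\<close>.\<close>

lemma inner_eq_mink: "x \<bullet> y = mink x (\<chi> i. if i = 0 then - y $ i else y $ i)"
  by (simp add: inner_vec_def sum_4 mink_def vec_nth_4)

lemma bounded_bilinear_mink: "bounded_bilinear mink"
proof
  show "mink (x + y) z = mink x z + mink y z" "mink x (y + z) = mink x y + mink x z"
    "mink (c *\<^sub>R x) y = c *\<^sub>R mink x y" "mink x (c *\<^sub>R y) = c *\<^sub>R mink x y" for x y z c
    by (simp_all add: mink_simps)
  have "norm (mink x y) \<le> norm x * norm y * 4" for x y
  proof -
    have *: "\<bar>x$i * y$i\<bar> \<le> norm x * norm y" for i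
      unfolding abs_mult by (intro mult_mono component_le_norm_cart) auto
    show ?thesis
      using *[of 0] *[of 1] *[of 2] *[of 3] unfolding mink_def by (simp add: abs_le_iff)
  qed
  then show "\<exists>K. \<forall>x y. norm (mink x y) \<le> norm x * norm y * K"
    by blast
qed

interpretation mink: bounded_bilinear mink
  by (rule bounded_bilinear_mink)

lemmas has_derivative_mink [derivative_intros] = mink.FDERIV
lemmas continuous_on_mink [continuous_intros] = mink.continuous_on

lemma mink_nondegenerate:
  assumes "\<And>y. mink x y = 0"
  shows "x = 0"
  using assms by (metis inner_eq_mink inner_eq_zero_iff)

text \<open>Lagrange's identity: the difference of the two sides is the squared length of the cross
  product.\<close>

lemma spatial_Cauchy_Schwarz:
  fixes x y :: "real^4"
  shows "(x$1 * y$1 + x$2 * y$2 + x$3 * y$3)\<^sup>2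
    \<le> ((x$1)\<^sup>2 + (x$2)\<^sup>2 + (x$3)\<^sup>2) * ((y$1)\<^sup>2 + (y$2)\<^sup>2 + (y$3)\<^sup>2)"
proof -
  have "((x$1)\<^sup>2 + (x$2)\<^sup>2 + (x$3)\<^sup>2) * ((y$1)\<^sup>2 + (y$2)\<^sup>2 + (y$3)\<^sup>2) - (x$1 * y$1 + x$2 * y$2 + x$3 * y$3)\<^sup>2
    = (x$1*y$2 - x$2*y$1)\<^sup>2 + (x$1*y$3 - x$3*y$1)\<^sup>2 + (x$2*y$3 - x$3*y$2)\<^sup>2"
    by (simp add: power2_eq_square algebra_simps)
  then show ?thesis
    by (smt (verit) zero_le_power2)
qed

text \<open>Orthogonality reads \<open>x$0 * y$0 = c\<close>, so Cauchy-Schwarz for the spatial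
  parts gives \<open>(1 + a) * (y$0)\<^sup>2 \<le> a * b\<close>, which is strictly less than
  \<open>(1 + a) * b\<close>.\<close>

lemma mink_orthogonal_timelike_pos:
  assumes "mink x x = -1" "mink y x = 0" "y \<noteq> 0"
  shows "mink y y > 0"
proof -
  define a where "a = (x$1)\<^sup>2 + (x$2)\<^sup>2 + (x$3)\<^sup>2"
  define b where "b = (y$1)\<^sup>2 + (y$2)\<^sup>2 + (y$3)\<^sup>2"
  define c where "c = x$1 * y$1 + x$2 * y$2 + x$3 * y$3"
  have 1: "(x$0)\<^sup>2 = 1 + a" and 2: "x$0 * y$0 = c"
    using assms by (auto simp: mink_def a_def c_def power2_eq_square algebra_simps)
  have 3: "c\<^sup>2 \<le> a * b"
    unfolding a_def b_def c_def by (rule spatial_Cauchy_Schwarz)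
  have 4: "(1 + a) * (y$0)\<^sup>2 = c\<^sup>2"
    using 1 2 by (metis power_mult_distrib)
  have a: "0 \<le> a" "0 \<le> b"
    by (simp_all add: a_def b_def)
  have b: "0 < b"
  proof (rule ccontr)
    assume "\<not> 0 < b"
    then have b0: "b = 0" using a by simp
    then have "y$1 = 0" "y$2 = 0" "y$3 = 0"
      by (auto simp: b_def add_nonneg_eq_0_iff)
    moreover have "y$0 = 0"
      using 3 4 a b0 by auto
    ultimately have "y = 0"
      by (simp add: vec_eq_iff forall_4 vec_nth_4)
    then show False using assms by simp
  qed
  have "(1 + a) * (y$0)\<^sup>2 < (1 + a) * b"
    using 3 4 a b by (simp add: algebra_simps)
  then have "(y$0)\<^sup>2 < b"
    using a by (simp add: mult_less_cancel_left)
  then show ?thesis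
    by (simp add: mink_def b_def power2_eq_square)
qed

lemma mink_in_basis_right:
  "mink x (in_basis e x0 x1 x2 x3) = x0 * mink x (e 0) + x1 * mink x (e 1) + x2 * mink x (e 2) + x3 * mink x (e 3)"
  by (simp add: in_basis_def mink_simps)

lemma orthonormal_basis_mink:
  assumes "orthonormal_basis e"
  shows "mink (e i) (e j) = (if i \<noteq> j then 0 else if i = 0 then -1 else 1)"
  using assms by (auto simp: orthonormal_basis_def)

lemma orthonormal_basisI:
  assumes "mink (e 0) (e 0) = -1" "mink (e 1) (e 1) = 1" "mink (e 2) (e 2) = 1" "mink (e 3) (e 3) = 1"
    "mink (e 0) (e 1) = 0" "mink (e 0) (e 2) = 0" "mink (e 0) (e 3) = 0"
    "mink (e 1) (e 2) = 0" "mink (e 1) (e 3) = 0" "mink (e 2) (e 3) = 0"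
  shows "orthonormal_basis e"
proof -
  have U: "i = 0 \<or> i = 1 \<or> i = 2 \<or> i = 3" for i :: 4
    using exhaust_4[of i] by auto
  show ?thesis
    unfolding orthonormal_basis_def
  proof (intro allI)
    fix i j :: 4
    show "mink (e i) (e j) = (if i \<noteq> j then 0 else if i = 0 then -1 else 1)"
      using U[of i] U[of j] assms by (elim disjE) (simp_all add: mink_commute)
  qed
qed

text \<open>Products with the basis vectors recover the coefficients, so the coordinate map is
  injective and, by dimension, onto.\<close>

lemma orthonormal_basis_expansion:
  assumes "orthonormal_basis e"
  shows "x = in_basis e (- mink x (e 0)) (mink x (e 1)) (mink x (e 2)) (mink x (e 3))"
proof -
  define L :: "real^4 \<Rightarrow> real^4" where "L c = in_basis e (c$0) (c$1) (c$2) (c$3)" for c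
  have lin: "linear L"
    by (rule linearI) (simp_all add: L_def in_basis_def algebra_simps)
  have coord: "mink (L c) (e 0) = - c$0" "mink (L c) (e 1) = c$1"
    "mink (L c) (e 2) = c$2" "mink (L c) (e 3) = c$3" for c
    by (simp_all add: L_def mink_commute[of "in_basis _ _ _ _ _"] mink_in_basis_right
        orthonormal_basis_mink[OF assms])
  have "inj L"
  proof (subst linear_injective_0[OF lin], intro allI impI)
    fix c assume "L c = 0"
    then show "c = 0"
      using coord[of c] by (simp only: mink_simps) (simp add: vec_eq_iff forall_4 vec_nth_4)
  qed
  then have "surj L"
    using lin linear_injective_imp_surjective by blast
  then obtain c where "x = L c"
    by (metis surjD)
  then show ?thesis
    using coord[of c] by (simp add: L_def)
qed

text \<open>Three linear conditions in dimension 4: collected into an endomorphism whose component 0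
  vanishes, they cannot be surjective, hence not injective.\<close>

lemma exists_orthogonal_to_three:
  "\<exists>x. x \<noteq> 0 \<and> mink x a = 0 \<and> mink x b = 0 \<and> mink x c = 0"
proof (rule ccontr)
  assume neg: "\<not> ?thesis"
  define L :: "real^4 \<Rightarrow> real^4" where
    "L x = mink x a *\<^sub>R axis 1 1 + mink x b *\<^sub>R axis 2 1 + mink x c *\<^sub>R axis 3 1" for x
  have lin: "linear L"
    by (rule linearI) (simp_all add: L_def mink_simps algebra_simps)
  have comp: "L x $ 0 = 0" "L x $ 1 = mink x a" "L x $ 2 = mink x b" "L x $ 3 = mink x c" for x
    by (simp_all add: L_def axis_def)
  have "inj L"
  proof (subst linear_injective_0[OF lin], intro allI impI)
    fix x assume "L x = 0"
    then show "x = 0"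
      using comp[of x] neg by (metis zero_index)
  qed
  then have "surj L"
    using lin linear_injective_imp_surjective by blast
  then obtain x where "L x = axis 0 1"
    by (metis surjD)
  then show False
    using comp(1)[of x] by (simp add: axis_def)
qed

lemma exists_unit_orthogonal_to_three:
  assumes "mink a a = -1"
  shows "\<exists>x. mink x x = 1 \<and> mink x a = 0 \<and> mink x b = 0 \<and> mink x c = 0"
proof -
  obtain x where x: "x \<noteq> 0" "mink x a = 0" "mink x b = 0" "mink x c = 0"
    using exists_orthogonal_to_three by blast
  have pos: "mink x x > 0"
    using mink_orthogonal_timelike_pos[OF assms x(2) x(1)] .
  define y where "y = (1 / sqrt (mink x x)) *\<^sub>R x"
  have "mink y y = 1"
    using pos by (simp add: y_def mink_simps field_simps flip: power2_eq_square)
  then show ?thesis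
    using x by (intro exI[of _ y]) (simp add: y_def mink_simps)
qed

lemma orthonormal_basis_mink_expansion:
  assumes "orthonormal_basis e"
  shows "mink x y = - mink x (e 0) * mink y (e 0) + mink x (e 1) * mink y (e 1)
    + mink x (e 2) * mink y (e 2) + mink x (e 3) * mink y (e 3)"
  by (subst orthonormal_basis_expansion[OF assms, of y]) (simp add: mink_in_basis_right)

text \<open>Reversed Cauchy-Schwarz for two points of hyperbolic space. It makes the timelike
  coordinate of the surface positive, as the hyperbolic angle requires.\<close>

lemma mink_future_neg:
  assumes "mink x x = -1" "x $ 0 > 0" "mink y y = -1" "y $ 0 > 0"
  shows "mink x y < 0"
proof -
  define a where "a = (x$1)\<^sup>2 + (x$2)\<^sup>2 + (x$3)\<^sup>2"
  define b where "b = (y$1)\<^sup>2 + (y$2)\<^sup>2 + (y$3)\<^sup>2"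
  define c where "c = x$1 * y$1 + x$2 * y$2 + x$3 * y$3"
  have 1: "(x$0)\<^sup>2 = 1 + a" "(y$0)\<^sup>2 = 1 + b"
    using assms by (auto simp: mink_def a_def b_def power2_eq_square algebra_simps)
  have "c\<^sup>2 \<le> a * b"
    unfolding a_def b_def c_def by (rule spatial_Cauchy_Schwarz)
  also have "\<dots> < (1 + a) * (1 + b)"
  proof -
    have "0 \<le> a" "0 \<le> b"
      by (simp_all add: a_def b_def)
    then show ?thesis by (simp add: algebra_simps)
  qed
  also have "\<dots> = (x$0 * y$0)\<^sup>2"
    by (simp add: 1 power_mult_distrib)
  finally have "c < x$0 * y$0"
    using assms by (intro power2_less_imp_less[of c]) auto
  then show ?thesis
    by (simp add: mink_def c_def)
qed

text \<open>Gram-Schmidt applied to the standard timelike vector \<open>E\<close>: subtracting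
  spacelike components only makes the square more negative and keeps the time component positive.
  The alternative \<open>b = 0\<close> covers a single spacelike vector.\<close>

lemma exists_future_orthogonal:
  assumes a: "mink a a = 1" and b: "mink b b = 1 \<or> b = 0" and ab: "mink a b = 0"
  shows "\<exists>x. mink x x = -1 \<and> x $ 0 > 0 \<and> mink x a = 0 \<and> mink x b = 0"
proof -
  define E :: "real^4" where "E = axis 0 1"
  have E: "mink E E = -1" "mink y E = - y $ 0" for y
    by (simp_all add: E_def mink_def axis_def)
  define x where "x = E - mink E a *\<^sub>R a - mink E b *\<^sub>R b"
  have xa: "mink x a = 0" and xb: "mink x b = 0"
    using a b ab by (auto simp: x_def mink_simps mink_commute)
  have xx: "mink x x = mink x E"
    by (subst (2) x_def) (simp add: mink_simps xa xb)
  have "mink x E = -1 - (mink E a)\<^sup>2 - (mink E b)\<^sup>2"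
    by (simp add: x_def mink_simps E(1) mink_commute[of a E] mink_commute[of b E] power2_eq_square)
  then have neg: "mink x E < 0"
    by (smt (verit) zero_le_power2)
  define s where "s = sqrt (- mink x x)"
  have s: "s > 0" "s * s = - mink x x"
    using neg xx by (auto simp: s_def)
  have "mink ((1 / s) *\<^sub>R x) ((1 / s) *\<^sub>R x) = -1"
    using s neg xx by (simp add: mink_simps field_simps)
  moreover have "((1 / s) *\<^sub>R x) $ 0 > 0"
    using neg s by (simp add: E(2))
  ultimately show ?thesis
    using xa xb by (intro exI[of _ "(1 / s) *\<^sub>R x"]) (simp add: mink_simps)
qed

lemma mink_eq_zero_commute: "mink x y = 0 \<Longrightarrow> mink y x = 0"
  by (simp add: mink_commute)

lemma exists_basis_spacelike_plane:
  assumes "mink a a = 1" "mink b b = 1" "mink a b = 0"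
  shows "\<exists>e. orthonormal_basis e \<and> e 2 = a \<and> e 3 = b \<and> e 0 $ 0 > 0"
proof -
  obtain x where x: "mink x x = -1" "x $ 0 > 0" "mink x a = 0" "mink x b = 0"
    using exists_future_orthogonal[of a b] assms by blast
  obtain y where y: "mink y y = 1" "mink y x = 0" "mink y a = 0" "mink y b = 0"
    using exists_unit_orthogonal_to_three[OF x(1)] by blast
  define e where "e i = (if i = 0 then x else if i = 1 then y else if i = 2 then a else b)" for i :: 4
  have e: "e 0 = x" "e 1 = y" "e 2 = a" "e 3 = b"
    by (simp_all add: e_def)
  have "orthonormal_basis e"
    using x y assms by (intro orthonormal_basisI) (simp_all add: e mink_eq_zero_commute)
  then show ?thesis
    using x e by auto
qed

text \<open>The timelike \<open>b\<close> may point to the past, hence the choice of sign.\<close>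

lemma exists_basis_lorentzian_plane:
  assumes "mink a a = 1" "mink b b = -1" "mink a b = 0"
  shows "\<exists>e. orthonormal_basis e \<and> (e 0 = b \<or> e 0 = - b) \<and> e 1 = a \<and> e 0 $ 0 > 0"
proof -
  have "b $ 0 \<noteq> 0"
    using assms(2) by (auto simp: mink_def) (smt (verit) zero_le_square)
  then obtain x where x: "x = b \<or> x = - b" "x $ 0 > 0"
    by (metis neg_0_less_iff_less linorder_neqE vector_uminus_component)
  then have xx: "mink x x = -1" "mink a x = 0"
    using assms by (auto simp: mink_simps)
  obtain y where y: "mink y y = 1" "mink y x = 0" "mink y a = 0"
    using exists_unit_orthogonal_to_three[OF xx(1)] by blast
  obtain z where z: "mink z z = 1" "mink z x = 0" "mink z a = 0" "mink z y = 0"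
    using exists_unit_orthogonal_to_three[OF xx(1)] by blast
  define e where "e i = (if i = 0 then x else if i = 1 then a else if i = 2 then y else z)" for i :: 4
  have e: "e 0 = x" "e 1 = a" "e 2 = y" "e 3 = z"
    by (simp_all add: e_def)
  have "orthonormal_basis e"
    using x xx y z assms by (intro orthonormal_basisI) (simp_all add: e mink_eq_zero_commute)
  then show ?thesis
    using x e by auto
qed

subsection \<open>Surfaces and their normals\<close>

text \<open>Schwarz's theorem: the second difference over a small parallelogram is symmetric in
  \<open>v\<close> and \<open>w\<close>, and the mean value theorem, applied twice, writes it as
  \<open>h\<^sup>2\<close> times a mixed derivative at a nearby point, in either order.\<close>

lemma second_derivative_symmetric:
  fixes g :: "'a::real_normed_vector \<Rightarrow> real"
  assumes U: "open U" "u \<in> U"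
    and g': "\<And>x. x \<in> U \<Longrightarrow> (g has_derivative g' x) (at x)"
    and g'': "\<And>x w. x \<in> U \<Longrightarrow> ((\<lambda>y. g' y w) has_derivative (\<lambda>v. g'' x v w)) (at x)"
    and cont: "\<And>v w. continuous_on U (\<lambda>x. g'' x v w)"
  shows "g'' u v w = g'' u w v"
proof -
  have second_difference: "\<exists>s t. 0 < s \<and> s < h \<and> 0 < t \<and> t < h \<and>
      g (u + h *\<^sub>R v + h *\<^sub>R w) - g (u + h *\<^sub>R v) - g (u + h *\<^sub>R w) + g u
        = h\<^sup>2 * g'' (u + s *\<^sub>R v + t *\<^sub>R w) w v"
    if h: "0 < h" and sub: "\<And>s t. 0 \<le> s \<Longrightarrow> s \<le> h \<Longrightarrow> 0 \<le> t \<Longrightarrow> t \<le> h \<Longrightarrow> u + s *\<^sub>R v + t *\<^sub>R w \<in> U"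
    for h v w
  proof -
    have subs: "u + s *\<^sub>R v \<in> U" if "0 \<le> s" "s \<le> h" for s
      using sub[of s 0] that h by simp
    have scale: "g' x (s *\<^sub>R y) = s * g' x y" "g'' x (s *\<^sub>R y) z = s * g'' x y z" if "x \<in> U" for x s y z
      using linear_scale[OF bounded_linear.linear[OF has_derivative_bounded_linear[OF g'[OF that]]]]
        linear_scale[OF bounded_linear.linear[OF has_derivative_bounded_linear[OF g''[OF that]]]]
      by auto
    have "\<exists>s>0. s < h \<and> (g (u + h *\<^sub>R v + h *\<^sub>R w) - g (u + h *\<^sub>R v)) - (g (u + 0 *\<^sub>R v + h *\<^sub>R w) - g (u + 0 *\<^sub>R v))
      = (h - 0) * (g' (u + s *\<^sub>R v + h *\<^sub>R w) v - g' (u + s *\<^sub>R v) v)"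
    proof (rule MVT2[OF h])
      fix s assume s: "0 \<le> s" "s \<le> h"
      have 1: "((\<lambda>s. g (u + s *\<^sub>R v + h *\<^sub>R w)) has_derivative (\<lambda>y. g' (u + s *\<^sub>R v + h *\<^sub>R w) (y *\<^sub>R v))) (at s)"
        by (rule has_derivative_compose[OF _ g']) (use s sub h in \<open>auto intro!: derivative_eq_intros\<close>)
      have 2: "((\<lambda>s. g (u + s *\<^sub>R v)) has_derivative (\<lambda>y. g' (u + s *\<^sub>R v) (y *\<^sub>R v))) (at s)"
        by (rule has_derivative_compose[OF _ g']) (use s subs h in \<open>auto intro!: derivative_eq_intros\<close>)
      show "((\<lambda>s. g (u + s *\<^sub>R v + h *\<^sub>R w) - g (u + s *\<^sub>R v)) has_real_derivative
          g' (u + s *\<^sub>R v + h *\<^sub>R w) v - g' (u + s *\<^sub>R v) v) (at s)"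
        unfolding has_field_derivative_def
        by (rule has_derivative_eq_rhs[OF has_derivative_diff[OF 1 2]])
          (use s h scale(1)[OF sub[of s h]] scale(1)[OF subs[of s]] in
            \<open>simp add: fun_eq_iff left_diff_distrib right_diff_distrib mult.commute\<close>)
    qed
    then obtain s where s: "0 < s" "s < h" and
      1: "g (u + h *\<^sub>R v + h *\<^sub>R w) - g (u + h *\<^sub>R v) - g (u + h *\<^sub>R w) + g u
        = h * (g' (u + s *\<^sub>R v + h *\<^sub>R w) v - g' (u + s *\<^sub>R v) v)"
      by auto
    have "\<exists>t>0. t < h \<and> g' (u + s *\<^sub>R v + h *\<^sub>R w) v - g' (u + s *\<^sub>R v + 0 *\<^sub>R w) v
      = (h - 0) * g'' (u + s *\<^sub>R v + t *\<^sub>R w) w v"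
    proof (rule MVT2[OF h])
      fix t assume t: "0 \<le> t" "t \<le> h"
      have "((\<lambda>t. g' (u + s *\<^sub>R v + t *\<^sub>R w) v) has_derivative (\<lambda>y. g'' (u + s *\<^sub>R v + t *\<^sub>R w) (y *\<^sub>R w) v)) (at t)"
        by (rule has_derivative_compose[OF _ g'']) (use s t sub h in \<open>auto intro!: derivative_eq_intros\<close>)
      then show "((\<lambda>t. g' (u + s *\<^sub>R v + t *\<^sub>R w) v) has_real_derivative g'' (u + s *\<^sub>R v + t *\<^sub>R w) w v) (at t)"
        unfolding has_field_derivative_def
        by (rule has_derivative_eq_rhs) (use s t h scale[OF sub[of s t]] in \<open>simp add: fun_eq_iff\<close>)
    qed
    then show ?thesis
      using s 1 by (auto simp: power2_eq_square)
  qed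
  have "\<bar>g'' u v w - g'' u w v\<bar> \<le> e" if e: "e > 0" for e
  proof -
    have "isCont (\<lambda>x. g'' x v w) u" "isCont (\<lambda>x. g'' x w v) u"
      using cont U continuous_on_eq_continuous_at by blast+
    then obtain d1 d2 where d: "d1 > 0" "d2 > 0"
      "\<And>x. norm (x - u) < d1 \<Longrightarrow> \<bar>g'' x v w - g'' u v w\<bar> < e / 2"
      "\<And>x. norm (x - u) < d2 \<Longrightarrow> \<bar>g'' x w v - g'' u w v\<bar> < e / 2"
      using e half_gt_zero[OF e] unfolding continuous_at_eps_delta dist_norm real_norm_def by metis
    obtain d3 where d3: "d3 > 0" "ball u d3 \<subseteq> U"
      using U by (meson open_contains_ball)
    define d where "d = min d1 (min d2 d3)"
    \<comment> \<open>Small enough to keep the parallelogram within distance \<open>d\<close> of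
      \<open>u\<close>; the summand 1 covers \<open>v = w = 0\<close>.\<close>
    define h where "h = d / (2 * (norm v + norm w + 1))"
    have X: "norm v + norm w + 1 > 0"
      by (simp add: add_nonneg_pos)
    have dpos: "d > 0" using d d3 by (simp add: d_def)
    then have h: "h > 0"
      by (simp add: h_def add_nonneg_pos)
    have small: "norm ((u + s *\<^sub>R v + t *\<^sub>R w) - u) < d" if "0 \<le> s" "s \<le> h" "0 \<le> t" "t \<le> h" for s t
    proof -
      have "norm ((u + s *\<^sub>R v + t *\<^sub>R w) - u) \<le> s * norm v + t * norm w"
        using norm_triangle_ineq[of "s *\<^sub>R v" "t *\<^sub>R w"] that by (simp add: algebra_simps)
      also have "\<dots> \<le> h * norm v + h * norm w"
        by (intro add_mono mult_right_mono) (use that in auto)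
      also have "\<dots> \<le> h * (norm v + norm w + 1)"
        using h by (simp add: algebra_simps)
      also have "\<dots> = d / 2"
      proof -
        have "d / (2 * y) * y = d / 2" if "y > 0" for y :: real
          using that by simp
        from this[OF X] show ?thesis
          by (simp add: h_def)
      qed
      also have "\<dots> < d" using dpos by simp
      finally show ?thesis .
    qed
    have sub: "u + s *\<^sub>R v + t *\<^sub>R w \<in> U" if "0 \<le> s" "s \<le> h" "0 \<le> t" "t \<le> h" for s t
    proof -
      have "u + s *\<^sub>R v + t *\<^sub>R w \<in> ball u d3"
        using small[OF that] by (simp only: mem_ball dist_norm d_def norm_minus_commute[of u])
      then show ?thesis
        using d3 by blast
    qed
    obtain s t where st: "0 < s" "s < h" "0 < t" "t < h"
      "g (u + h *\<^sub>R v + h *\<^sub>R w) - g (u + h *\<^sub>R v) - g (u + h *\<^sub>R w) + g u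
        = h\<^sup>2 * g'' (u + s *\<^sub>R v + t *\<^sub>R w) w v"
      using second_difference[OF h, of v w] sub by blast
    have sub': "u + s *\<^sub>R w + t *\<^sub>R v \<in> U" if "0 \<le> s" "s \<le> h" "0 \<le> t" "t \<le> h" for s t
      using sub[of t s] that by (simp add: algebra_simps)
    obtain s' t' where st': "0 < s'" "s' < h" "0 < t'" "t' < h"
      "g (u + h *\<^sub>R w + h *\<^sub>R v) - g (u + h *\<^sub>R w) - g (u + h *\<^sub>R v) + g u
        = h\<^sup>2 * g'' (u + s' *\<^sub>R w + t' *\<^sub>R v) v w"
      using second_difference[OF h, of w v] sub' by blast
    have comm: "u + h *\<^sub>R w + h *\<^sub>R v = u + h *\<^sub>R v + h *\<^sub>R w"
      by (simp add: algebra_simps)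
    have "h\<^sup>2 * g'' (u + s *\<^sub>R v + t *\<^sub>R w) w v = h\<^sup>2 * g'' (u + s' *\<^sub>R w + t' *\<^sub>R v) v w"
      using st(5) st'(5) unfolding comm by linarith
    then have eq: "g'' (u + s *\<^sub>R v + t *\<^sub>R w) w v = g'' (u + t' *\<^sub>R v + s' *\<^sub>R w) v w"
      using h by (simp add: algebra_simps)
    have "norm ((u + s *\<^sub>R v + t *\<^sub>R w) - u) < d2" "norm ((u + t' *\<^sub>R v + s' *\<^sub>R w) - u) < d1"
      using small[of s t] small[of t' s'] st st' by (simp_all add: d_def)
    then show ?thesis
      using d(3)[of "u + t' *\<^sub>R v + s' *\<^sub>R w"] d(4)[of "u + s *\<^sub>R v + t *\<^sub>R w"] eq by linarith
  qed
  then have "\<bar>g'' u v w - g'' u w v\<bar> \<le> 0"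
    by (rule field_le_epsilon[of _ 0, simplified])
  then show ?thesis by simp
qed

text \<open>No differentiability of the continuous factor is needed, because the other one vanishes.\<close>

lemma (in bounded_bilinear) has_derivative_continuous_vanishing:
  assumes n: "isCont n u" and g: "(g has_derivative g') (at u)" "g u = 0"
  shows "((\<lambda>x. prod (n x) (g x)) has_derivative (\<lambda>v. prod (n u) (g' v))) (at u)"
proof -
  obtain K where K: "K > 0" "\<And>a b. norm (prod a b) \<le> norm a * norm b * K"
    using pos_bounded by blast
  obtain B where B: "\<And>v. norm (g' v) \<le> norm v * B"
    using bounded_linear.bounded[OF has_derivative_bounded_linear[OF g(1)]] by blast
  have lim: "((\<lambda>y. norm ((g y - g u) - g' (y - u)) / norm (y - u)) \<longlongrightarrow> 0) (at u)"
    using g(1) by (simp add: has_derivative_iff_norm)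
  have nlim: "((\<lambda>y. norm (n y - n u)) \<longlongrightarrow> 0) (at u)"
    using n by (simp add: isCont_def LIM_zero tendsto_norm_zero)
  \<comment> \<open>The first factor tends to 0 and \<open>g x\<close> is at most a constant times
    \<open>norm (x - u)\<close> near \<open>u\<close>, so the product is of smaller order.\<close>
  have zero: "((\<lambda>x. prod (n x - n u) (g x)) has_derivative (\<lambda>v. 0)) (at u)"
  proof (rule has_derivativeI_sandwich[where e=1])
    fix y assume y: "y \<noteq> u"
    have "norm (g y) \<le> norm ((g y - g u) - g' (y - u)) + norm (g' (y - u))"
      using norm_triangle_ineq[of "(g y - g u) - g' (y - u)" "g' (y - u)"] g(2) by simp
    also have "\<dots> \<le> norm ((g y - g u) - g' (y - u)) + norm (y - u) * B"
      using B by simp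
    finally have "norm (g y) / norm (y - u) \<le> norm ((g y - g u) - g' (y - u)) / norm (y - u) + B"
      using y by (simp add: field_simps)
    then have "norm (n y - n u) * (norm (g y) / norm (y - u)) * K
      \<le> norm (n y - n u) * (norm ((g y - g u) - g' (y - u)) / norm (y - u) + B) * K"
      using K by (intro mult_right_mono mult_left_mono) auto
    moreover have "norm (prod (n y - n u) (g y)) / norm (y - u) \<le> norm (n y - n u) * (norm (g y) / norm (y - u)) * K"
      using divide_right_mono[OF K(2)[of "n y - n u" "g y"], of "norm (y - u)"] by (simp add: ac_simps)
    ultimately show "norm (prod (n y - n u) (g y) - prod (n u - n u) (g u) - 0) / norm (y - u)
      \<le> norm (n y - n u) * (norm ((g y - g u) - g' (y - u)) / norm (y - u) + B) * K"
      by (simp add: zero_left)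
  next
    have "((\<lambda>y. norm (n y - n u) * (norm ((g y - g u) - g' (y - u)) / norm (y - u) + B) * K) \<longlongrightarrow> 0 * (0 + B) * K) (at u)"
      by (intro tendsto_intros nlim lim)
    then show "((\<lambda>y. norm (n y - n u) * (norm ((g y - g u) - g' (y - u)) / norm (y - u) + B) * K) \<longlongrightarrow> 0) (at u)"
      by simp
  qed simp_all
  have "((\<lambda>x. prod (n u) (g x)) has_derivative (\<lambda>v. prod (n u) (g' v))) (at u)"
    by (rule bounded_linear.has_derivative[OF bounded_linear_right g(1)])
  from has_derivative_add[OF this zero] show ?thesis
    by (simp add: diff_left)
qed

lemma differentiable_mink_iff:
  assumes "\<And>Y. (\<lambda>u. mink (z u) Y) differentiable (at u)"
  shows "z differentiable (at u)"
  using assms by (subst differentiable_componentwise_within) (auto simp: inner_eq_mink)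

lemma linear_injective_imp_surj_plane:
  fixes L :: "real \<times> real \<Rightarrow> real \<times> real"
  assumes "linear L" "\<And>v. L v = 0 \<Longrightarrow> v = 0"
  shows "\<exists>v. L v = w"
proof -
  have "inj L"
    using assms linear_injective_0 by blast
  then have "surj L"
    using assms(1) linear_injective_imp_surjective by blast
  then show ?thesis
    by (metis surjD)
qed

section \<open>Differentiability of the unit normal and symmetry of its derivative\<close>

locale surface_with_normal =
  fixes f :: "real \<times> real \<Rightarrow> real^4" and U and n
  assumes immersed: "immersed_surface f U"
    and normal_field: "unit_normal_field f U n"
begin

definition N :: "real \<times> real \<Rightarrow> real \<times> real \<Rightarrow> real^4" where
  "N u = frechet_derivative n (at u)"

lemma U: "open U" "connected U" "U \<noteq> {}"
  using immersed by (auto simp: immersed_surface_def)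

lemma D1: "u \<in> U \<Longrightarrow> (f has_derivative D1 f u) (at u)"
proof -
  assume u: "u \<in> U"
  have "f differentiable (at u)"
    using immersed u unfolding immersed_surface_def twice_cont_diff_on_def
    by (metis differentiable_on_eq_differentiable_at)
  moreover have "D1 f u = frechet_derivative f (at u)"
    by (auto simp: D1_def)
  ultimately show ?thesis
    by (simp add: frechet_derivative_works)
qed

lemma D2: "u \<in> U \<Longrightarrow> ((\<lambda>x. D1 f x w) has_derivative (\<lambda>v. D2 f u v w)) (at u)"
proof -
  assume u: "u \<in> U"
  have "(\<lambda>x. D1 f x w) differentiable (at u)"
    using immersed u unfolding immersed_surface_def twice_cont_diff_on_def
    by (metis differentiable_on_eq_differentiable_at)
  then show ?thesis
    by (simp add: frechet_derivative_works D2_def)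
qed

lemma D1_linear: "u \<in> U \<Longrightarrow> linear (D1 f u)"
  using D1 has_derivative_bounded_linear bounded_linear.linear by blast

lemma D1_inj: "u \<in> U \<Longrightarrow> D1 f u v = 0 \<Longrightarrow> v = 0"
  using immersed D1_linear by (metis immersed_surface_def linear_injective_0)

lemma D1_continuous: "continuous_on U (\<lambda>u. D1 f u v)"
  by (intro continuous_at_imp_continuous_on ballI has_derivative_continuous[OF D2])

lemma f_mink: "u \<in> U \<Longrightarrow> mink (f u) (f u) = -1"
  and f_pos: "u \<in> U \<Longrightarrow> f u $ 0 > 0"
  using immersed by (auto simp: immersed_surface_def hyperbolic_space_def)

lemma n_unit: "u \<in> U \<Longrightarrow> mink (n u) (n u) = 1"
  and n_f: "u \<in> U \<Longrightarrow> mink (n u) (f u) = 0"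
  and n_D1: "u \<in> U \<Longrightarrow> mink (n u) (D1 f u v) = 0"
  and n_cont: "u \<in> U \<Longrightarrow> isCont n u"
  using normal_field U unfolding unit_normal_field_def
  by (blast, blast, blast, metis continuous_on_eq_continuous_at)

lemma derivative_eq_on_U:
  assumes "u \<in> U" "(g has_derivative g1) (at u)" "(h has_derivative h1) (at u)" "\<And>x. x \<in> U \<Longrightarrow> g x = h x"
  shows "g1 = h1"
  using has_derivative_transform_within_open[OF assms(2) U(1) assms(1) assms(4)] assms(3)
    has_derivative_unique by blast

lemma D1_f: "u \<in> U \<Longrightarrow> mink (D1 f u v) (f u) = 0"
proof -
  assume u: "u \<in> U"
  have "((\<lambda>x. mink (f x) (f x)) has_derivative (\<lambda>v. mink (f u) (D1 f u v) + mink (D1 f u v) (f u))) (at u)"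
    by (intro derivative_intros D1 u)
  from derivative_eq_on_U[OF u this has_derivative_const f_mink] show ?thesis
    by (metis (no_types, lifting) mink_commute mult_2 mult_eq_0_iff zero_neq_numeral)
qed

text \<open>The position, the tangent vectors and the normal are mutually orthogonal, so the map
  \<open>L\<close> from a 4-dimensional space is injective.\<close>

lemma frame_spans:
  assumes u: "u \<in> U"
  shows "\<exists>a v c. y = a *\<^sub>R f u + D1 f u v + c *\<^sub>R n u"
proof -
  define L :: "(real \<times> real) \<times> (real \<times> real) \<Rightarrow> real^4"
    where "L p = fst (fst p) *\<^sub>R f u + D1 f u (snd p) + snd (fst p) *\<^sub>R n u" for p
  interpret D: linear "D1 f u"
    by (rule D1_linear[OF u])
  have lin: "linear L"
    by (rule linearI) (simp_all add: L_def D.add D.scaleR algebra_simps)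
  have "inj L"
  proof (subst linear_injective_0[OF lin], intro allI impI)
    fix p assume p: "L p = 0"
    have "mink (L p) (f u) = - fst (fst p)" "mink (L p) (n u) = snd (fst p)"
      using u n_f[OF u] n_D1[OF u] D1_f[OF u] n_unit[OF u] f_mink[OF u]
      by (simp_all add: L_def mink_simps mink_commute)
    then have "fst (fst p) = 0" "snd (fst p) = 0"
      using p by (simp_all add: mink_simps)
    moreover from this have "snd p = 0"
      using p D1_inj[OF u] by (simp add: L_def)
    ultimately show "p = 0"
      by (simp add: prod_eq_iff)
  qed
  then have "dim (range L) = 4"
    using dim_image_eq[OF lin, of UNIV] by simp
  then have "span (range L) = UNIV"
    using dim_eq_full[of "range L"] by simp
  moreover have "span (range L) = range L"
    using linear_span_image[OF lin, of UNIV] by simp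
  ultimately have "range L = UNIV"
    by simp
  then obtain p where "y = L p"
    by blast
  then show ?thesis
    unfolding L_def by blast
qed

text \<open>Freezing \<open>X\<close> at \<open>u\<close> changes the product to
  \<open>mink (n x) (X u - X x)\<close>, whose second factor vanishes at \<open>u\<close>; there
  continuity of \<open>n\<close> is enough for the product rule.\<close>

lemma mink_n_derivative:
  assumes u: "u \<in> U" and X: "(X has_derivative X') (at u)" and orth: "\<And>x. x \<in> U \<Longrightarrow> mink (n x) (X x) = 0"
  shows "((\<lambda>x. mink (n x) (X u)) has_derivative (\<lambda>v. - mink (n u) (X' v))) (at u)"
proof -
  have "((\<lambda>x. mink (n x) (X u - X x)) has_derivative (\<lambda>v. mink (n u) (0 - X' v))) (at u)"
    by (rule mink.has_derivative_continuous_vanishing[OF n_cont[OF u]])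
      (auto intro!: derivative_eq_intros X)
  then have "((\<lambda>x. mink (n x) (X u - X x)) has_derivative (\<lambda>v. - mink (n u) (X' v))) (at u)"
    by (simp add: mink_simps)
  then show ?thesis
    by (rule has_derivative_transform_within_open[OF _ U(1) u]) (simp add: mink_simps orth)
qed

text \<open>Let \<open>z\<close> be the part of \<open>n\<close> orthogonal to \<open>n u\<close>.
  Its products with \<open>f u\<close> and with tangent vectors at \<open>u\<close> are
  differentiable by freezing, so \<open>z\<close> is. The remaining component
  \<open>\<alpha>\<close> is positive near \<open>u\<close>, and the unit length recovers it as
  \<open>sqrt (1 - mink (z x) (z x))\<close>.\<close>

lemma n_differentiable:
  assumes u: "u \<in> U"
  shows "n differentiable (at u)"
proof -
  define \<alpha> where "\<alpha> x = mink (n x) (n u)" for x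
  define z where "z x = n x - \<alpha> x *\<^sub>R n u" for x
  have zn: "mink (z x) (n u) = 0" for x
    using n_unit[OF u] by (simp add: z_def \<alpha>_def mink_simps)
  have zf: "mink (z x) (f u) = mink (n x) (f u)" and zD: "mink (z x) (D1 f u v) = mink (n x) (D1 f u v)" for x v
    using n_f[OF u] n_D1[OF u] by (simp_all add: z_def mink_simps)
  have "z differentiable (at u)"
  proof (rule differentiable_mink_iff)
    fix y
    obtain a v c where y: "y = a *\<^sub>R f u + D1 f u v + c *\<^sub>R n u"
      using frame_spans[OF u] by blast
    have "mink (z x) y = a * mink (n x) (f u) + mink (n x) (D1 f u v)" for x
      by (simp add: y mink_simps zn zf zD)
    moreover have "((\<lambda>x. mink (n x) (f u)) has_derivative (\<lambda>w. - mink (n u) (D1 f u w))) (at u)"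
      by (rule mink_n_derivative[OF u D1[OF u] n_f])
    moreover have "((\<lambda>x. mink (n x) (D1 f u v)) has_derivative (\<lambda>w. - mink (n u) (D2 f u w v))) (at u)"
      by (rule mink_n_derivative[OF u D2[OF u] n_D1])
    ultimately show "(\<lambda>x. mink (z x) y) differentiable (at u)"
      by (auto simp: differentiable_def intro!: exI derivative_intros)
  qed
  then obtain z' where z': "(z has_derivative z') (at u)"
    by (auto simp: differentiable_def)
  have zu: "z u = 0"
    using n_unit[OF u] by (simp add: z_def \<alpha>_def)
  have \<alpha>: "(\<alpha> x)\<^sup>2 = 1 - mink (z x) (z x)" if "x \<in> U" for x
    using n_unit[OF that] n_unit[OF u]
    by (simp add: z_def mink_simps mink_commute[of "n u" "n x"] power2_eq_square flip: \<alpha>_def)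
  have "isCont \<alpha> u"
    unfolding \<alpha>_def by (intro continuous_intros mink.continuous n_cont u)
  moreover have "\<alpha> u = 1"
    using n_unit[OF u] by (simp add: \<alpha>_def)
  ultimately have "\<forall>\<^sub>F x in nhds u. \<alpha> x > 0"
    by (metis isCont_def order_tendstoD(1) tendsto_nhds_iff zero_less_one)
  then obtain V where V: "open V" "u \<in> V" "\<And>x. x \<in> V \<Longrightarrow> \<alpha> x > 0"
    by (auto simp: eventually_nhds)
  have d: "((\<lambda>x. sqrt (1 - mink (z x) (z x)) *\<^sub>R n u + z x) has_derivative
      (\<lambda>v. ((0 - (mink (z u) (z' v) + mink (z' v) (z u))) * (inverse (sqrt (1 - mink (z u) (z u))) / 2)) *\<^sub>R n u + z' v)) (at u)"
    by (auto intro!: derivative_eq_intros z' simp: zu mink_simps)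
  have "(n has_derivative
      (\<lambda>v. ((0 - (mink (z u) (z' v) + mink (z' v) (z u))) * (inverse (sqrt (1 - mink (z u) (z u))) / 2)) *\<^sub>R n u + z' v)) (at u)"
  proof (rule has_derivative_transform_within_open[OF d, of "U \<inter> V"])
    fix x assume x: "x \<in> U \<inter> V"
    then have "sqrt (1 - mink (z x) (z x)) = \<alpha> x"
      using \<alpha>[of x] V(3)[of x] by (metis IntD1 IntD2 less_eq_real_def real_sqrt_unique)
    then show "sqrt (1 - mink (z x) (z x)) *\<^sub>R n u + z x = n x"
      by (simp add: z_def)
  qed (use U V u in auto)
  then show ?thesis
    by (auto simp: differentiable_def)
qed

lemma N: "u \<in> U \<Longrightarrow> (n has_derivative N u) (at u)"
  using n_differentiable frechet_derivative_works unfolding N_def by blast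

lemma N_linear: "u \<in> U \<Longrightarrow> linear (N u)"
  using N has_derivative_bounded_linear bounded_linear.linear by blast

lemma derivative_orthogonal:
  assumes "u \<in> U" "(X has_derivative X') (at u)" "\<And>x. x \<in> U \<Longrightarrow> mink (n x) (X x) = c"
  shows "mink (N u v) (X u) = - mink (n u) (X' v)"
proof -
  have "((\<lambda>x. mink (n x) (X x)) has_derivative (\<lambda>v. mink (n u) (X' v) + mink (N u v) (X u))) (at u)"
    by (intro derivative_intros N assms)
  from derivative_eq_on_U[OF assms(1) this has_derivative_const assms(3)] show ?thesis
    by (metis (no_types, lifting) add.commute eq_neg_iff_add_eq_0)
qed

lemma N_f: "u \<in> U \<Longrightarrow> mink (N u v) (f u) = 0"
  using derivative_orthogonal[OF _ D1 n_f] n_D1 by simp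

lemma N_n: "u \<in> U \<Longrightarrow> mink (N u v) (n u) = 0"
  using derivative_orthogonal[OF _ N n_unit, of u v] by (simp add: mink_commute)

lemma N_D1: "u \<in> U \<Longrightarrow> mink (N u v) (D1 f u w) = - second_form f n u v w"
  using derivative_orthogonal[OF _ D2 n_D1, of u v w] by (simp add: second_form_def mink_commute)

lemma D2_symmetric:
  assumes u: "u \<in> U"
  shows "D2 f u v w = D2 f u w v"
proof (rule euclidean_eqI)
  fix b :: "real^4"
  have cont: "continuous_on U (\<lambda>x. D2 f x v w)" for v w
    using immersed unfolding immersed_surface_def twice_cont_diff_on_def by blast
  show "D2 f u v w \<bullet> b = D2 f u w v \<bullet> b"
    by (rule second_derivative_symmetric[where g = "\<lambda>x. f x \<bullet> b" and g' = "\<lambda>x v. D1 f x v \<bullet> b"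
          and g'' = "\<lambda>x v w. D2 f x v w \<bullet> b", OF U(1) u])
      (auto intro!: has_derivative_inner_left D1 D2 continuous_intros cont)
qed

lemma N_symmetric: "u \<in> U \<Longrightarrow> mink (N u v) (D1 f u w) = mink (N u w) (D1 f u v)"
  using D2_symmetric by (simp add: N_D1 second_form_def)

end

section \<open>The mean curvature condition\<close>

locale cmc_surface = surface_with_normal +
  fixes H :: real
  assumes cmc: "u \<in> U \<Longrightarrow> \<exists>k1 k2. principal_curvatures f n u k1 k2 \<and> H = (k1 + k2) / 2"
begin

text \<open>This evaluates the trace of the shape operator on an orthogonal pair of tangent vectors of
  equal length.\<close>

lemma mean_curvature_trace:
  assumes u: "u \<in> U" and "mink (D1 f u v) (D1 f u w) = 0"
    and "mink (D1 f u v) (D1 f u v) = r" "mink (D1 f u w) (D1 f u w) = r" "r \<noteq> 0"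
  shows "mink (N u v) (D1 f u v) + mink (N u w) (D1 f u w) = - 2 * H * r"
proof -
  define I where "I v w = mink (D1 f u v) (D1 f u w)" for v w
  define S where "S v w = mink (N u v) (D1 f u w)" for v w
  interpret D: linear "D1 f u"
    by (rule D1_linear[OF u])
  interpret N: linear "N u"
    by (rule N_linear[OF u])
  have I: "I (a *\<^sub>R x + b *\<^sub>R y) z = a * I x z + b * I y z" "I x y = I y x" for a b x y z
    by (simp_all add: I_def D.add D.scaleR mink_simps mink_commute)
  have S: "S (a *\<^sub>R x + b *\<^sub>R y) z = a * S x z + b * S y z" "S x y = S y x" for a b x y z
    using N_symmetric[OF u] by (simp_all add: S_def N.add N.scaleR mink_simps)
  obtain k1 k2 where k: "principal_curvatures f n u k1 k2" "H = (k1 + k2) / 2"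
    using cmc[OF u] by blast
  then obtain e1 e2 where e: "e1 \<noteq> e2" "independent {e1, e2}"
    "\<And>w. S e1 w = - k1 * I e1 w" "\<And>w. S e2 w = - k2 * I e2 w"
    unfolding principal_curvatures_def first_form_def S_def I_def N_D1[OF u] minus_mult_left[symmetric] neg_equal_iff_equal
    by blast
  have "\<exists>a b. x = a *\<^sub>R e1 + b *\<^sub>R e2" for x
  proof -
    have "dim (UNIV :: (real \<times> real) set) \<le> card {e1, e2}"
      using e by (simp add: dim_UNIV)
    then have "span {e1, e2} = UNIV"
      using e card_ge_dim_independent[of "{e1, e2}" UNIV] by auto
    then have "x \<in> span {e1, e2}" by simp
    then show ?thesis
      by (auto simp: span_insert span_singleton algebra_simps)
  qed
  then obtain a b c d where v: "v = a *\<^sub>R e1 + b *\<^sub>R e2" and w: "w = c *\<^sub>R e1 + d *\<^sub>R e2"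
    by metis
  define E F G where "E = I e1 e1" and "F = I e1 e2" and "G = I e2 e2"
  have Ie: "I e1 e1 = E" "I e1 e2 = F" "I e2 e1 = F" "I e2 e2 = G"
    using I(2) by (simp_all add: E_def F_def G_def)
  have SE: "S e1 e1 = - k1 * E" "S e1 e2 = - k1 * F" "S e2 e1 = - k2 * F" "S e2 e2 = - k2 * G"
    by (simp_all add: e(3,4) Ie)
  have kF: "k1 * F = k2 * F"
    using SE(2,3) S(2)[of e1 e2] by auto
  have Ir: "I x (a *\<^sub>R y + b *\<^sub>R z) = a * I x y + b * I x z"
    "S x (a *\<^sub>R y + b *\<^sub>R z) = a * S x y + b * S x z" for a b x y z
    by (metis I(1,2), metis S(1,2))
  have Ivv: "I v v = a\<^sup>2 * E + 2 * a * b * F + b\<^sup>2 * G"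
    and Iww: "I w w = c\<^sup>2 * E + 2 * c * d * F + d\<^sup>2 * G"
    and Ivw: "I v w = a * c * E + (a * d + b * c) * F + b * d * G"
    and Svv: "S v v = - (k1 * a\<^sup>2 * E + 2 * a * b * k1 * F + k2 * b\<^sup>2 * G)"
    and Sww: "S w w = - (k1 * c\<^sup>2 * E + 2 * c * d * k1 * F + k2 * d\<^sup>2 * G)"
    and Svw: "S v w = - (k1 * a * c * E + (a * d + b * c) * k1 * F + k2 * b * d * G)"
    unfolding v w I(1) S(1) Ir Ie SE using kF by (auto simp: power2_eq_square algebra_simps)
  \<comment> \<open>Trace times Gram determinant, written independently of the basis. Symmetry gave
    \<open>k1 * F = k2 * F\<close>: either the eigenvectors are orthogonal or the point is umbilic,
    and in each case a polynomial identity remains.\<close>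
  have "S v v * I w w + S w w * I v v - 2 * S v w * I v w
      = - (k1 + k2) * (I v v * I w w - (I v w)\<^sup>2)"
  proof (cases "F = 0")
    case True
    show ?thesis
      unfolding Ivv Iww Ivw Svv Sww Svw True by algebra
  next
    case False
    then have "k2 = k1" using kF by simp
    show ?thesis
      unfolding Ivv Iww Ivw Svv Sww Svw \<open>k2 = k1\<close> by algebra
  qed
  also have "\<dots> = - 2 * H * (I v v * I w w - (I v w)\<^sup>2)"
    by (simp add: k(2))
  finally have "(S v v + S w w) * r = (- 2 * H * r) * r"
    using assms by (simp add: I_def algebra_simps power2_eq_square)
  then show ?thesis
    using assms(5) unfolding S_def mult_cancel_right by simp
qed

end

subsection \<open>Jacobi elliptic functions\<close>

lemma LBINT_has_real_derivative:
  fixes g :: "real \<Rightarrow> real"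
  assumes "\<And>x. isCont g x"
  shows "((\<lambda>s. LBINT u=ereal c..ereal s. g u) has_real_derivative g s) (at s)"
proof -
  define a where "a = min c s - 1"
  define b where "b = max c s + 1"
  have "((\<lambda>s. LBINT u=ereal c..ereal s. g u) has_vector_derivative g s) (at s within {a..b})"
    by (rule interval_integral_FTC2)
      (auto simp: a_def b_def intro!: continuous_at_imp_continuous_on assms)
  then have "((\<lambda>s. LBINT u=ereal c..ereal s. g u) has_vector_derivative g s) (at s)"
    by (subst (asm) at_within_interior) (auto simp: a_def b_def)
  then show ?thesis
    by (simp add: has_real_derivative_iff_has_vector_derivative)
qed

text \<open>The incomplete elliptic integral of the first kind, whose inverse is the
  amplitude.\<close>

definition elliptic_F :: "real \<Rightarrow> real \<Rightarrow> real" where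
  "elliptic_F p \<phi> = (LBINT x=ereal 0..ereal \<phi>. 1 / sqrt (1 - p\<^sup>2 * (sin x)\<^sup>2))"

lemma elliptic_F_0 [simp]: "elliptic_F p 0 = 0"
  by (simp add: elliptic_F_def)

lemma elliptic_K_eq: "elliptic_K p = elliptic_F p (pi / 2)"
  by (simp add: elliptic_K_def elliptic_F_def)

text \<open>The strict bound on \<open>p\<close> makes the integrand bounded and the integral an
  increasing bijection of the reals. Admissible constants satisfy it because
  \<open>0 < Cp\<close>.\<close>

context
  fixes p :: real
  assumes p: "0 \<le> p" "p < 1"
begin

lemma elliptic_radicand_pos: "0 < 1 - p\<^sup>2 * (sin x)\<^sup>2"
  and elliptic_radicand_le: "1 - p\<^sup>2 * (sin x)\<^sup>2 \<le> 1"
proof -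
  have "p\<^sup>2 * (sin x)\<^sup>2 \<le> p\<^sup>2 * 1"
    by (intro mult_left_mono) (auto simp: abs_square_le_1)
  moreover have "p\<^sup>2 < 1"
    using p by (simp add: abs_square_less_1)
  ultimately show "0 < 1 - p\<^sup>2 * (sin x)\<^sup>2" by linarith
qed simp

lemma isCont_elliptic_integrand: "isCont (\<lambda>x. 1 / sqrt (1 - p\<^sup>2 * (sin x)\<^sup>2)) x"
  using elliptic_radicand_pos[of x] by (intro continuous_intros) auto

lemma elliptic_F_has_real_derivative:
  "(elliptic_F p has_real_derivative 1 / sqrt (1 - p\<^sup>2 * (sin \<phi>)\<^sup>2)) (at \<phi>)"
  unfolding elliptic_F_def[abs_def] by (rule LBINT_has_real_derivative[OF isCont_elliptic_integrand])

lemma elliptic_F_strict_mono: "x < y \<Longrightarrow> elliptic_F p x < elliptic_F p y"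
  by (rule DERIV_pos_imp_increasing)
    (use elliptic_F_has_real_derivative elliptic_radicand_pos in \<open>auto simp: field_simps intro!: exI\<close>)

lemma elliptic_F_less_iff: "elliptic_F p x < elliptic_F p y \<longleftrightarrow> x < y"
  using elliptic_F_strict_mono by (metis linorder_neqE order_less_asym)

lemma elliptic_F_eq_iff: "elliptic_F p x = elliptic_F p y \<longleftrightarrow> x = y"
  using elliptic_F_less_iff by (metis linorder_neqE order_less_irrefl)

lemma elliptic_F_minus: "elliptic_F p (- x) = - elliptic_F p x"
proof -
  have "((\<lambda>x. elliptic_F p x + elliptic_F p (- x)) has_real_derivative 0) (at x within UNIV)" for x
  proof -
    have "((\<lambda>x. elliptic_F p (- x)) has_real_derivative 1 / sqrt (1 - p\<^sup>2 * (sin (- x))\<^sup>2) * (- 1)) (at x)"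
      by (rule DERIV_chain2[OF elliptic_F_has_real_derivative]) (auto intro!: derivative_eq_intros)
    from DERIV_add[OF elliptic_F_has_real_derivative this] show ?thesis
      by simp
  qed
  then obtain c where "\<And>x. elliptic_F p x + elliptic_F p (- x) = c"
    using has_field_derivative_zero_constant[of UNIV "\<lambda>x. elliptic_F p x + elliptic_F p (- x)"] by auto
  from this[of 0] this[of x] show ?thesis by simp
qed

text \<open>The integrand is at least 1. With oddness, this is the unboundedness behind
  surjectivity.\<close>

lemma elliptic_F_ge: "0 \<le> x \<Longrightarrow> x \<le> elliptic_F p x"
proof -
  assume x: "0 \<le> x"
  have "(\<lambda>x. elliptic_F p x - x) 0 \<le> (\<lambda>x. elliptic_F p x - x) x"
  proof (rule DERIV_nonneg_imp_nondecreasing[OF x])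
    fix y
    have "((\<lambda>x. elliptic_F p x - x) has_real_derivative 1 / sqrt (1 - p\<^sup>2 * (sin y)\<^sup>2) - 1) (at y)"
      by (intro derivative_intros elliptic_F_has_real_derivative)
    moreover have "0 \<le> 1 / sqrt (1 - p\<^sup>2 * (sin y)\<^sup>2) - 1"
      using elliptic_radicand_pos[of y] elliptic_radicand_le[of y] by (simp add: field_simps)
    ultimately show "\<exists>d. ((\<lambda>x. elliptic_F p x - x) has_real_derivative d) (at y) \<and> 0 \<le> d"
      by blast
  qed
  then show ?thesis by simp
qed

lemma elliptic_F_surj: "\<exists>x. elliptic_F p x = u"
proof -
  have "\<exists>x\<ge>-\<bar>u\<bar>. x \<le> \<bar>u\<bar> \<and> elliptic_F p x = u"
  proof (rule IVT)
    show "elliptic_F p (- \<bar>u\<bar>) \<le> u" "u \<le> elliptic_F p \<bar>u\<bar>"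
      using elliptic_F_ge[of "\<bar>u\<bar>"] elliptic_F_minus[of "\<bar>u\<bar>"] by linarith+
  qed (use elliptic_F_has_real_derivative DERIV_isCont in auto)
  then show ?thesis by blast
qed

lemma jacobi_am_elliptic_F: "jacobi_am p (elliptic_F p \<phi>) = \<phi>"
  unfolding jacobi_am_def elliptic_F_def[symmetric]
proof (rule the_equality)
  show "interval_lebesgue_integrable lborel (ereal 0) (ereal \<phi>) (\<lambda>x. 1 / sqrt (1 - p\<^sup>2 * (sin x)\<^sup>2)) \<and>
    elliptic_F p \<phi> = elliptic_F p \<phi>"
    by (intro conjI interval_integrable_isCont isCont_elliptic_integrand refl)
qed (simp add: elliptic_F_eq_iff)

lemma elliptic_F_jacobi_am: "elliptic_F p (jacobi_am p u) = u"
  by (metis elliptic_F_surj jacobi_am_elliptic_F)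

lemma isCont_jacobi_am: "isCont (jacobi_am p) u"
proof -
  have "isCont (jacobi_am p) (elliptic_F p (jacobi_am p u))"
    by (rule isCont_inverse_function[where d = 1])
      (auto simp: jacobi_am_elliptic_F intro: DERIV_isCont elliptic_F_has_real_derivative)
  then show ?thesis
    by (simp add: elliptic_F_jacobi_am)
qed

lemma isCont_jacobi_sn: "isCont (jacobi_sn p) u"
  unfolding jacobi_sn_def[abs_def] by (intro continuous_intros isCont_jacobi_am)

lemma abs_less_elliptic_K_iff: "\<bar>elliptic_F p \<phi>\<bar> < elliptic_K p \<longleftrightarrow> \<bar>\<phi>\<bar> < pi / 2"
  unfolding elliptic_K_eq abs_less_iff elliptic_F_minus[symmetric] elliptic_F_less_iff ..

lemma jacobi_am_bounds: "\<bar>u\<bar> < elliptic_K p \<Longrightarrow> \<bar>jacobi_am p u\<bar> < pi / 2"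
  using abs_less_elliptic_K_iff[of "jacobi_am p u"] by (simp add: elliptic_F_jacobi_am)

lemma jacobi_cn_pos: "\<bar>u\<bar> < elliptic_K p \<Longrightarrow> 0 < jacobi_cn p u"
  using jacobi_am_bounds[of u] unfolding jacobi_cn_def by (intro cos_gt_zero_pi) auto

lemma jacobi_sn_squared: "(jacobi_sn p u)\<^sup>2 = 1 - (jacobi_cn p u)\<^sup>2"
  by (simp add: jacobi_sn_def jacobi_cn_def sin_squared_eq)

lemma elliptic_Pi_has_real_derivative:
  assumes "k < 1"
  shows "(elliptic_Pi p k has_real_derivative 1 / (1 - k * (jacobi_sn p s)\<^sup>2)) (at s)"
proof -
  have "k * (jacobi_sn p x)\<^sup>2 < 1" for x
  proof (cases "0 \<le> k")
    case True
    have "k * (jacobi_sn p x)\<^sup>2 \<le> k * 1"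
      using True by (intro mult_left_mono) (auto simp: abs_square_le_1 jacobi_sn_def)
    then show ?thesis using assms by simp
  next
    case False
    then have "k * (jacobi_sn p x)\<^sup>2 \<le> 0"
      by (simp add: mult_nonpos_nonneg)
    then show ?thesis by simp
  qed
  then have "isCont (\<lambda>u. 1 / (1 - k * (jacobi_sn p u)\<^sup>2)) x" for x
    by (intro continuous_intros isCont_jacobi_sn) (metis less_irrefl right_minus_eq)
  from LBINT_has_real_derivative[OF this] show ?thesis
    unfolding elliptic_Pi_def[abs_def] .
qed

lemma profile_r_squared:
  "0 < Cp \<Longrightarrow> (profile_r H Cp Cm p t)\<^sup>2 = Cp / (jacobi_cn p (Xi H Cp Cm * t))\<^sup>2"
  by (simp add: profile_r_def power_divide)

lemma profile_r_pos:
  "0 < Cp \<Longrightarrow> \<bar>Xi H Cp Cm * t\<bar> < elliptic_K p \<Longrightarrow> 0 < profile_r H Cp Cm p t"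
  by (simp add: profile_r_def jacobi_cn_pos)

text \<open>Replacing \<open>sn\<close> by \<open>cn\<close> turns the integrand of the third kind
  into a rational function of \<open>r\<^sup>2\<close>. The result is the angular velocity
  \<open>a / (r2 + k)\<close>, since the first integral gives \<open>a = k * (C - H * r2)\<close>.
  The assumption \<open>0 < Cp + k\<close> rules out the special case of
  \<open>profile_\<psi>\<close>.\<close>

lemma profile_\<psi>_has_real_derivative:
  assumes k: "k = 1 \<or> k = -1" and Cp: "0 < Cp" "0 < Cp + k" and X: "0 < Xi H Cp Cm"
    and t: "\<bar>Xi H Cp Cm * t\<bar> < elliptic_K p"
  defines "r \<equiv> profile_r H Cp Cm p t"
  shows "(profile_\<psi> k H C Cp Cm p has_real_derivative k * (C - H * r\<^sup>2) / (r\<^sup>2 + k)) (at t)"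
proof -
  define m where "m = 1 / (k * Cp + 1)"
  define c where "c = (jacobi_cn p (Xi H Cp Cm * t))\<^sup>2"
  have kk: "k * k = 1" using k by auto
  \<comment> \<open>Between 0 and 1 for \<open>k = 1\<close>; negative for \<open>k = -1\<close>,
    where \<open>Cp > 1\<close>. So the integrand has no pole.\<close>
  have "m < 1"
    using k Cp by (auto simp: m_def field_simps)
  have c: "0 < c" "c \<le> 1"
    using jacobi_cn_pos[OF t] by (auto simp: c_def jacobi_cn_def abs_square_le_1)
  have r2: "r\<^sup>2 = Cp / c"
    using Cp by (simp add: r_def profile_r_squared c_def)
  have sn: "(jacobi_sn p (Xi H Cp Cm * t))\<^sup>2 = 1 - c"
    by (simp add: jacobi_sn_squared c_def)
  have "(elliptic_Pi p m has_real_derivative 1 / (1 - m * (1 - c))) (at (Xi H Cp Cm * t))"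
    using elliptic_Pi_has_real_derivative[OF \<open>m < 1\<close>, of "Xi H Cp Cm * t"] by (simp add: sn)
  moreover have "((\<lambda>t. Xi H Cp Cm * t) has_real_derivative Xi H Cp Cm) (at t)"
    by (auto intro!: derivative_eq_intros)
  ultimately have 1: "((\<lambda>t. elliptic_Pi p m (Xi H Cp Cm * t)) has_real_derivative 1 / (1 - m * (1 - c)) * Xi H Cp Cm) (at t)"
    by (rule DERIV_chain2)
  have "((\<lambda>t. C * t - Cp * (C + k * H) / (Cp + k) * (1 / Xi H Cp Cm) * elliptic_Pi p m (Xi H Cp Cm * t))
      has_real_derivative C - Cp * (C + k * H) / (Cp + k) * (1 / Xi H Cp Cm) * (1 / (1 - m * (1 - c)) * Xi H Cp Cm)) (at t)"
    by (rule DERIV_diff[OF DERIV_cmult_Id DERIV_cmult[OF 1]])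
  moreover have "C - Cp * (C + k * H) / (Cp + k) * (1 / Xi H Cp Cm) * (1 / (1 - m * (1 - c)) * Xi H Cp Cm)
      = k * (C - H * r\<^sup>2) / (r\<^sup>2 + k)"
  proof -
    have kc: "k * Cp + 1 = k * (Cp + k)"
      using kk by (simp add: algebra_simps)
    have d: "Cp + k * c \<noteq> 0"
      using k Cp c by auto
    have k0: "k \<noteq> 0" using kk by auto
    have "1 - m * (1 - c) = (Cp + k * c) / (Cp + k)"
      unfolding m_def kc using Cp k0 k by (auto simp: field_simps)
    then have "C - Cp * (C + k * H) / (Cp + k) * (1 / Xi H Cp Cm) * (1 / (1 - m * (1 - c)) * Xi H Cp Cm)
      = C - Cp * (C + k * H) / (Cp + k * c)"
      using X Cp by simp
    also have "\<dots> = (k * C * c - k * H * Cp) / (Cp + k * c)"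
      using d by (simp add: field_simps)
    also have "\<dots> = k * (C - H * (Cp / c)) / (Cp / c + k)"
    proof -
      have "Cp / c + k = (Cp + k * c) / c" "C - H * (Cp / c) = (C * c - H * Cp) / c"
        using c by (simp_all add: field_simps)
      then show ?thesis
        using c by (simp add: algebra_simps)
    qed
    finally show ?thesis by (simp add: r2)
  qed
  ultimately show ?thesis
    using Cp unfolding profile_\<psi>_def[abs_def] m_def by simp
qed

end

subsection \<open>Moving frames of rotational surfaces\<close>

text \<open>\<open>A1, A2\<close> span the plane of rotation and \<open>B1, B2\<close> its orthogonal complement, with signatures
  \<open>(k, 1)\<close> and \<open>(- k, 1)\<close>; this treats elliptic and hyperbolic rotations simultaneously.\<close>

locale adapted_basis =
  fixes k :: real and e :: "4 \<Rightarrow> real^4" and A1 A2 B1 B2 :: "real^4"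
  assumes e: "orthonormal_basis e"
    and frame: "k = 1 \<and> A1 = e 2 \<and> A2 = e 3 \<and> B1 = e 0 \<and> B2 = e 1 \<or>
      k = -1 \<and> A1 = e 0 \<and> A2 = e 1 \<and> B1 = e 2 \<and> B2 = e 3"
begin

text \<open>Coordinates with respect to \<open>A1\<close>, \<open>A2\<close>, \<open>B1\<close>,
  \<open>B2\<close>; the factors compensate the squares \<open>k\<close> of \<open>A1\<close> and
  \<open>- k\<close> of \<open>B1\<close>.\<close>

definition P1 where "P1 x = k * mink x A1"
definition P2 where "P2 x = mink x A2"
definition Q1 where "Q1 x = - k * mink x B1"
definition Q2 where "Q2 x = mink x B2"

definition comb where "comb x1 x2 y1 y2 = x1 *\<^sub>R A1 + x2 *\<^sub>R A2 + y1 *\<^sub>R B1 + y2 *\<^sub>R B2"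

lemma k_cases: "k = 1 \<or> k = -1"
  using frame by auto

lemma kk: "k * k = 1" and k_sq: "k\<^sup>2 = 1" and k_nz: "k \<noteq> 0"
  using k_cases by auto

lemma kk_left: "k * (k * x) = x"
  using kk by (metis mult.assoc mult_1)

lemma mink_frame: "mink A1 A1 = k" "mink A2 A2 = 1" "mink B1 B1 = - k" "mink B2 B2 = 1"
  "mink A1 A2 = 0" "mink A1 B1 = 0" "mink A1 B2 = 0" "mink A2 B1 = 0" "mink A2 B2 = 0" "mink B1 B2 = 0"
  "mink A2 A1 = 0" "mink B1 A1 = 0" "mink B2 A1 = 0" "mink B1 A2 = 0" "mink B2 A2 = 0" "mink B2 B1 = 0"
  using frame by (auto simp: orthonormal_basis_mink[OF e])

lemma coord_comb [simp]: "P1 (comb x1 x2 y1 y2) = x1" "P2 (comb x1 x2 y1 y2) = x2"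
  "Q1 (comb x1 x2 y1 y2) = y1" "Q2 (comb x1 x2 y1 y2) = y2"
  using kk by (simp_all add: P1_def P2_def Q1_def Q2_def comb_def mink_simps mink_frame)

lemma comb_coord: "x = comb (P1 x) (P2 x) (Q1 x) (Q2 x)"
  unfolding P1_def P2_def Q1_def Q2_def comb_def
  using frame orthonormal_basis_expansion[OF e, of x]
  by (elim disjE) (simp_all add: in_basis_def algebra_simps)

lemma coord_eqI: "P1 x = P1 y \<Longrightarrow> P2 x = P2 y \<Longrightarrow> Q1 x = Q1 y \<Longrightarrow> Q2 x = Q2 y \<Longrightarrow> x = y"
  using comb_coord by metis

lemma mink_coord: "mink x y = k * P1 x * P1 y + P2 x * P2 y - k * Q1 x * Q1 y + Q2 x * Q2 y"
  unfolding P1_def P2_def Q1_def Q2_def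
  using frame orthonormal_basis_mink_expansion[OF e, of x y]
  by (elim disjE) simp_all

lemma bounded_linear_coord: "bounded_linear P1" "bounded_linear P2" "bounded_linear Q1" "bounded_linear Q2"
  unfolding P1_def[abs_def] P2_def[abs_def] Q1_def[abs_def] Q2_def[abs_def]
  by (intro bounded_linear_intros mink.bounded_linear_left)+

lemma coord_simps:
  "P1 (x + y) = P1 x + P1 y" "P2 (x + y) = P2 x + P2 y" "Q1 (x + y) = Q1 x + Q1 y" "Q2 (x + y) = Q2 x + Q2 y"
  "P1 (c *\<^sub>R x) = c * P1 x" "P2 (c *\<^sub>R x) = c * P2 x" "Q1 (c *\<^sub>R x) = c * Q1 x" "Q2 (c *\<^sub>R x) = c * Q2 x"
  by (simp_all add: P1_def P2_def Q1_def Q2_def mink_simps algebra_simps)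

end

text \<open>The assumption says that the infinitesimal rotation is tangent to the surface.\<close>

locale rotational_frame = cmc_surface f U n H + adapted_basis k e A1 A2 B1 B2
  for f U n H k e A1 A2 B1 B2 +
  assumes tangency: "u \<in> U \<Longrightarrow> mink (n u) A1 * mink (f u) A2 = mink (n u) A2 * mink (f u) A1"
begin

text \<open>\<open>r2\<close> is the \<open>r\<^sup>2\<close> of the parametrizations, \<open>a\<close> the product of the normal with the component of
  \<open>f\<close> in the plane of rotation, and \<open>xi\<close> the infinitesimal rotation. Off the axis, \<open>f\<close>, \<open>n\<close>, \<open>xi / r\<close>
  and \<open>T / r\<close> form an orthonormal basis; \<open>T\<close> is the cross product of the other three.\<close>

definition "p1 u = P1 (f u)"
definition "p2 u = P2 (f u)"
definition "q1 u = Q1 (f u)"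
definition "q2 u = Q2 (f u)"
definition "m1 u = P1 (n u)"
definition "m2 u = P2 (n u)"
definition "l1 u = Q1 (n u)"
definition "l2 u = Q2 (n u)"

lemmas coord_defs = p1_def p2_def q1_def q2_def m1_def m2_def l1_def l2_def

definition "r2 u = (p1 u)\<^sup>2 + k * (p2 u)\<^sup>2"
definition "a u = k * p1 u * m1 u + p2 u * m2 u"
definition "b u = k * (l1 u * q2 u - l2 u * q1 u)"
definition "xi u = comb (- k * p2 u) (p1 u) 0 0"
definition "T u = comb (b u * p1 u) (b u * p2 u) (a u * q2 u - k * r2 u * l2 u) (k * a u * q1 u - r2 u * l1 u)"

lemma q_form: "u \<in> U \<Longrightarrow> (q1 u)\<^sup>2 - k * (q2 u)\<^sup>2 = r2 u + k"
proof -
  assume "u \<in> U"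
  from f_mink[OF this] have "k * (p1 u)\<^sup>2 + (p2 u)\<^sup>2 - k * (q1 u)\<^sup>2 + (q2 u)\<^sup>2 = - 1"
    by (simp add: mink_coord coord_defs power2_eq_square)
  then show ?thesis
    using kk unfolding r2_def by algebra
qed

lemma n_form: "u \<in> U \<Longrightarrow> k * (m1 u)\<^sup>2 + (m2 u)\<^sup>2 - k * (l1 u)\<^sup>2 + (l2 u)\<^sup>2 = 1"
  using n_unit[of u] by (simp add: mink_coord coord_defs power2_eq_square)

lemma n_f_form: "u \<in> U \<Longrightarrow> k * q1 u * l1 u - q2 u * l2 u = a u"
  using n_f[of u] by (simp add: mink_coord coord_defs a_def algebra_simps)

lemma tangency_coord: "u \<in> U \<Longrightarrow> m1 u * p2 u = m2 u * p1 u"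
  using tangency[of u] by (simp add: coord_defs P1_def P2_def)

text \<open>Tangency makes the components of \<open>f\<close> and \<open>n\<close> in the plane of
  rotation parallel; the factor of proportionality is \<open>k * a / r2\<close>.\<close>

lemma r2_m: "u \<in> U \<Longrightarrow> r2 u * m1 u = k * a u * p1 u" "u \<in> U \<Longrightarrow> r2 u * m2 u = k * a u * p2 u"
  using tangency_coord[of u] kk unfolding r2_def a_def by algebra+

lemma r2_ge:
  assumes "u \<in> U" "k = -1"
  shows "1 \<le> r2 u"
proof -
  have "(q1 u)\<^sup>2 + (q2 u)\<^sup>2 = r2 u - 1"
    using q_form[OF assms(1)] by (simp only: assms(2))
  then show ?thesis
    by (smt (verit) zero_le_power2)
qed

lemma r2_nonneg:
  assumes "u \<in> U"
  shows "0 \<le> r2 u"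
proof (cases "k = 1")
  case True
  show ?thesis
    unfolding r2_def by (subst True) simp
next
  case False
  then show ?thesis
    using r2_ge[OF assms] k_cases by simp
qed

lemma l_form:
  assumes "u \<in> U" "r2 u \<noteq> 0"
  shows "r2 u * ((l2 u)\<^sup>2 - k * (l1 u)\<^sup>2) = r2 u - k * (a u)\<^sup>2"
proof -
  have "r2 u * (r2 u * ((l2 u)\<^sup>2 - k * (l1 u)\<^sup>2)) = r2 u * (r2 u - k * (a u)\<^sup>2)"
    using n_form[OF assms(1)] r2_m[OF assms(1)] kk r2_def[of u] by algebra
  then show ?thesis
    using assms(2) by simp
qed

text \<open>Lagrange's identity in the complementary plane, where \<open>a\<close> is a product and
  \<open>b\<close> a determinant of the components of \<open>f\<close> and \<open>n\<close>. Since
  \<open>r2\<close> will turn out to have derivative \<open>2 * b * r2 * \<tau>\<close>, this is the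
  first-order equation of the profile curve.\<close>

lemma ab_form:
  assumes "u \<in> U" "r2 u \<noteq> 0"
  shows "(a u)\<^sup>2 + r2 u * (b u)\<^sup>2 = r2 u * (r2 u + k)"
  using l_form[OF assms] q_form[OF assms(1)] n_f_form[OF assms(1)] kk unfolding b_def by algebra

lemma frame_orthogonal:
  assumes "u \<in> U" "r2 u \<noteq> 0"
  shows "mink (xi u) (xi u) = r2 u" "mink (T u) (T u) = r2 u" "mink (xi u) (T u) = 0"
    "mink (f u) (xi u) = 0" "mink (n u) (xi u) = 0" "mink (f u) (T u) = 0" "mink (n u) (T u) = 0"
proof -
  note facts = l_form[OF assms] q_form[OF assms(1)] n_f_form[OF assms(1)] kk ab_form[OF assms]
  show "mink (xi u) (xi u) = r2 u"
    unfolding mink_coord xi_def coord_comb r2_def using kk by algebra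
  show "mink (xi u) (T u) = 0"
    unfolding mink_coord xi_def T_def coord_comb using kk by algebra
  show "mink (f u) (xi u) = 0"
    unfolding mink_coord xi_def coord_comb coord_defs[symmetric] using kk by algebra
  show "mink (n u) (xi u) = 0"
    unfolding mink_coord xi_def coord_comb coord_defs[symmetric] using kk tangency_coord[OF assms(1)] by algebra
  show "mink (T u) (T u) = r2 u"
    unfolding mink_coord T_def coord_comb using facts r2_def[of u] by algebra
  show "mink (f u) (T u) = 0"
    unfolding mink_coord T_def coord_comb coord_defs[symmetric]
    using kk r2_def[of u] b_def[of u] by algebra
  show "mink (n u) (T u) = 0"
    unfolding mink_coord T_def coord_comb coord_defs[symmetric]
    using kk a_def[of u] b_def[of u] by algebra
qed

text \<open>Coordinates of the differential of \<open>f\<close> with respect to \<open>xi\<close>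
  and \<open>T\<close>. As one-forms they become the differentials of \<open>\<theta>\<close> and
  \<open>t\<close>.\<close>

definition "\<beta> u v = mink (D1 f u v) (xi u) / r2 u"
definition "\<tau> u v = mink (D1 f u v) (T u) / r2 u"

lemma tangent_frame:
  assumes u: "u \<in> U" "r2 u \<noteq> 0" and x: "mink x (f u) = 0" "mink x (n u) = 0"
  shows "x = (mink x (xi u) / r2 u) *\<^sub>R xi u + (mink x (T u) / r2 u) *\<^sub>R T u"
proof -
  define s where "s = sqrt (r2 u)"
  have s: "s > 0" "s * s = r2 u"
    using r2_nonneg[OF u(1)] u(2) by (auto simp: s_def)
  define g where "g i = (if i = 0 then f u else if i = 1 then n u
    else if i = 2 then (1 / s) *\<^sub>R xi u else (1 / s) *\<^sub>R T u)" for i :: 4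
  have g: "g 0 = f u" "g 1 = n u" "g 2 = (1 / s) *\<^sub>R xi u" "g 3 = (1 / s) *\<^sub>R T u"
    by (simp_all add: g_def)
  have "orthonormal_basis g"
    by (rule orthonormal_basisI)
      (use s u(2) f_mink[OF u(1)] n_unit[OF u(1)] n_f[OF u(1)] frame_orthogonal[OF u] in
        \<open>simp_all add: g mink_simps mink_commute\<close>)
  from orthonormal_basis_expansion[OF this, of x] show ?thesis
    using x s by (simp add: g in_basis_def mink_simps)
qed

lemma D1_frame:
  assumes "u \<in> U" "r2 u \<noteq> 0"
  shows "D1 f u v = \<beta> u v *\<^sub>R xi u + \<tau> u v *\<^sub>R T u"
  unfolding \<beta>_def \<tau>_def
  by (rule tangent_frame[OF assms]) (use assms D1_f n_D1 mink_commute in metis)+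

lemma linear_\<beta>: "u \<in> U \<Longrightarrow> linear (\<beta> u)" and linear_\<tau>: "u \<in> U \<Longrightarrow> linear (\<tau> u)"
  using D1_linear[of u] unfolding \<beta>_def[abs_def] \<tau>_def[abs_def]
  by (auto simp: linear_iff mink_simps add_divide_distrib simp del: split_paired_All)

lemma \<beta>_\<tau>_inj:
  assumes "u \<in> U" "r2 u \<noteq> 0" "\<beta> u v = 0" "\<tau> u v = 0"
  shows "v = 0"
  using D1_frame[OF assms(1,2), of v] D1_inj[OF assms(1)] assms(3,4) by simp

text \<open>Differentiating \<open>mink (n x) (xi x) = 0\<close> makes \<open>xi\<close> an
  eigenvector with factor \<open>k * a / r2\<close>. By symmetry \<open>T\<close> is one too, and
  the mean curvature determines its factor.\<close>

lemma N_frame: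
  assumes u: "u \<in> U" "r2 u \<noteq> 0"
  shows "N u v = (k * a u * \<beta> u v / r2 u) *\<^sub>R xi u - ((2 * H + k * a u / r2 u) * \<tau> u v) *\<^sub>R T u"
proof -
  have xi: "mink (N u v) (xi u) = k * a u * \<beta> u v" for v
  proof -
    have d: "((\<lambda>x. comb (- k * P2 (f x)) (P1 (f x)) 0 0) has_derivative
        (\<lambda>v. comb (- k * P2 (D1 f u v)) (P1 (D1 f u v)) 0 0)) (at u)"
      unfolding comb_def
      by (auto intro!: derivative_eq_intros bounded_linear.has_derivative[OF bounded_linear_coord(1)]
          bounded_linear.has_derivative[OF bounded_linear_coord(2)] D1[OF u(1)])
    have "mink (n x) (comb (- k * P2 (f x)) (P1 (f x)) 0 0) = 0" if "x \<in> U" for x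
      using tangency_coord[OF that] unfolding mink_coord coord_comb coord_defs[symmetric]
      using kk by algebra
    from derivative_orthogonal[OF u(1) d this]
    have "mink (N u v) (xi u) = - mink (n u) (comb (- k * P2 (D1 f u v)) (P1 (D1 f u v)) 0 0)"
      by (simp add: xi_def coord_defs)
    also have "\<dots> = k * a u * \<beta> u v"
      unfolding D1_frame[OF u] mink_coord coord_simps xi_def T_def coord_comb coord_defs[symmetric]
      using a_def[of u] kk tangency_coord[OF u(1)] by algebra
    finally show ?thesis .
  qed
  define L where "L v = (\<beta> u v, \<tau> u v)" for v
  have lin: "linear L"
    using linear_\<beta>[OF u(1)] linear_\<tau>[OF u(1)]
    by (auto simp: linear_iff L_def simp del: split_paired_All)
  have surj: "\<exists>v. L v = w" for w
    by (rule linear_injective_imp_surj_plane[OF lin])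
      (use \<beta>_\<tau>_inj[OF u] in \<open>auto simp: L_def zero_prod_def\<close>)
  obtain v0 where "L v0 = (1, 0)" using surj by blast
  then have v0: "D1 f u v0 = xi u" "\<beta> u v0 = 1"
    using D1_frame[OF u, of v0] by (simp_all add: L_def)
  obtain v1 where "L v1 = (0, 1)" using surj by blast
  then have v1: "D1 f u v1 = T u" "\<beta> u v1 = 0"
    using D1_frame[OF u, of v1] by (simp_all add: L_def)
  have "mink (N u v0) (xi u) + mink (N u v1) (T u) = - 2 * H * r2 u"
    using mean_curvature_trace[OF u(1), of v0 v1 "r2 u"] frame_orthogonal[OF u] u(2) by (simp add: v0 v1)
  then have N11: "mink (N u v1) (T u) = - 2 * H * r2 u - k * a u"
    using xi[of v0] v0 by simp
  have N01: "mink (N u v0) (T u) = 0"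
    using N_symmetric[OF u(1), of v0 v1] xi[of v1] v0 v1 by simp
  have "D1 f u v = D1 f u (\<beta> u v *\<^sub>R v0 + \<tau> u v *\<^sub>R v1)"
    using D1_frame[OF u, of v] D1_linear[OF u(1)] by (simp add: linear_add linear_scale v0 v1)
  then have "D1 f u (v - (\<beta> u v *\<^sub>R v0 + \<tau> u v *\<^sub>R v1)) = 0"
    using D1_linear[OF u(1)] by (simp add: linear_diff)
  then have "v - (\<beta> u v *\<^sub>R v0 + \<tau> u v *\<^sub>R v1) = 0"
    using D1_inj[OF u(1)] by blast
  then have "v = \<beta> u v *\<^sub>R v0 + \<tau> u v *\<^sub>R v1"
    by (simp only: right_minus_eq)
  then have "N u v = N u (\<beta> u v *\<^sub>R v0 + \<tau> u v *\<^sub>R v1)"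
    by (rule arg_cong)
  then have "N u v = \<beta> u v *\<^sub>R N u v0 + \<tau> u v *\<^sub>R N u v1"
    using N_linear[OF u(1)] by (simp only: linear_add linear_scale)
  then have NT: "mink (N u v) (T u) = - (2 * H * r2 u + k * a u) * \<tau> u v"
    by (simp add: mink_simps N01 N11 algebra_simps)
  have "N u v = (mink (N u v) (xi u) / r2 u) *\<^sub>R xi u + (mink (N u v) (T u) / r2 u) *\<^sub>R T u"
    by (rule tangent_frame[OF u]) (simp_all add: N_f N_n u)
  also have "mink (N u v) (T u) / r2 u = - ((2 * H + k * a u / r2 u) * \<tau> u v)"
    using u(2) by (simp add: NT field_simps)
  finally show ?thesis
    by (simp add: xi)
qed

lemma coord_derivative:
  assumes "u \<in> U"
  shows "(p1 has_derivative (\<lambda>v. P1 (D1 f u v))) (at u)" "(p2 has_derivative (\<lambda>v. P2 (D1 f u v))) (at u)"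
    "(q1 has_derivative (\<lambda>v. Q1 (D1 f u v))) (at u)" "(q2 has_derivative (\<lambda>v. Q2 (D1 f u v))) (at u)"
    "(m1 has_derivative (\<lambda>v. P1 (N u v))) (at u)" "(m2 has_derivative (\<lambda>v. P2 (N u v))) (at u)"
    "(l1 has_derivative (\<lambda>v. Q1 (N u v))) (at u)" "(l2 has_derivative (\<lambda>v. Q2 (N u v))) (at u)"
  unfolding coord_defs[abs_def]
  by (intro bounded_linear.has_derivative[OF bounded_linear_coord(1)] bounded_linear.has_derivative[OF bounded_linear_coord(2)]
      bounded_linear.has_derivative[OF bounded_linear_coord(3)] bounded_linear.has_derivative[OF bounded_linear_coord(4)]
      D1 N assms)+

lemma coord_D1:
  assumes "u \<in> U" "r2 u \<noteq> 0"
  shows "P1 (D1 f u v) = - k * p2 u * \<beta> u v + b u * p1 u * \<tau> u v"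
    "P2 (D1 f u v) = p1 u * \<beta> u v + b u * p2 u * \<tau> u v"
    "Q1 (D1 f u v) = (a u * q2 u - k * r2 u * l2 u) * \<tau> u v"
    "Q2 (D1 f u v) = (k * a u * q1 u - r2 u * l1 u) * \<tau> u v"
  unfolding D1_frame[OF assms] coord_simps xi_def T_def coord_comb by (simp_all add: algebra_simps)

lemma coord_N:
  assumes "u \<in> U" "r2 u \<noteq> 0"
  shows "P1 (N u v) = - p2 u * a u * \<beta> u v / r2 u - (2 * H + k * a u / r2 u) * \<tau> u v * (b u * p1 u)"
    "P2 (N u v) = k * p1 u * a u * \<beta> u v / r2 u - (2 * H + k * a u / r2 u) * \<tau> u v * (b u * p2 u)"
    "Q1 (N u v) = - (2 * H + k * a u / r2 u) * \<tau> u v * (a u * q2 u - k * r2 u * l2 u)"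
    "Q2 (N u v) = - (2 * H + k * a u / r2 u) * \<tau> u v * (k * a u * q1 u - r2 u * l1 u)"
proof -
  have N: "N u v = (k * a u * \<beta> u v / r2 u) *\<^sub>R xi u + (- ((2 * H + k * a u / r2 u) * \<tau> u v)) *\<^sub>R T u"
    using N_frame[OF assms] by simp
  show "P1 (N u v) = - p2 u * a u * \<beta> u v / r2 u - (2 * H + k * a u / r2 u) * \<tau> u v * (b u * p1 u)"
    "P2 (N u v) = k * p1 u * a u * \<beta> u v / r2 u - (2 * H + k * a u / r2 u) * \<tau> u v * (b u * p2 u)"
    "Q1 (N u v) = - (2 * H + k * a u / r2 u) * \<tau> u v * (a u * q2 u - k * r2 u * l2 u)"
    "Q2 (N u v) = - (2 * H + k * a u / r2 u) * \<tau> u v * (k * a u * q1 u - r2 u * l1 u)"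
    unfolding N coord_simps xi_def T_def coord_comb using kk by (simp_all add: algebra_simps kk_left)
qed

text \<open>In coordinates rather than in the frame, because the first integral must also be
  differentiated on the axis.\<close>

lemma r2_derivative:
  assumes "u \<in> U"
  shows "(r2 has_derivative (\<lambda>v. 2 * (p1 u * P1 (D1 f u v) + k * p2 u * P2 (D1 f u v)))) (at u)"
  unfolding r2_def[abs_def]
  by (auto intro!: derivative_eq_intros coord_derivative assms simp: algebra_simps)

lemma a_derivative:
  assumes "u \<in> U"
  shows "(a has_derivative (\<lambda>v. k * (P1 (D1 f u v) * m1 u + p1 u * P1 (N u v)) + (P2 (D1 f u v) * m2 u + p2 u * P2 (N u v)))) (at u)"
  unfolding a_def[abs_def]
  by (auto intro!: derivative_eq_intros coord_derivative assms simp: algebra_simps)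

lemma r2_derivative_frame:
  assumes u: "u \<in> U" "r2 u \<noteq> 0"
  shows "(r2 has_derivative (\<lambda>v. 2 * b u * r2 u * \<tau> u v)) (at u)"
  by (rule has_derivative_eq_rhs[OF r2_derivative[OF u(1)]])
    (use kk in \<open>simp add: fun_eq_iff coord_D1[OF u] r2_def power2_eq_square algebra_simps\<close>)

text \<open>The square is completed so that \<open>C = k * a + H * r2\<close> appears, giving
  \<open>C\<^sup>2 / r2 + (1 - H\<^sup>2) * r2\<close>. Differentiating \<open>ab_form\<close>
  instead would yield this only where \<open>b\<close> is nonzero, hence not where \<open>r2\<close>
  is critical.\<close>

lemma b_derivative_frame:
  assumes u: "u \<in> U" "r2 u \<noteq> 0"
  shows "(b has_derivative (\<lambda>v. ((k * a u + H * r2 u)\<^sup>2 / r2 u + (1 - H\<^sup>2) * r2 u) * \<tau> u v)) (at u)"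
proof -
  have "(b has_derivative (\<lambda>v. k * ((Q1 (N u v) * q2 u + l1 u * Q2 (D1 f u v)) - (Q2 (N u v) * q1 u + l2 u * Q1 (D1 f u v))))) (at u)"
    unfolding b_def[abs_def]
    by (auto intro!: derivative_eq_intros coord_derivative u simp: algebra_simps)
  then show ?thesis
  proof (rule has_derivative_eq_rhs, intro ext)
    fix v
    define s where "s = 2 * H + k * a u / r2 u"
    define T3 where "T3 = a u * q2 u - k * r2 u * l2 u"
    define T4 where "T4 = k * a u * q1 u - r2 u * l1 u"
    have 1: "T3 * q2 u - T4 * q1 u = - a u"
      using q_form[OF u(1)] n_f_form[OF u(1)] kk unfolding T3_def T4_def by algebra
    have 2: "l1 u * T4 - l2 u * T3 = k * r2 u"
      using l_form[OF u] n_f_form[OF u(1)] kk unfolding T3_def T4_def by algebra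
    have "k * ((Q1 (N u v) * q2 u + l1 u * Q2 (D1 f u v)) - (Q2 (N u v) * q1 u + l2 u * Q1 (D1 f u v)))
      = k * \<tau> u v * (- s * (T3 * q2 u - T4 * q1 u) + (l1 u * T4 - l2 u * T3))"
      unfolding coord_N[OF u] coord_D1[OF u] s_def[symmetric] T3_def[symmetric] T4_def[symmetric]
      by (simp add: algebra_simps)
    also have "\<dots> = (k * a u * s + r2 u) * \<tau> u v"
      unfolding 1 2 using kk by algebra
    also have "k * a u * s + r2 u = (k * a u + H * r2 u)\<^sup>2 / r2 u + (1 - H\<^sup>2) * r2 u"
      using u(2) kk unfolding s_def by (simp add: field_simps power2_eq_square)
    finally show "k * ((Q1 (N u v) * q2 u + l1 u * Q2 (D1 f u v)) - (Q2 (N u v) * q1 u + l2 u * Q1 (D1 f u v)))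
      = ((k * a u + H * r2 u)\<^sup>2 / r2 u + (1 - H\<^sup>2) * r2 u) * \<tau> u v" .
  qed
qed

text \<open>Differentiating the tangency equation shows that the rotation-plane part of every
  tangent vector is parallel to \<open>(m1, m2)\<close>. Some nonzero tangent vector lies in the
  rotation plane and is also orthogonal to \<open>(m1, m2)\<close>, so this vector vanishes. Then
  \<open>f u\<close> and \<open>n u\<close> span the complement, and everything orthogonal to both
  lies in the rotation plane.\<close>

lemma axis:
  assumes u: "u \<in> U" "r2 u = 0"
  shows "k = 1" "p1 u = 0" "p2 u = 0" "m1 u = 0" "m2 u = 0"
    "Q1 (D1 f u v) = 0" "Q2 (D1 f u v) = 0" "Q1 (N u v) = 0" "Q2 (N u v) = 0"
proof -
  show k: "k = 1"
    using r2_ge[OF u(1)] u(2) k_cases by auto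
  then have k1: "k * x = x" for x
    by simp
  have "(p1 u)\<^sup>2 + (p2 u)\<^sup>2 = 0"
    using u(2) by (simp add: r2_def k1)
  then show p: "p1 u = 0" "p2 u = 0"
    by (auto simp: add_nonneg_eq_0_iff)
  have q: "(q1 u)\<^sup>2 - (q2 u)\<^sup>2 = 1"
    using q_form[OF u(1)] k1 u(2) by (metis add_0 k)
  have ql: "q1 u * l1 u = q2 u * l2 u"
    using n_f_form[OF u(1)] by (simp add: a_def p k1)
  have tangent: "- (Q1 x * q1 u) + Q2 x * q2 u = 0" if "mink x (f u) = 0" for x
    using that by (simp add: mink_coord k1 p flip: coord_defs)
  have m: "m1 u = 0 \<and> m2 u = 0"
  proof -
    have d: "((\<lambda>x. m1 x * p2 x - m2 x * p1 x) has_derivative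
        (\<lambda>v. (m1 u * P2 (D1 f u v) + P1 (N u v) * p2 u) - (m2 u * P1 (D1 f u v) + P2 (N u v) * p1 u))) (at u)"
      by (intro derivative_intros coord_derivative u)
    have "(\<lambda>v. (m1 u * P2 (D1 f u v) + P1 (N u v) * p2 u) - (m2 u * P1 (D1 f u v) + P2 (N u v) * p1 u)) = (\<lambda>v. 0)"
      by (rule derivative_eq_on_U[OF u(1) d has_derivative_const]) (simp add: tangency_coord)
    then have par: "m1 u * P2 (D1 f u v) = m2 u * P1 (D1 f u v)" for v
      using p by (simp add: fun_eq_iff del: split_paired_All)
    \<comment> \<open>A linear functional on the plane has a nonzero kernel vector. Together with
      orthogonality to \<open>f u\<close>, \<open>g v = 0\<close> is a regular system for the two
      \<open>Q\<close> coordinates, with determinant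
      \<open>(q1 u)\<^sup>2 - (q2 u)\<^sup>2 = 1\<close>.\<close>
    define g where "g v = q1 u * Q2 (D1 f u v) - q2 u * Q1 (D1 f u v)" for v
    have g: "g (x *\<^sub>R v + y *\<^sub>R w) = x * g v + y * g w" for x y v w
      using D1_linear[OF u(1)] by (simp add: g_def linear_add linear_scale coord_simps algebra_simps)
    obtain v :: "real \<times> real" where v: "v \<noteq> 0" "g v = 0"
    proof (cases "g (1, 0) = 0")
      case True
      then show ?thesis using that[of "(1, 0)"] by (simp add: zero_prod_def)
    next
      case False
      have "g (g (0, 1) *\<^sub>R (1, 0) + (- g (1, 0)) *\<^sub>R (0, 1)) = 0"
        unfolding g by simp
      moreover have "g (0, 1) *\<^sub>R (1 :: real, 0 :: real) + (- g (1, 0)) *\<^sub>R (0, 1) \<noteq> 0"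
        using False by (simp add: zero_prod_def)
      ultimately show ?thesis using that by blast
    qed
    have t: "- (Q1 (D1 f u v) * q1 u) + Q2 (D1 f u v) * q2 u = 0"
      by (rule tangent[OF D1_f[OF u(1)]])
    have Q: "Q1 (D1 f u v) = 0" "Q2 (D1 f u v) = 0"
      using t v(2) q unfolding g_def by algebra+
    have "m1 u * P1 (D1 f u v) + m2 u * P2 (D1 f u v) = 0"
      using n_D1[OF u(1), of v] Q by (simp add: mink_coord k1 flip: coord_defs)
    then have P: "((m1 u)\<^sup>2 + (m2 u)\<^sup>2) * P1 (D1 f u v) = 0" "((m1 u)\<^sup>2 + (m2 u)\<^sup>2) * P2 (D1 f u v) = 0"
      using par[of v] by algebra+
    have "(m1 u)\<^sup>2 + (m2 u)\<^sup>2 = 0"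
    proof (rule ccontr)
      assume "(m1 u)\<^sup>2 + (m2 u)\<^sup>2 \<noteq> 0"
      then have "P1 (D1 f u v) = 0" "P2 (D1 f u v) = 0"
        using P by auto
      then have "D1 f u v = 0"
        using Q comb_coord[of "D1 f u v"] by (simp add: comb_def)
      then show False
        using D1_inj[OF u(1)] v by blast
    qed
    then show ?thesis
      by (simp add: add_nonneg_eq_0_iff)
  qed
  then show "m1 u = 0" "m2 u = 0" by auto
  have l: "(l2 u)\<^sup>2 - (l1 u)\<^sup>2 = 1"
    using n_form[OF u(1)] m by (simp add: k1)
  have Q0: "Q1 x = 0 \<and> Q2 x = 0" if x: "mink x (f u) = 0" "mink x (n u) = 0" for x
  proof -
    have "- (Q1 x * l1 u) + Q2 x * l2 u = 0"
      using x(2) m by (simp add: mink_coord k1 flip: coord_defs)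
    moreover have "(q1 u * l2 u - q2 u * l1 u)\<^sup>2 = 1"
      using q l ql by algebra
    ultimately show ?thesis
      using tangent[OF x(1)] q l ql by algebra
  qed
  have "mink (D1 f u v) (n u) = 0"
    using n_D1[OF u(1)] mink_commute by metis
  then show "Q1 (D1 f u v) = 0" "Q2 (D1 f u v) = 0"
    using Q0[OF D1_f[OF u(1)]] by auto
  show "Q1 (N u v) = 0" "Q2 (N u v) = 0"
    using Q0[OF N_f[OF u(1)] N_n[OF u(1)]] by auto
qed

text \<open>Off the axis the terms containing the curvature in direction \<open>xi\<close> cancel in
  the derivative of \<open>k * a\<close>, which leaves \<open>- 2 * H * b * r2 * \<tau>\<close>,
  that is \<open>- H\<close> times the derivative of \<open>r2\<close>. On the axis every summand
  has a vanishing factor.\<close>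

lemma first_integral: "\<exists>C. \<forall>u\<in>U. k * a u + H * r2 u = C"
proof -
  have "((\<lambda>x. k * a x + H * r2 x) has_derivative (\<lambda>v. 0)) (at u)" if u: "u \<in> U" for u
  proof -
    have "((\<lambda>x. k * a x + H * r2 x) has_derivative
      (\<lambda>v. k * (k * (P1 (D1 f u v) * m1 u + p1 u * P1 (N u v)) + (P2 (D1 f u v) * m2 u + p2 u * P2 (N u v)))
        + H * (2 * (p1 u * P1 (D1 f u v) + k * p2 u * P2 (D1 f u v))))) (at u)"
      by (intro derivative_intros r2_derivative a_derivative u)
    then show ?thesis
    proof (rule has_derivative_eq_rhs, intro ext)
      fix v
      show "k * (k * (P1 (D1 f u v) * m1 u + p1 u * P1 (N u v)) + (P2 (D1 f u v) * m2 u + p2 u * P2 (N u v)))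
        + H * (2 * (p1 u * P1 (D1 f u v) + k * p2 u * P2 (D1 f u v))) = 0"
      proof (cases "r2 u = 0")
        case True
        then show ?thesis using axis[OF u True] by simp
      next
        case False
        define s where "s = k * a u / r2 u"
        have s: "r2 u * s = k * a u"
          using False by (simp add: s_def)
        have m: "m1 u = s * p1 u" "m2 u = s * p2 u"
          using r2_m[OF u] False by (simp_all add: s_def field_simps)
        have "P1 (N u v) = - k * p2 u * s * \<beta> u v - (2 * H + s) * \<tau> u v * (b u * p1 u)"
          "P2 (N u v) = p1 u * s * \<beta> u v - (2 * H + s) * \<tau> u v * (b u * p2 u)"
          unfolding coord_N[OF u False] s_def using kk by (simp_all add: algebra_simps)
        then show ?thesis
          unfolding coord_D1[OF u False] m using kk by algebra
      qed
    qed
  qed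
  from has_derivative_zero_unique_connected[OF U(1,2) this] U(3) show ?thesis
    by blast
qed

end

subsection \<open>The profile curve\<close>

text \<open>The quadratic formula. For \<open>C = 0\<close> and \<open>k = 1\<close> one has
  \<open>B = d = 1\<close> and the larger root is 0; this is the excluded case.\<close>

lemma exists_admissible:
  assumes H: "H\<^sup>2 < 1" and k: "k = 1 \<or> k = -1" and C: "C \<noteq> 0 \<or> k = -1"
  shows "\<exists>Cp Cm p. admissible k H C Cp Cm p"
proof -
  define h where "h = 1 - H\<^sup>2"
  define B where "B = k + 2 * H * C"
  define d where "d = sqrt (B\<^sup>2 + 4 * h * C\<^sup>2)"
  have h: "h > 0" using H by (simp add: h_def)
  have d2: "d\<^sup>2 = B\<^sup>2 + 4 * h * C\<^sup>2"
    using h by (simp add: d_def add_nonneg_nonneg)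
  have d0: "d \<ge> 0" using h by (simp add: d_def)
  have dB: "d > B \<and> d \<ge> - B"
  proof (cases "C = 0")
    case True
    then have "B = -1" "d = 1" using C by (simp_all add: B_def d_def)
    then show ?thesis by simp
  next
    case False
    then have "4 * h * C\<^sup>2 > 0" using h by simp
    then have "\<bar>B\<bar> < d"
      unfolding d_def real_sqrt_abs[symmetric] by (intro real_sqrt_less_mono) simp
    then show ?thesis by linarith
  qed
  define Cp where "Cp = (d - B) / (2 * h)"
  define Cm where "Cm = (- d - B) / (2 * h)"
  have Cp: "Cp > 0" and Cm: "Cm \<le> 0"
    using dB h by (simp_all add: Cp_def Cm_def divide_nonpos_pos)
  have root: "poly_C k H C x = 0" if "x * (2 * h) = s * d - B" "s\<^sup>2 = 1" for x s
  proof -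
    have "4 * h * poly_C k H C x = 0"
      using that d2 unfolding poly_C_def h_def B_def by algebra
    then show ?thesis using h by simp
  qed
  have "poly_C k H C Cp = 0" "poly_C k H C Cm = 0"
    using h by (auto intro: root[of _ 1] root[of _ "-1"] simp: Cp_def Cm_def)
  moreover define p where "p = sqrt (- Cm / (Cp - Cm))"
  moreover have "0 \<le> - Cm / (Cp - Cm)" "- Cm / (Cp - Cm) \<le> 1"
    using Cp Cm by (simp_all add: field_simps)
  ultimately show ?thesis
    using Cp Cm unfolding admissible_def
    by (intro exI[of _ Cp] exI[of _ Cm] exI[of _ p]) (auto simp: p_def)
qed

locale rotational_profile = rotational_frame +
  fixes C Cp Cm p :: real
  assumes H: "H\<^sup>2 < 1"
    and C: "u \<in> U \<Longrightarrow> k * a u + H * r2 u = C"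
    and admissible: "admissible k H C Cp Cm p"
    and r2_nz: "u \<in> U \<Longrightarrow> r2 u \<noteq> 0"
begin

lemma Cp: "0 < Cp" and Cm: "Cm \<le> 0"
  using admissible by (auto simp: admissible_def)

lemma r2_pos: "u \<in> U \<Longrightarrow> 0 < r2 u"
  using r2_nonneg[of u] r2_nz[of u] by simp

definition "h = 1 - H\<^sup>2"

lemma h: "h > 0"
  using H by (simp add: h_def)

lemma vieta: "h * (Cp + Cm) = - (k + 2 * H * C)" "h * Cp * Cm = - C\<^sup>2"
proof -
  have roots: "poly_C k H C Cp = 0" "poly_C k H C Cm = 0"
    using admissible by (auto simp: admissible_def)
  then have "(Cp - Cm) * (h * (Cp + Cm) + (k + 2 * H * C)) = 0"
    unfolding poly_C_def h_def by algebra
  then show 1: "h * (Cp + Cm) = - (k + 2 * H * C)"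
    using Cp Cm by auto
  show "h * Cp * Cm = - C\<^sup>2"
    using roots(1) 1 unfolding poly_C_def h_def by algebra
qed

lemma p: "0 \<le> p" "p < 1"
proof -
  have p2: "p\<^sup>2 = - Cm / (Cp - Cm)" and p0: "0 \<le> p"
    using admissible by (auto simp: admissible_def)
  show "0 \<le> p" by (rule p0)
  have "p\<^sup>2 < 1"
    using Cp Cm by (simp add: p2 field_simps)
  then show "p < 1"
    using p0 by (simp add: abs_square_less_1)
qed

definition "\<Xi> = Xi H Cp Cm"

lemma Xi: "0 < \<Xi>" "\<Xi>\<^sup>2 = h * (Cp - Cm)"
  using h Cp Cm by (simp_all add: \<Xi>_def Xi_def h_def)

lemma a_eq:
  assumes "u \<in> U"
  shows "a u = k * (C - H * r2 u)"
  using C[OF assms, symmetric] by (simp add: kk_left)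

text \<open>Inserting the first integral into \<open>ab_form\<close> turns the right-hand side into
  \<open>- poly_C k H C (r2 u)\<close>, here factored by its roots.\<close>

lemma b_squared: "u \<in> U \<Longrightarrow> r2 u * (b u)\<^sup>2 = h * (r2 u - Cp) * (r2 u - Cm)"
proof -
  assume u: "u \<in> U"
  show ?thesis
    using ab_form[OF u r2_nz[OF u]] C[OF u] vieta kk unfolding h_def by algebra
qed

text \<open>The left-hand side of \<open>b_squared\<close> is nonnegative and \<open>r2\<close> lies
  above the nonpositive root \<open>Cm\<close>.\<close>

lemma r2_ge_Cp:
  assumes "u \<in> U"
  shows "Cp \<le> r2 u"
proof -
  have "0 \<le> h * (r2 u - Cp) * (r2 u - Cm)"
    using b_squared[OF assms] r2_pos[OF assms] by (metis less_eq_real_def mult_nonneg_nonneg zero_le_power2)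
  moreover have "0 < h * (r2 u - Cm)"
    using h r2_pos[OF assms] Cm by simp
  ultimately have "0 \<le> (r2 u - Cp) * (h * (r2 u - Cm))" by (simp add: mult.assoc mult.left_commute)
  then show ?thesis
    using \<open>0 < h * (r2 u - Cm)\<close> by (simp add: zero_le_mult_iff)
qed

text \<open>Putting \<open>tan \<phi> = b / D\<close> turns \<open>r2 * b\<^sup>2 = h * (r2 - Cp) * (r2 - Cm)\<close> into \<open>r2 = Cp / (cos \<phi>)\<^sup>2\<close> and
  \<open>D = \<Xi> * sqrt (1 - p\<^sup>2 * (sin \<phi>)\<^sup>2)\<close>. Since \<open>d\<phi> = D * \<tau>\<close>, the elliptic integral \<open>t\<close> satisfies
  \<open>dt = \<tau>\<close> and \<open>\<phi>\<close> is the amplitude of \<open>\<Xi> * t\<close>.\<close>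

definition "D u = sqrt (h * Cp * (1 - Cm / r2 u))"
definition "\<phi> u = arctan (b u / D u)"
definition "t u = elliptic_F p (\<phi> u) / \<Xi>"

lemma D_radicand_pos: "u \<in> U \<Longrightarrow> 0 < h * Cp * (1 - Cm / r2 u)"
  using h Cp Cm r2_pos[of u] by (intro mult_pos_pos) (auto simp: field_simps)

lemma D: "u \<in> U \<Longrightarrow> 0 < D u"
  "u \<in> U \<Longrightarrow> (D u)\<^sup>2 = h * Cp * (r2 u - Cm) / r2 u"
  "u \<in> U \<Longrightarrow> (D u)\<^sup>2 + (b u)\<^sup>2 = h * (r2 u - Cm)"
proof -
  assume u: "u \<in> U"
  show "0 < D u" using D_radicand_pos[OF u] by (simp add: D_def)
  show D2: "(D u)\<^sup>2 = h * Cp * (r2 u - Cm) / r2 u"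
    using D_radicand_pos[OF u] r2_nz[OF u] by (simp add: D_def) (simp add: field_simps)
  have "r2 u * ((D u)\<^sup>2 + (b u)\<^sup>2) = r2 u * (h * (r2 u - Cm))"
    unfolding D2 distrib_left b_squared[OF u] using r2_nz[OF u] by (simp add: field_simps)
  then show "(D u)\<^sup>2 + (b u)\<^sup>2 = h * (r2 u - Cm)"
    using r2_nz[OF u] by simp
qed

lemma cos_\<phi>: "u \<in> U \<Longrightarrow> (cos (\<phi> u))\<^sup>2 = Cp / r2 u"
proof -
  assume u: "u \<in> U"
  have "(cos (\<phi> u))\<^sup>2 = 1 / (1 + (b u / D u)\<^sup>2)"
    by (simp add: \<phi>_def cos_arctan power_divide add_nonneg_nonneg)
  also have "\<dots> = (D u)\<^sup>2 / ((D u)\<^sup>2 + (b u)\<^sup>2)"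
    using D(1)[OF u] by (simp add: field_simps)
  also have "\<dots> = Cp / r2 u"
    by (subst D(3)[OF u], subst D(2)[OF u]) (use h Cm r2_pos[OF u] in \<open>simp add: field_simps\<close>)
  finally show ?thesis .
qed

lemma \<phi>_bounds: "\<bar>\<phi> u\<bar> < pi / 2"
  using arctan_lbound[of "b u / D u"] arctan_ubound[of "b u / D u"] by (simp add: \<phi>_def abs_less_iff)

lemma D_eq: "u \<in> U \<Longrightarrow> D u = \<Xi> * sqrt (1 - p\<^sup>2 * (sin (\<phi> u))\<^sup>2)"
proof -
  assume u: "u \<in> U"
  have p2: "p\<^sup>2 = - Cm / (Cp - Cm)"
    using admissible by (auto simp: admissible_def)
  have "(D u)\<^sup>2 = \<Xi>\<^sup>2 * (1 - p\<^sup>2 * (1 - Cp / r2 u))"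
    unfolding D(2)[OF u] Xi(2) p2 using r2_pos[OF u] Cp Cm by (simp add: field_simps)
  then have "D u = sqrt (\<Xi>\<^sup>2 * (1 - p\<^sup>2 * (1 - Cp / r2 u)))"
    using D(1)[OF u] by (metis less_eq_real_def real_sqrt_unique)
  then show ?thesis
    using Xi(1) by (simp add: sin_squared_eq cos_\<phi>[OF u] real_sqrt_mult)
qed

lemma D_derivative:
  assumes u: "u \<in> U"
  shows "(D has_derivative (\<lambda>v. - C\<^sup>2 * b u * \<tau> u v / (D u * r2 u))) (at u)"
proof -
  note nz = r2_nz[OF u]
  have d: "(D has_derivative (\<lambda>v. (h * Cp * (Cm * (2 * b u * r2 u * \<tau> u v) / (r2 u * r2 u))) * (inverse (sqrt (h * Cp * (1 - Cm / r2 u))) / 2))) (at u)"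
    unfolding D_def[abs_def]
    by (rule derivative_eq_intros r2_derivative_frame u nz refl | rule D_radicand_pos)+ (auto simp: u)
  show ?thesis
  proof (rule has_derivative_eq_rhs[OF d], intro ext)
    fix v
    have "h * Cp * (Cm * (2 * b u * r2 u * \<tau> u v) / (r2 u * r2 u)) * (inverse (sqrt (h * Cp * (1 - Cm / r2 u))) / 2)
      = (h * Cp * Cm) * b u * \<tau> u v / (D u * r2 u)"
      unfolding D_def[symmetric] using nz D(1)[OF u] by (simp add: field_simps)
    then show "h * Cp * (Cm * (2 * b u * r2 u * \<tau> u v) / (r2 u * r2 u)) * (inverse (sqrt (h * Cp * (1 - Cm / r2 u))) / 2)
      = - C\<^sup>2 * b u * \<tau> u v / (D u * r2 u)"
      by (simp add: vieta)
  qed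
qed

text \<open>With \<open>X = D\<^sup>2 + b\<^sup>2\<close> the numerator of the quotient rule
  collapses to \<open>\<tau> * D * X\<close>, and \<open>X\<close> cancels against the derivative of
  \<open>arctan\<close>. Nothing is divided by \<open>b\<close>, so minima of \<open>r2\<close>,
  where \<open>b = 0\<close>, are no exception.\<close>

lemma \<phi>_derivative:
  assumes u: "u \<in> U"
  shows "(\<phi> has_derivative (\<lambda>v. D u * \<tau> u v)) (at u)"
proof -
  note nz = r2_nz[OF u]
  note dD = D_derivative[OF u]
  have db: "(b has_derivative (\<lambda>v. (C\<^sup>2 / r2 u + h * r2 u) * \<tau> u v)) (at u)"
    using b_derivative_frame[OF u nz] by (simp add: C[OF u] h_def)
  have "((\<lambda>x. b x / D x) has_derivative (\<lambda>v. ((C\<^sup>2 / r2 u + h * r2 u) * \<tau> u v * D u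
      - b u * (- C\<^sup>2 * b u * \<tau> u v / (D u * r2 u))) / (D u * D u))) (at u)"
    by (rule has_derivative_divide'[OF db dD]) (use D(1)[OF u] in simp)
  from DERIV_compose_FDERIV[OF DERIV_arctan this]
  have "(\<phi> has_derivative (\<lambda>v. ((C\<^sup>2 / r2 u + h * r2 u) * \<tau> u v * D u
      - b u * (- C\<^sup>2 * b u * \<tau> u v / (D u * r2 u))) / (D u * D u) * inverse (1 + (b u / D u)\<^sup>2))) (at u)"
    unfolding \<phi>_def[abs_def] .
  then show ?thesis
  proof (rule has_derivative_eq_rhs, intro ext)
    fix v
    define X where "X = (D u)\<^sup>2 + (b u)\<^sup>2"
    have X: "X > 0"
      using D(1)[OF u] by (simp add: X_def add_pos_nonneg)
    have D2: "(D u)\<^sup>2 = h * Cp + C\<^sup>2 / r2 u"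
      using vieta(2) nz unfolding D(2)[OF u] by (simp add: field_simps)
    have "X = h * (r2 u - Cm)"
      unfolding X_def by (rule D(3)[OF u])
    then have rX: "h * r2 u * (D u)\<^sup>2 = h * Cp * X"
      unfolding D(2)[OF u] using nz by simp
    have inv: "inverse (1 + (b u / D u)\<^sup>2) = (D u)\<^sup>2 / X"
      using D(1)[OF u] X by (simp add: X_def field_simps)
    have num: "(C\<^sup>2 / r2 u + h * r2 u) * \<tau> u v * D u - b u * (- C\<^sup>2 * b u * \<tau> u v / (D u * r2 u))
      = \<tau> u v / D u * (C\<^sup>2 / r2 u * X + h * r2 u * (D u)\<^sup>2)"
      using D(1)[OF u] nz by (simp add: X_def field_simps power2_eq_square)
    also have "\<dots> = \<tau> u v / D u * ((D u)\<^sup>2 * X)"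
      by (simp only: rX, simp only: D2) (simp add: algebra_simps)
    also have "\<dots> = \<tau> u v * D u * X"
      using D(1)[OF u] by (simp add: power2_eq_square)
    finally have "(C\<^sup>2 / r2 u + h * r2 u) * \<tau> u v * D u - b u * (- C\<^sup>2 * b u * \<tau> u v / (D u * r2 u)) = \<tau> u v * D u * X" .
    then show "((C\<^sup>2 / r2 u + h * r2 u) * \<tau> u v * D u
      - b u * (- C\<^sup>2 * b u * \<tau> u v / (D u * r2 u))) / (D u * D u) * inverse (1 + (b u / D u)\<^sup>2) = D u * \<tau> u v"
      unfolding inv using D(1)[OF u] X by (simp add: power2_eq_square)
  qed
qed

lemma t_derivative:
  assumes u: "u \<in> U"
  shows "(t has_derivative \<tau> u) (at u)"
proof -
  have "((\<lambda>x. elliptic_F p (\<phi> x) / \<Xi>) has_derivative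
      (\<lambda>v. (D u * \<tau> u v) * (1 / sqrt (1 - p\<^sup>2 * (sin (\<phi> u))\<^sup>2)) / \<Xi>)) (at u)"
    by (rule bounded_linear.has_derivative[OF bounded_linear_divide])
      (rule DERIV_compose_FDERIV[OF elliptic_F_has_real_derivative[OF p] \<phi>_derivative[OF u]])
  moreover have "(D u * x) * (1 / sqrt (1 - p\<^sup>2 * (sin (\<phi> u))\<^sup>2)) / \<Xi> = x" for x
    unfolding D_eq[OF u] using Xi(1) elliptic_radicand_pos[OF p, of "\<phi> u"] by simp
  ultimately show ?thesis
    by (simp add: t_def[abs_def])
qed

lemma am_t: "jacobi_am p (\<Xi> * t u) = \<phi> u"
  using Xi(1) by (simp add: t_def jacobi_am_elliptic_F[OF p])

lemma t_bounds: "\<bar>\<Xi> * t u\<bar> < elliptic_K p"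
  using \<phi>_bounds[of u] abs_less_elliptic_K_iff[OF p] Xi(1) by (simp add: t_def)

lemma t_domain: "(x, t u) \<in> param_domain H Cp Cm p"
  using t_bounds by (simp add: param_domain_def \<Xi>_def)

lemma profile_r_t:
  assumes u: "u \<in> U"
  shows "(profile_r H Cp Cm p (t u))\<^sup>2 = r2 u" "0 < profile_r H Cp Cm p (t u)"
    "profile_r H Cp Cm p (t u) = sqrt (r2 u)"
proof -
  show 1: "(profile_r H Cp Cm p (t u))\<^sup>2 = r2 u"
    using cos_\<phi>[OF u] Cp r2_pos[OF u]
    by (simp add: profile_r_squared[OF p Cp] jacobi_cn_def am_t[unfolded \<Xi>_def])
  show 2: "0 < profile_r H Cp Cm p (t u)"
    using profile_r_pos[OF p Cp] t_bounds by (simp add: \<Xi>_def)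
  show "profile_r H Cp Cm p (t u) = sqrt (r2 u)"
    using 1 2 by (metis less_eq_real_def real_sqrt_unique)
qed

definition "\<psi> u = profile_\<psi> k H C Cp Cm p (t u)"

lemma \<psi>_derivative:
  assumes u: "u \<in> U" and pos: "0 < Cp + k"
  shows "(\<psi> has_derivative (\<lambda>v. a u * \<tau> u v / (r2 u + k))) (at u)"
proof -
  have "(profile_\<psi> k H C Cp Cm p has_real_derivative k * (C - H * r2 u) / (r2 u + k)) (at (t u))"
    using profile_\<psi>_has_real_derivative[OF p k_cases Cp pos, of H Cm "t u"] Xi(1) t_bounds[of u]
    by (simp add: \<Xi>_def profile_r_t(1)[OF u])
  from DERIV_compose_FDERIV[OF this t_derivative[OF u]] show ?thesis
    unfolding \<psi>_def[abs_def] by (simp add: a_eq[OF u] mult.commute)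
qed

end

section \<open>Local inverses and hyperbolic angles\<close>

text \<open>Lets continuity of a derivative in each fixed direction imply continuity in operator
  norm.\<close>

lemma plane_linear_bound:
  fixes L :: "real \<times> real \<Rightarrow> 'a::real_normed_vector"
  assumes "linear L"
  shows "norm (L v) \<le> (norm (L (1, 0)) + norm (L (0, 1))) * norm v"
proof -
  have "L v = L (fst v *\<^sub>R (1, 0) + snd v *\<^sub>R (0, 1))"
    by simp
  also have "\<dots> = fst v *\<^sub>R L (1, 0) + snd v *\<^sub>R L (0, 1)"
    by (simp only: linear_add[OF assms] linear_scale[OF assms])
  finally have "L v = fst v *\<^sub>R L (1, 0) + snd v *\<^sub>R L (0, 1)" .
  then have "norm (L v) \<le> \<bar>fst v\<bar> * norm (L (1, 0)) + \<bar>snd v\<bar> * norm (L (0, 1))"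
    using norm_triangle_ineq[of "fst v *\<^sub>R L (1, 0)" "snd v *\<^sub>R L (0, 1)"] by simp
  also have "\<dots> \<le> norm v * norm (L (1, 0)) + norm v * norm (L (0, 1))"
    using norm_fst_le[of "fst v" "snd v"] norm_snd_le[of "snd v" "fst v"]
    by (intro add_mono mult_right_mono) auto
  finally show ?thesis
    by (simp add: algebra_simps)
qed

text \<open>Inverse function theorem in the plane: a continuous injective derivative gives local
  injectivity, invariance of domain gives openness and a continuous inverse, and the left inverse of
  the derivative differentiates that inverse.\<close>

lemma local_diffeomorphism:
  fixes h :: "real \<times> real \<Rightarrow> real \<times> real"
  assumes U: "open U" "u \<in> U"
    and h: "\<And>x. x \<in> U \<Longrightarrow> (h has_derivative h' x) (at x)"
    and cont: "\<And>v. continuous_on U (\<lambda>x. h' x v)"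
    and inj: "\<And>x v. x \<in> U \<Longrightarrow> h' x v = 0 \<Longrightarrow> v = 0"
  obtains V where "open V" "u \<in> V" "V \<subseteq> U" "open (h ` V)" "diffeomorphism V (h ` V) h"
proof -
  have lin: "linear (h' x)" if "x \<in> U" for x
    using h[OF that] has_derivative_bounded_linear bounded_linear.linear by blast
  have left_inverse: "\<exists>g. bounded_linear g \<and> g \<circ> h' x = id" if "x \<in> U" for x
  proof -
    have "inj (h' x)"
      using lin[OF that] inj[OF that] linear_injective_0 by blast
    then show ?thesis
      using linear_injective_left_inverse[OF lin[OF that]] linear_conv_bounded_linear by blast
  qed
  obtain g' where g': "bounded_linear g'" "g' \<circ> h' u = id"
    using left_inverse[OF U(2)] by blast
  have "\<exists>d>0. \<forall>x. dist u x < d \<longrightarrow> onorm (\<lambda>v. h' x v - h' u v) < e" if e: "e > 0" for e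
  proof -
    define w :: "real \<times> real \<Rightarrow> real" where
      "w x = norm (h' x (1, 0) - h' u (1, 0)) + norm (h' x (0, 1) - h' u (0, 1))" for x
    have "continuous_on U w"
      unfolding w_def by (intro continuous_intros cont)
    then have "isCont w u"
      using U continuous_on_eq_continuous_at by blast
    then obtain d1 where d1: "d1 > 0" "\<And>x. norm (x - u) < d1 \<Longrightarrow> \<bar>w x - w u\<bar> < e / 2"
      using half_gt_zero[OF e] unfolding continuous_at_eps_delta dist_norm real_norm_def by metis
    obtain d2 where d2: "d2 > 0" "ball u d2 \<subseteq> U"
      using U by (meson open_contains_ball)
    have "onorm (\<lambda>v. h' x v - h' u v) < e" if x: "dist u x < min d1 d2" for x
    proof -
      have xU: "x \<in> U" using d2 x by (auto simp: subset_eq)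
      have "linear (\<lambda>v. h' x v - h' u v)"
        using lin[OF xU] lin[OF U(2)] by (rule linear_compose_sub)
      from plane_linear_bound[OF this] have "onorm (\<lambda>v. h' x v - h' u v) \<le> w x"
        by (intro onorm_le) (simp add: w_def)
      also have "w x < e"
        using d1(2)[of x] x e by (simp add: w_def dist_norm norm_minus_commute)
      finally show ?thesis .
    qed
    then show ?thesis
      using d1 d2 by (metis min_less_iff_conj)
  qed
  from has_derivative_locally_injective[OF U(2,1) g' h this]
  obtain r where r: "r > 0" "ball u r \<subseteq> U" "inj_on h (ball u r)"
    by blast
  define V where "V = ball u r"
  have V: "open V" "u \<in> V" "V \<subseteq> U" "inj_on h V"
    using r by (auto simp: V_def)
  have hV: "continuous_on V h"
    using V h by (meson continuous_at_imp_continuous_on has_derivative_continuous subsetD)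
  have op: "open (h ` V)"
    by (rule invariance_of_domain_gen[OF V(1) hV V(4)]) simp
  obtain g where g: "homeomorphism V (h ` V) h g"
    using invariance_of_domain_homeomorphism[OF V(1) hV _ V(4)] by auto
  have "g differentiable (at (h x))" if x: "x \<in> V" for x
  proof -
    obtain g' where g': "bounded_linear g'" "g' \<circ> h' x = id"
      using left_inverse x V(3) by blast
    have "(g has_derivative g') (at (h x))"
      by (rule has_derivative_inverse_dieudonne[OF V(1) op hV _ _ x h g'])
        (use g V x in \<open>auto simp: homeomorphism_def\<close>)
    then show ?thesis by (auto simp: differentiable_def)
  qed
  then have "g differentiable_on h ` V"
    by (auto simp: differentiable_on_def intro: differentiable_at_withinI)
  moreover have "h differentiable_on V"
    using h V(3) by (meson differentiableI differentiable_at_withinI differentiable_on_def subsetD)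
  ultimately have "diffeomorphism V (h ` V) h"
    using g by (auto simp: diffeomorphism_def)
  then show thesis
    using that V op by blast
qed

text \<open>The polar angle \<open>artanh (y / x)\<close> of a point in the Lorentzian plane.\<close>

definition hyp_angle :: "real \<Rightarrow> real \<Rightarrow> real" where
  "hyp_angle x y = (ln (x + y) - ln (x - y)) / 2"

context
  fixes x y s :: real
  assumes x: "0 < x" and s: "x\<^sup>2 - y\<^sup>2 = s" "0 < s"
begin

lemma hyp_angle_pos: "0 < x + y" "0 < x - y"
proof -
  have "\<bar>y\<bar> < x"
    using s x by (intro power2_less_imp_less[of "\<bar>y\<bar>" x]) auto
  then show "0 < x + y" "0 < x - y" by auto
qed

text \<open>In the null coordinates \<open>x + y\<close> and \<open>x - y\<close> a hyperbolic
  rotation acts by reciprocal factors.\<close>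

lemma hyp_angle_exp: "sqrt s * exp (hyp_angle x y) = x + y" "sqrt s * exp (- hyp_angle x y) = x - y"
proof -
  have "s = (x + y) * (x - y)"
    unfolding s(1)[symmetric] by (simp add: power2_eq_square algebra_simps)
  then have sq: "sqrt s = sqrt (x + y) * sqrt (x - y)"
    by (simp only: real_sqrt_mult)
  have 1: "exp (ln z / 2) = sqrt z" if "z > 0" for z :: real
    using that by (simp flip: ln_sqrt)
  have e: "exp (hyp_angle x y) = sqrt (x + y) / sqrt (x - y)"
    using hyp_angle_pos by (simp add: hyp_angle_def diff_divide_distrib exp_diff 1)
  show "sqrt s * exp (hyp_angle x y) = x + y"
    unfolding sq e using hyp_angle_pos by simp
  show "sqrt s * exp (- hyp_angle x y) = x - y"
    unfolding sq exp_minus e using hyp_angle_pos by simp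
qed

lemma hyp_angle_cosh: "sqrt s * cosh (hyp_angle x y) = x"
  and hyp_angle_sinh: "sqrt s * sinh (hyp_angle x y) = y"
  using hyp_angle_exp by (simp_all add: cosh_field_def sinh_field_def algebra_simps)

end

lemma hyp_angle_derivative:
  assumes x: "(x has_derivative x') (at u)" and y: "(y has_derivative y') (at u)"
    and pos: "0 < x u" "(x u)\<^sup>2 - (y u)\<^sup>2 = s" "0 < s"
  shows "((\<lambda>w. hyp_angle (x w) (y w)) has_derivative (\<lambda>v. (x u * y' v - y u * x' v) / s)) (at u)"
proof -
  note p = hyp_angle_pos[OF pos]
  have 1: "((\<lambda>w. ln (x w + y w)) has_derivative (\<lambda>v. (x' v + y' v) * (1 / (x u + y u)))) (at u)"
    by (rule DERIV_compose_FDERIV[OF DERIV_ln_divide[OF p(1)] has_derivative_add[OF x y]])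
  have 2: "((\<lambda>w. ln (x w - y w)) has_derivative (\<lambda>v. (x' v - y' v) * (1 / (x u - y u)))) (at u)"
    by (rule DERIV_compose_FDERIV[OF DERIV_ln_divide[OF p(2)] has_derivative_diff[OF x y]])
  have "((\<lambda>w. hyp_angle (x w) (y w)) has_derivative
    (\<lambda>v. ((x' v + y' v) * (1 / (x u + y u)) - (x' v - y' v) * (1 / (x u - y u))) / 2)) (at u)"
    unfolding hyp_angle_def by (rule bounded_linear.has_derivative[OF bounded_linear_divide has_derivative_diff[OF 1 2]])
  then show ?thesis
  proof (rule has_derivative_eq_rhs, intro ext)
    fix v
    have s: "s = (x u + y u) * (x u - y u)"
      unfolding pos(2)[symmetric] by (simp add: power2_eq_square algebra_simps)
    show "((x' v + y' v) * (1 / (x u + y u)) - (x' v - y' v) * (1 / (x u - y u))) / 2 = (x u * y' v - y u * x' v) / s"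
      unfolding s using p by (simp add: divide_simps) (simp add: algebra_simps)
  qed
qed

section \<open>Angle and time as coordinates\<close>

context rotational_profile
begin

lemma continuous_on_coord:
  "continuous_on U p1" "continuous_on U p2" "continuous_on U q1" "continuous_on U q2"
  "continuous_on U m1" "continuous_on U m2" "continuous_on U l1" "continuous_on U l2"
  by (intro continuous_at_imp_continuous_on ballI has_derivative_continuous[OF coord_derivative(1)]
      has_derivative_continuous[OF coord_derivative(2)] has_derivative_continuous[OF coord_derivative(3)]
      has_derivative_continuous[OF coord_derivative(4)] has_derivative_continuous[OF coord_derivative(5)]
      has_derivative_continuous[OF coord_derivative(6)] has_derivative_continuous[OF coord_derivative(7)]
      has_derivative_continuous[OF coord_derivative(8)], assumption)+

lemma continuous_on_\<beta>_\<tau>: "continuous_on U (\<lambda>u. \<beta> u v)" "continuous_on U (\<lambda>u. \<tau> u v)"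
  unfolding \<beta>_def \<tau>_def xi_def T_def comb_def a_def b_def r2_def
  by (intro continuous_intros continuous_on_coord D1_continuous ballI; simp add: r2_nz[unfolded r2_def])+

text \<open>Any primitive \<open>\<theta>\<close> of \<open>\<beta>\<close> will do: the
  differential \<open>(\<beta>, \<tau>)\<close> consists of the frame coordinates of
  \<open>D1 f\<close>, so it is injective because \<open>f\<close> is an immersion.\<close>

lemma angle_time_diffeomorphism:
  assumes "open V" "V \<subseteq> U" "u \<in> V" and \<theta>: "\<And>x. x \<in> V \<Longrightarrow> (\<theta> has_derivative \<beta> x) (at x)"
  obtains V' where "open V'" "u \<in> V'" "V' \<subseteq> V" "open ((\<lambda>x. (\<theta> x, t x)) ` V')"
    "diffeomorphism V' ((\<lambda>x. (\<theta> x, t x)) ` V') (\<lambda>x. (\<theta> x, t x))"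
proof (rule local_diffeomorphism[of V u "\<lambda>x. (\<theta> x, t x)" "\<lambda>x v. (\<beta> x v, \<tau> x v)"])
  show "((\<lambda>x. (\<theta> x, t x)) has_derivative (\<lambda>v. (\<beta> x v, \<tau> x v))) (at x)" if "x \<in> V" for x
    using that assms by (intro has_derivative_Pair t_derivative) auto
  show "continuous_on V (\<lambda>x. (\<beta> x v, \<tau> x v))" for v
    by (intro continuous_intros continuous_on_subset[OF continuous_on_\<beta>_\<tau>(1) assms(2)]
        continuous_on_subset[OF continuous_on_\<beta>_\<tau>(2) assms(2)])
  show "v = 0" if "x \<in> V" "(\<beta> x v, \<tau> x v) = 0" for x v
  proof -
    have x: "x \<in> U" using that assms(2) by blast
    show ?thesis
      by (rule \<beta>_\<tau>_inj[OF x r2_nz[OF x]]) (use that in \<open>simp_all add: zero_prod_def\<close>)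
  qed
qed (use assms that in auto)

end

section \<open>Hyperbolic rotations away from the fixed point\<close>

context rotational_profile
begin

lemma constant_on_U:
  fixes X :: "real \<times> real \<Rightarrow> 'b::real_normed_vector"
  assumes "\<And>u. u \<in> U \<Longrightarrow> (X has_derivative (\<lambda>v. 0)) (at u)"
  shows "\<exists>c. \<forall>u\<in>U. X u = c"
  using has_derivative_zero_unique_connected[OF U(1,2) assms] U(3) by blast

text \<open>Splits the motion in the complementary plane into a radial part with rate
  \<open>b * r2 / (r2 + k)\<close> and an angular part with rate \<open>a / (r2 + k)\<close>. It is
  multiplied out because \<open>r2 + k\<close> may vanish for \<open>k = -1\<close>.\<close>

lemma q_derivative:
  assumes u: "u \<in> U"
  shows "(r2 u + k) * Q1 (D1 f u v) = (k * q2 u * a u + q1 u * b u * r2 u) * \<tau> u v"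
    "(r2 u + k) * Q2 (D1 f u v) = (q1 u * a u + q2 u * b u * r2 u) * \<tau> u v"
proof -
  define T3 where "T3 = a u * q2 u - k * r2 u * l2 u"
  define T4 where "T4 = k * a u * q1 u - r2 u * l1 u"
  have T: "Q1 (D1 f u v) = T3 * \<tau> u v" "Q2 (D1 f u v) = T4 * \<tau> u v"
    by (simp_all add: coord_D1[OF u r2_nz[OF u]] T3_def T4_def)
  have "(r2 u + k) * T3 = k * q2 u * a u + q1 u * b u * r2 u"
    using q_form[OF u] n_f_form[OF u] b_def[of u] kk unfolding T3_def by algebra
  then show "(r2 u + k) * Q1 (D1 f u v) = (k * q2 u * a u + q1 u * b u * r2 u) * \<tau> u v"
    unfolding T by (metis mult.assoc)
  have "(r2 u + k) * T4 = q1 u * a u + q2 u * b u * r2 u"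
    using q_form[OF u] n_f_form[OF u] b_def[of u] kk unfolding T4_def by algebra
  then show "(r2 u + k) * Q2 (D1 f u v) = (q1 u * a u + q2 u * b u * r2 u) * \<tau> u v"
    unfolding T by (metis mult.assoc)
qed

lemma angle_derivative_P:
  assumes "k = -1" "\<And>u. u \<in> U \<Longrightarrow> 0 < p1 u" and u: "u \<in> U"
  shows "((\<lambda>x. hyp_angle (p1 x) (p2 x)) has_derivative \<beta> u) (at u)"
proof -
  note nz = r2_nz[OF u]
  have r2: "(p1 u)\<^sup>2 - (p2 u)\<^sup>2 = r2 u"
    unfolding r2_def by (subst assms(1)) simp
  have "((\<lambda>x. hyp_angle (p1 x) (p2 x)) has_derivative
      (\<lambda>v. (p1 u * P2 (D1 f u v) - p2 u * P1 (D1 f u v)) / r2 u)) (at u)"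
    by (rule hyp_angle_derivative[OF coord_derivative(1,2)[OF u] assms(2)[OF u] r2 r2_pos[OF u]])
  moreover have "(p1 u * P2 (D1 f u v) - p2 u * P1 (D1 f u v)) / r2 u = \<beta> u v" for v
  proof -
    have "p1 u * P2 (D1 f u v) - p2 u * P1 (D1 f u v) = \<beta> u v * r2 u"
      unfolding coord_D1[OF u nz] r2_def by (simp add: power2_eq_square algebra_simps)
    then show ?thesis
      using nz by simp
  qed
  ultimately show ?thesis by simp
qed

text \<open>Reduces both hyperbolic cases to finding a constant phase \<open>(c, s)\<close>, by
  which the basis of the complement is turned. Since the hyperbolic angle is single-valued,
  \<open>g = (\<theta>, t)\<close> is defined on all of \<open>U\<close> and its image serves as
  domain.\<close>

lemma hyperbolic_param_of_phase:
  assumes k: "k = -1" and p1: "\<And>u. u \<in> U \<Longrightarrow> 0 < p1 u" and cs: "c\<^sup>2 + s\<^sup>2 = 1"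
    and q1: "\<And>u. u \<in> U \<Longrightarrow> q1 u = profile_\<rho> H Cp Cm p (t u) * (c * cos (\<psi> u) - s * sin (\<psi> u))"
    and q2: "\<And>u. u \<in> U \<Longrightarrow> q2 u = profile_\<rho> H Cp Cm p (t u) * (s * cos (\<psi> u) + c * sin (\<psi> u))"
  shows "given_by_hyperbolic_param H C f U"
proof -
  have A: "A1 = e 0" "A2 = e 1" "B1 = e 2" "B2 = e 3"
    using frame k by auto
  then have A': "x *\<^sub>R A1 = x *\<^sub>R e 0" "x *\<^sub>R A2 = x *\<^sub>R e 1" "x *\<^sub>R B1 = x *\<^sub>R e 2" "x *\<^sub>R B2 = x *\<^sub>R e 3" for x
    by simp_all
  define e' where "e' i = (if i = 2 then c *\<^sub>R e 2 + s *\<^sub>R e 3 else if i = 3 then - s *\<^sub>R e 2 + c *\<^sub>R e 3 else e i)" for i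
  have e': "e' 0 = e 0" "e' 1 = e 1" "e' 2 = c *\<^sub>R e 2 + s *\<^sub>R e 3" "e' 3 = - s *\<^sub>R e 2 + c *\<^sub>R e 3"
    by (simp_all add: e'_def)
  have orth: "orthonormal_basis e'"
    by (rule orthonormal_basisI; simp only: e' mink_simps orthonormal_basis_mink[OF e])
      (use cs in \<open>simp_all add: power2_eq_square algebra_simps\<close>)
  define \<theta> where "\<theta> u = hyp_angle (p1 u) (p2 u)" for u
  define g where "g u = (\<theta> u, t u)" for u
  define F where "F = hyperbolic_param e' H C Cp Cm p"
  have fF: "f u = F (g u)" if u: "u \<in> U" for u
  proof -
    have r2: "(p1 u)\<^sup>2 - (p2 u)\<^sup>2 = r2 u"
      unfolding r2_def by (subst k) simp
    have p: "p1 u = profile_r H Cp Cm p (t u) * cosh (\<theta> u)" "p2 u = profile_r H Cp Cm p (t u) * sinh (\<theta> u)"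
      using hyp_angle_cosh[OF p1[OF u] r2 r2_pos[OF u]] hyp_angle_sinh[OF p1[OF u] r2 r2_pos[OF u]]
      by (simp_all add: \<theta>_def profile_r_t(3)[OF u])
    have \<psi>: "\<psi> u = profile_\<psi> (-1) H C Cp Cm p (t u)"
      unfolding \<psi>_def by (subst k) simp
    have "f u = comb (p1 u) (p2 u) (q1 u) (q2 u)"
      unfolding coord_defs by (rule comb_coord)
    also have "\<dots> = p1 u *\<^sub>R e 0 + p2 u *\<^sub>R e 1 + q1 u *\<^sub>R e 2 + q2 u *\<^sub>R e 3"
      unfolding comb_def by (simp only: A')
    also have "\<dots> = F (g u)"
      unfolding F_def hyperbolic_param_def g_def Let_def prod.case in_basis_def e' \<psi>[symmetric]
        p[symmetric] q1[OF u] q2[OF u]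
      by (simp add: algebra_simps)
    finally show ?thesis .
  qed
  have \<theta>: "(\<theta> has_derivative \<beta> u) (at u)" if "u \<in> U" for u
    using angle_derivative_P[OF k p1 that] by (simp add: \<theta>_def[abs_def])
  have loc: "\<exists>V. open V \<and> u \<in> V \<and> V \<subseteq> U \<and> open (g ` V) \<and> diffeomorphism V (g ` V) g" if "u \<in> U" for u
    by (rule angle_time_diffeomorphism[OF U(1) subset_refl that \<theta>]) (auto simp: g_def[abs_def])
  have "open (g ` U)"
  proof (rule openI)
    fix y assume "y \<in> g ` U"
    then obtain u where u: "u \<in> U" "y = g u" by auto
    obtain V where V: "open V" "u \<in> V" "V \<subseteq> U" "open (g ` V)"
      using loc[OF u(1)] by blast
    then have "open (g ` V)" "y \<in> g ` V" "g ` V \<subseteq> g ` U"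
      using u by auto
    then show "\<exists>e>0. ball y e \<subseteq> g ` U"
      by (meson open_contains_ball subset_trans)
  qed
  moreover have "connected (g ` U)"
  proof (rule connected_continuous_image[OF _ U(2)])
    show "continuous_on U g"
      unfolding g_def
      by (intro continuous_on_Pair continuous_at_imp_continuous_on ballI)
        (auto intro: has_derivative_continuous[OF \<theta>] has_derivative_continuous[OF t_derivative])
  qed
  moreover have "g ` U \<subseteq> param_domain H Cp Cm p"
    using t_domain by (auto simp: g_def)
  moreover have "same_surface f U F (g ` U)"
    unfolding same_surface_def
  proof (intro conjI ballI)
    show "f ` U = F ` g ` U"
      using fF by (auto simp: image_image)
  next
    fix u assume "u \<in> U"
    then obtain V where "open V" "u \<in> V" "V \<subseteq> U" "open (g ` V)" "diffeomorphism V (g ` V) g"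
      using loc by blast
    then show "\<exists>V h. open V \<and> u \<in> V \<and> V \<subseteq> U \<and> open (h ` V) \<and> h ` V \<subseteq> g ` U \<and>
        diffeomorphism V (h ` V) h \<and> (\<forall>x\<in>V. f x = F (h x))"
      using fF by (intro exI[of _ V] exI[of _ g]) (auto simp: subset_eq)
  qed
  moreover have "admissible (-1) H C Cp Cm p"
    using admissible unfolding k .
  ultimately show ?thesis
    using orth unfolding given_by_hyperbolic_param_def F_def by blast
qed

text \<open>Evaluate \<open>p_C\<close> at 1: for \<open>k = -1\<close> its value is
  \<open>(H - C)\<^sup>2\<close>, while the factorization gives
  \<open>- h * (1 - Cp) * (1 - Cm)\<close>.\<close>

lemma Cp_hyperbolic:
  assumes "k = -1"
  shows "1 \<le> Cp" "Cp = 1 \<Longrightarrow> C = H"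
proof -
  have eq: "h * (1 - Cp) * (1 - Cm) = - (H - C)\<^sup>2"
    using vieta assms unfolding h_def by algebra
  have "(h * (1 - Cm)) * (Cp - 1) = (H - C)\<^sup>2"
    using eq by algebra
  then have "0 \<le> (h * (1 - Cm)) * (Cp - 1)"
    by simp
  moreover have "0 < h * (1 - Cm)"
    using h Cm by simp
  ultimately show "1 \<le> Cp"
    by (simp add: zero_le_mult_iff)
  show "C = H" if "Cp = 1"
    using eq that by simp
qed

text \<open>Turning \<open>(q1, q2)\<close> back by \<open>\<psi>\<close> removes the angular part
  of the motion. The result \<open>(P, R)\<close> scales like \<open>sqrt (w u)\<close>, positive
  because \<open>Cp > 1\<close>, so the quotient is the constant phase. No branch of the argument of
  \<open>(q1, q2)\<close> has to be chosen.\<close>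

lemma hyperbolic_generic:
  assumes k: "k = -1" and p1: "\<And>u. u \<in> U \<Longrightarrow> 0 < p1 u" and Cp1: "Cp \<noteq> 1"
  shows "given_by_hyperbolic_param H C f U"
proof -
  have Cpk: "0 < Cp + k" and Cp2: "1 < Cp"
    using Cp_hyperbolic(1)[OF k] Cp1 k by auto
  define w where "w u = r2 u + k" for u
  have w: "0 < w u" if "u \<in> U" for u
    using r2_ge_Cp[OF that] Cpk by (simp add: w_def)
  define P where "P u = q1 u * cos (\<psi> u) + q2 u * sin (\<psi> u)" for u
  define R where "R u = q2 u * cos (\<psi> u) - q1 u * sin (\<psi> u)" for u
  have const: "\<exists>c. \<forall>u\<in>U. P u / sqrt (w u) = c" "\<exists>c. \<forall>u\<in>U. R u / sqrt (w u) = c"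
  proof -
    \<comment> \<open>The logarithmic derivative of \<open>sqrt (w u)\<close>, and below it the
      angular velocity.\<close>
    define \<kappa> where "\<kappa> u v = b u * r2 u * \<tau> u v / w u" for u v
    define \<alpha> where "\<alpha> u v = a u * \<tau> u v / w u" for u v
    have dw: "((\<lambda>x. sqrt (w x)) has_derivative (\<lambda>v. sqrt (w u) * \<kappa> u v)) (at u)"
      if u: "u \<in> U" for u
    proof -
      have "(w has_derivative (\<lambda>v. 2 * b u * r2 u * \<tau> u v)) (at u)"
        unfolding w_def[abs_def] by (auto intro!: derivative_eq_intros r2_derivative_frame u r2_nz)
      from DERIV_compose_FDERIV[OF DERIV_real_sqrt[OF w[OF u]] this]
      show ?thesis
      proof (rule has_derivative_eq_rhs, intro ext)
        fix v
        have "inverse (sqrt (w u)) = sqrt (w u) / w u"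
          using w[OF u] by (simp add: field_simps)
        then show "2 * b u * r2 u * \<tau> u v * (inverse (sqrt (w u)) / 2) = sqrt (w u) * \<kappa> u v"
          by (simp add: \<kappa>_def)
      qed
    qed
    have d0: "((\<lambda>x. X x / sqrt (w x)) has_derivative (\<lambda>v. 0)) (at u)"
      if u: "u \<in> U" and X: "(X has_derivative (\<lambda>v. X u * \<kappa> u v)) (at u)" for u X
      by (rule has_derivative_eq_rhs[OF has_derivative_divide'[OF X dw[OF u]]])
        (use w[OF u] in \<open>simp_all add: fun_eq_iff\<close>)
    have dq: "(q1 has_derivative (\<lambda>v. q1 u * \<kappa> u v - q2 u * \<alpha> u v)) (at u)"
      "(q2 has_derivative (\<lambda>v. q2 u * \<kappa> u v + q1 u * \<alpha> u v)) (at u)"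
      "(\<psi> has_derivative \<alpha> u) (at u)" if u: "u \<in> U" for u
    proof -
      have kq: "k * q2 u = - q2 u" by (simp add: k)
      have "Q1 (D1 f u v) = q1 u * \<kappa> u v - q2 u * \<alpha> u v"
        "Q2 (D1 f u v) = q2 u * \<kappa> u v + q1 u * \<alpha> u v" for v
        using q_derivative[OF u, of v] w[OF u] unfolding w_def[symmetric] kq \<kappa>_def \<alpha>_def
        by (simp_all add: field_simps)
      then show "(q1 has_derivative (\<lambda>v. q1 u * \<kappa> u v - q2 u * \<alpha> u v)) (at u)"
        "(q2 has_derivative (\<lambda>v. q2 u * \<kappa> u v + q1 u * \<alpha> u v)) (at u)"
        using coord_derivative(3,4)[OF u] by simp_all
      show "(\<psi> has_derivative \<alpha> u) (at u)"
        using \<psi>_derivative[OF u Cpk] by (simp add: w_def \<alpha>_def[abs_def])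
    qed
    have dP: "(P has_derivative (\<lambda>v. P u * \<kappa> u v)) (at u)"
      and dR: "(R has_derivative (\<lambda>v. R u * \<kappa> u v)) (at u)" if u: "u \<in> U" for u
    proof -
      show "(P has_derivative (\<lambda>v. P u * \<kappa> u v)) (at u)"
        unfolding P_def[abs_def]
        by (rule has_derivative_eq_rhs, (rule derivative_eq_intros dq[OF u] refl)+)
          (simp add: fun_eq_iff algebra_simps)
      show "(R has_derivative (\<lambda>v. R u * \<kappa> u v)) (at u)"
        unfolding R_def[abs_def]
        by (rule has_derivative_eq_rhs, (rule derivative_eq_intros dq[OF u] refl)+)
          (simp add: fun_eq_iff algebra_simps)
    qed
    show "\<exists>c. \<forall>u\<in>U. P u / sqrt (w u) = c" "\<exists>c. \<forall>u\<in>U. R u / sqrt (w u) = c"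
      by (rule constant_on_U[OF d0[OF _ dP]], assumption+, rule constant_on_U[OF d0[OF _ dR]], assumption+)
  qed
  then obtain c s where cs: "\<And>u. u \<in> U \<Longrightarrow> P u / sqrt (w u) = c" "\<And>u. u \<in> U \<Longrightarrow> R u / sqrt (w u) = s"
    by metis
  have P: "P u = sqrt (w u) * c" and R: "R u = sqrt (w u) * s" if "u \<in> U" for u
    using cs[OF that] w[OF that] by (auto simp: field_simps)
  have sc: "(sin (\<psi> u))\<^sup>2 + (cos (\<psi> u))\<^sup>2 = 1" for u
    by simp
  have w': "w u = r2 u - 1" for u
    unfolding w_def by (simp add: k)
  have \<rho>: "profile_\<rho> H Cp Cm p (t u) = sqrt (w u)" if "u \<in> U" for u
    by (simp add: profile_\<rho>_def profile_r_t(1)[OF that] w' Cp1)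
  have "c\<^sup>2 + s\<^sup>2 = 1"
  proof -
    obtain u where u: "u \<in> U" using U(3) by blast
    have "(q1 u)\<^sup>2 + (q2 u)\<^sup>2 = w u"
      using q_form[OF u] k unfolding w_def by algebra
    moreover have "(sqrt (w u))\<^sup>2 = w u"
      using w[OF u] by simp
    moreover have "(P u)\<^sup>2 + (R u)\<^sup>2 = ((q1 u)\<^sup>2 + (q2 u)\<^sup>2) * ((sin (\<psi> u))\<^sup>2 + (cos (\<psi> u))\<^sup>2)"
      unfolding P_def R_def by algebra
    ultimately have "w u * (c\<^sup>2 + s\<^sup>2) = w u"
      unfolding P[OF u] R[OF u] sc by (simp add: power_mult_distrib distrib_left)
    then show ?thesis
      using w[OF u] by simp
  qed
  moreover have "q1 u = sqrt (w u) * (c * cos (\<psi> u) - s * sin (\<psi> u))"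
    "q2 u = sqrt (w u) * (s * cos (\<psi> u) + c * sin (\<psi> u))" if "u \<in> U" for u
  proof -
    have "q1 u * ((sin (\<psi> u))\<^sup>2 + (cos (\<psi> u))\<^sup>2) = P u * cos (\<psi> u) - R u * sin (\<psi> u)"
      "q2 u * ((sin (\<psi> u))\<^sup>2 + (cos (\<psi> u))\<^sup>2) = R u * cos (\<psi> u) + P u * sin (\<psi> u)"
      unfolding P_def R_def by algebra+
    then show "q1 u = sqrt (w u) * (c * cos (\<psi> u) - s * sin (\<psi> u))"
      "q2 u = sqrt (w u) * (s * cos (\<psi> u) + c * sin (\<psi> u))"
      unfolding sc P[OF that] R[OF that] by (simp_all add: algebra_simps)
  qed
  ultimately show ?thesis
    by (intro hyperbolic_param_of_phase[OF k p1, of c s]) (simp_all add: \<rho>)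
qed

end

section \<open>Hyperbolic rotations with a profile through the fixed point\<close>

context rotational_profile
begin

text \<open>For \<open>Cp = 1\<close> the profile curve may pass through the fixed point \<open>q1 = q2 = 0\<close> of its polar
  coordinates. Its unit normal does not vanish there, so the phase is read off from the normal.\<close>

lemma hyperbolic_critical:
  assumes k: "k = -1" and p1: "\<And>u. u \<in> U \<Longrightarrow> 0 < p1 u" and Cp1: "Cp = 1"
  shows "given_by_hyperbolic_param H C f U"
proof -
  have kx: "k * x = - x" for x
    by (simp add: k)
  have CH: "C = H"
    by (rule Cp_hyperbolic(2)[OF k Cp1])
  have hCm: "h * Cm = - H\<^sup>2"
    using vieta(2) by (simp add: Cp1 CH)
  have "\<Xi>\<^sup>2 = 1"
    using Xi(2) hCm by (simp add: Cp1 right_diff_distrib h_def)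
  then have Xi1: "\<Xi> = 1"
    using Xi(1) by (simp add: power2_eq_1_iff)
  have \<psi>: "\<psi> u = H * t u" for u
    unfolding \<psi>_def profile_\<psi>_def by (simp add: k Cp1)
  \<comment> \<open>As \<open>\<phi> = arctan (b / D)\<close>, this is the tangent of the amplitude,
    a smooth signed square root of \<open>r2 - 1\<close>.\<close>
  define \<rho> where "\<rho> u = b u / D u" for u
  have b: "b u = D u * \<rho> u" if "u \<in> U" for u
    using D(1)[OF that] by (simp add: \<rho>_def)
  have D2: "r2 u * (D u)\<^sup>2 = h * r2 u + H\<^sup>2" if "u \<in> U" for u
    using D(2)[OF that] r2_nz[OF that] hCm by (simp add: Cp1 right_diff_distrib)
  have r2: "r2 u = 1 + (\<rho> u)\<^sup>2" if u: "u \<in> U" for u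
  proof -
    have "(D u)\<^sup>2 * (\<rho> u)\<^sup>2 * r2 u = (D u)\<^sup>2 * (r2 u - 1) * r2 u"
      using b_squared[OF u] D2[OF u] hCm unfolding b[OF u] Cp1 by algebra
    then show ?thesis
      using D(1)[OF u] r2_nz[OF u] by simp
  qed
  have a: "a u = H * (\<rho> u)\<^sup>2" if "u \<in> U" for u
    using a_eq[OF that] r2[OF that] CH kx by (simp add: algebra_simps)
  have sgn_t: "sgn (t u) = sgn (\<rho> u)" for u
  proof -
    have "0 < t u \<longleftrightarrow> 0 < \<rho> u" "t u < 0 \<longleftrightarrow> \<rho> u < 0"
      using elliptic_F_less_iff[OF p, of 0 "\<phi> u"] elliptic_F_less_iff[OF p, of "\<phi> u" 0]
      by (simp_all add: t_def Xi1 \<phi>_def flip: \<rho>_def)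
    then show ?thesis
      by (cases rule: linorder_cases[of "t u" 0]; cases rule: linorder_cases[of "\<rho> u" 0]) simp_all
  qed
  have \<rho>: "profile_\<rho> H Cp Cm p (t u) = \<rho> u" if "u \<in> U" for u
    unfolding profile_\<rho>_def profile_r_t(1)[OF that] if_P[OF Cp1] sgn_t r2[OF that]
    by (simp add: sgn_mult_abs)
  have d\<rho>: "(\<rho> has_derivative (\<lambda>v. r2 u * D u * \<tau> u v)) (at u)" if u: "u \<in> U" for u
  proof -
    have "(cos (\<phi> u))\<^sup>2 \<noteq> 0"
      using cos_\<phi>[OF u] Cp r2_nz[OF u] by simp
    then have "cos (\<phi> u) \<noteq> 0"
      by simp
    from DERIV_compose_FDERIV[OF DERIV_tan[OF this] \<phi>_derivative[OF u]]
    have "((\<lambda>x. tan (\<phi> x)) has_derivative (\<lambda>v. D u * \<tau> u v * inverse ((cos (\<phi> u))\<^sup>2))) (at u)" .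
    moreover have "(\<lambda>x. tan (\<phi> x)) = \<rho>"
      by (simp add: \<phi>_def \<rho>_def fun_eq_iff tan_arctan)
    moreover have "inverse ((cos (\<phi> u))\<^sup>2) = r2 u"
      unfolding cos_\<phi>[OF u] using Cp1 by simp
    ultimately show ?thesis
      by (simp add: mult_ac)
  qed
  have dD: "(D has_derivative (\<lambda>v. - H\<^sup>2 * \<rho> u * \<tau> u v / r2 u)) (at u)" if u: "u \<in> U" for u
    by (rule has_derivative_eq_rhs[OF D_derivative[OF u]])
      (use D(1)[OF u] in \<open>simp add: fun_eq_iff b[OF u] CH\<close>)
  have d\<psi>: "(\<psi> has_derivative (\<lambda>v. H * \<tau> u v)) (at u)" if u: "u \<in> U" for u
    unfolding \<psi>[abs_def] by (auto intro!: derivative_eq_intros t_derivative u)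
  have q: "(q1 u)\<^sup>2 + (q2 u)\<^sup>2 = (\<rho> u)\<^sup>2" "q1 u * l1 u + q2 u * l2 u = - H * (\<rho> u)\<^sup>2"
    "q1 u * l2 u - q2 u * l1 u = D u * \<rho> u" if u: "u \<in> U" for u
  proof -
    show "(q1 u)\<^sup>2 + (q2 u)\<^sup>2 = (\<rho> u)\<^sup>2"
      using q_form[OF u] r2[OF u] by (simp add: kx) (simp add: k)
    show "q1 u * l1 u + q2 u * l2 u = - H * (\<rho> u)\<^sup>2"
      using n_f_form[OF u] a[OF u] by (simp add: kx)
    show "q1 u * l2 u - q2 u * l1 u = D u * \<rho> u"
      using b[OF u] b_def[of u] by (simp add: kx algebra_simps)
  qed
  \<comment> \<open>With \<open>q = q1 + \<i> * q2\<close> and \<open>l = l1 + \<i> * l2\<close>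
    this says \<open>\<rho> * l = - (H * \<rho> - \<i> * D) * q\<close>. Where \<open>\<rho>\<close>
    vanishes, so does \<open>q\<close>.\<close>
  have \<rho>l: "\<rho> u * l1 u = - (H * \<rho> u * q1 u + D u * q2 u)" "\<rho> u * l2 u = D u * q1 u - H * \<rho> u * q2 u"
    if u: "u \<in> U" for u
  proof -
    show "\<rho> u * l1 u = - (H * \<rho> u * q1 u + D u * q2 u)"
    proof (cases "\<rho> u = 0")
      case True
      then show ?thesis using q(1)[OF u] by (simp add: add_nonneg_eq_0_iff)
    next
      case False
      have "\<rho> u * (\<rho> u * l1 u) = \<rho> u * - (H * \<rho> u * q1 u + D u * q2 u)"
        using q[OF u] by algebra
      then show ?thesis using False by simp
    qed
    show "\<rho> u * l2 u = D u * q1 u - H * \<rho> u * q2 u"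
    proof (cases "\<rho> u = 0")
      case True
      then show ?thesis using q(1)[OF u] by (simp add: add_nonneg_eq_0_iff)
    next
      case False
      have "\<rho> u * (\<rho> u * l2 u) = \<rho> u * (D u * q1 u - H * \<rho> u * q2 u)"
        using q[OF u] by algebra
      then show ?thesis using False by simp
    qed
  qed
  \<comment> \<open>\<open>X\<close> is \<open>l\<close> turned back by \<open>\<psi>\<close>, and
    \<open>Y\<close> is what it should be up to a constant factor. Unlike \<open>\<rho>\<close>,
    \<open>Y\<close> has no zero because \<open>D\<close> is positive, so \<open>X / Y\<close> can
    be differentiated on all of \<open>U\<close>.\<close>
  define X where "X u = (of_real (l1 u) + \<i> * of_real (l2 u)) * (of_real (cos (\<psi> u)) - \<i> * of_real (sin (\<psi> u)))" for u
  define Y where "Y u = of_real (H * \<rho> u) - \<i> * of_real (D u)" for u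
  have Y0: "Y u \<noteq> 0" if "u \<in> U" for u
    using D(1)[OF that] by (simp add: Y_def complex_eq_iff)
  have "((\<lambda>x. X x / Y x) has_derivative (\<lambda>v. 0)) (at u)" if u: "u \<in> U" for u
  proof -
    define E where "E = (of_real (cos (\<psi> u)) - \<i> * of_real (sin (\<psi> u)) :: complex)"
    have dX: "(X has_derivative (\<lambda>v. ((of_real (Q1 (N u v)) + \<i> * of_real (Q2 (N u v)))
        - \<i> * of_real (H * \<tau> u v) * (of_real (l1 u) + \<i> * of_real (l2 u))) * E)) (at u)"
      unfolding X_def[abs_def] E_def
      by (rule has_derivative_eq_rhs,
          (rule derivative_eq_intros has_derivative_of_real coord_derivative[OF u] d\<psi>[OF u] refl)+)
        (simp add: fun_eq_iff complex_eq_iff algebra_simps)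
    have dY: "(Y has_derivative (\<lambda>v. of_real (H * (r2 u * D u * \<tau> u v)) - \<i> * of_real (- H\<^sup>2 * \<rho> u * \<tau> u v / r2 u))) (at u)"
      unfolding Y_def[abs_def]
      by (rule has_derivative_eq_rhs,
          (rule derivative_eq_intros has_derivative_of_real d\<rho>[OF u] dD[OF u] refl)+)
        (simp add: fun_eq_iff)
    have key: "((of_real (Q1 (N u v)) + \<i> * of_real (Q2 (N u v)))
        - \<i> * of_real (H * \<tau> u v) * (of_real (l1 u) + \<i> * of_real (l2 u))) * Y u
      = (of_real (l1 u) + \<i> * of_real (l2 u)) * (of_real (H * (r2 u * D u * \<tau> u v)) - \<i> * of_real (- H\<^sup>2 * \<rho> u * \<tau> u v / r2 u))" for v
    proof -
      define i where "i = 1 / r2 u"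
      have i: "i * (1 + (\<rho> u)\<^sup>2) = 1"
        using r2_nz[OF u] by (simp add: i_def flip: r2[OF u])
      have N1: "Q1 (N u v) = - (2 * H - H * (\<rho> u)\<^sup>2 * i) * \<tau> u v * (H * (\<rho> u)\<^sup>2 * q2 u + (1 + (\<rho> u)\<^sup>2) * l2 u)"
        and N2: "Q2 (N u v) = (2 * H - H * (\<rho> u)\<^sup>2 * i) * \<tau> u v * (H * (\<rho> u)\<^sup>2 * q1 u + (1 + (\<rho> u)\<^sup>2) * l1 u)"
      proof -
        have s: "2 * H + k * a u / r2 u = 2 * H - H * (\<rho> u)\<^sup>2 * i"
          using a[OF u] by (simp add: kx i_def)
        have T: "a u * q2 u - k * r2 u * l2 u = H * (\<rho> u)\<^sup>2 * q2 u + (1 + (\<rho> u)\<^sup>2) * l2 u"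
          "k * a u * q1 u - r2 u * l1 u = - (H * (\<rho> u)\<^sup>2 * q1 u + (1 + (\<rho> u)\<^sup>2) * l1 u)"
          using a[OF u] r2[OF u] by (simp_all add: kx algebra_simps)
        show "Q1 (N u v) = - (2 * H - H * (\<rho> u)\<^sup>2 * i) * \<tau> u v * (H * (\<rho> u)\<^sup>2 * q2 u + (1 + (\<rho> u)\<^sup>2) * l2 u)"
          "Q2 (N u v) = (2 * H - H * (\<rho> u)\<^sup>2 * i) * \<tau> u v * (H * (\<rho> u)\<^sup>2 * q1 u + (1 + (\<rho> u)\<^sup>2) * l1 u)"
          unfolding coord_N(3,4)[OF u r2_nz[OF u], of v] s T by algebra+
      qed
      have "(Q1 (N u v) + H * \<tau> u v * l2 u) * (H * \<rho> u) + (Q2 (N u v) - H * \<tau> u v * l1 u) * D u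
        = l1 u * (H * (1 + (\<rho> u)\<^sup>2) * D u * \<tau> u v) - l2 u * (H\<^sup>2 * \<rho> u * \<tau> u v * i)"
        using N1 N2 i \<rho>l[OF u] by algebra
      moreover have "(Q2 (N u v) - H * \<tau> u v * l1 u) * (H * \<rho> u) - (Q1 (N u v) + H * \<tau> u v * l2 u) * D u
        = l2 u * (H * (1 + (\<rho> u)\<^sup>2) * D u * \<tau> u v) + l1 u * (H\<^sup>2 * \<rho> u * \<tau> u v * i)"
        using N1 N2 i \<rho>l[OF u] by algebra
      ultimately show ?thesis
        by (simp add: complex_eq_iff Y_def i_def r2[OF u] algebra_simps)
    qed
    have X: "X u = (of_real (l1 u) + \<i> * of_real (l2 u)) * E"
      by (simp add: X_def E_def)
    show ?thesis
    proof (rule has_derivative_eq_rhs[OF has_derivative_divide'[OF dX dY Y0[OF u]]], intro ext)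
      fix v
      have "x * Y u = l * y \<Longrightarrow> (x * E * Y u - l * E * y) / (Y u * Y u) = 0" for x y l
        by (simp add: mult.assoc mult.left_commute[of _ E])
      from this[OF key] show "(((of_real (Q1 (N u v)) + \<i> * of_real (Q2 (N u v)))
        - \<i> * of_real (H * \<tau> u v) * (of_real (l1 u) + \<i> * of_real (l2 u))) * E * Y u
        - X u * (of_real (H * (r2 u * D u * \<tau> u v)) - \<i> * of_real (- H\<^sup>2 * \<rho> u * \<tau> u v / r2 u))) / (Y u * Y u) = 0"
        unfolding X .
    qed
  qed
  from constant_on_U[OF this] obtain w where w: "\<And>u. u \<in> U \<Longrightarrow> X u / Y u = w"
    by auto
  then have XY: "X u = w * Y u" if "u \<in> U" for u
    using Y0[OF that] w[OF that] by (auto simp: field_simps)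
  have sc: "(sin (\<psi> u))\<^sup>2 + (cos (\<psi> u))\<^sup>2 = 1" for u
    by simp
  have l: "l1 u = Re w * (H * \<rho> u * cos (\<psi> u) + D u * sin (\<psi> u)) - Im w * (H * \<rho> u * sin (\<psi> u) - D u * cos (\<psi> u))"
    "l2 u = Re w * (H * \<rho> u * sin (\<psi> u) - D u * cos (\<psi> u)) + Im w * (H * \<rho> u * cos (\<psi> u) + D u * sin (\<psi> u))"
    if u: "u \<in> U" for u
  proof -
    have "l1 u * cos (\<psi> u) + l2 u * sin (\<psi> u) = Re w * (H * \<rho> u) + Im w * D u"
      "l2 u * cos (\<psi> u) - l1 u * sin (\<psi> u) = Im w * (H * \<rho> u) - Re w * D u"
      using XY[OF u] by (simp_all add: X_def Y_def complex_eq_iff algebra_simps)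
    then show "l1 u = Re w * (H * \<rho> u * cos (\<psi> u) + D u * sin (\<psi> u)) - Im w * (H * \<rho> u * sin (\<psi> u) - D u * cos (\<psi> u))"
      "l2 u = Re w * (H * \<rho> u * sin (\<psi> u) - D u * cos (\<psi> u)) + Im w * (H * \<rho> u * cos (\<psi> u) + D u * sin (\<psi> u))"
      using sc[of u] by algebra+
  qed
  show ?thesis
  proof (rule hyperbolic_param_of_phase[OF k p1])
    obtain u where u: "u \<in> U" using U(3) by blast
    define M where "M = (H * \<rho> u)\<^sup>2 + (D u)\<^sup>2"
    have "M > 0"
      using D(1)[OF u] by (simp add: M_def add_nonneg_pos)
    have "(l1 u)\<^sup>2 + (l2 u)\<^sup>2 = ((Re w)\<^sup>2 + (Im w)\<^sup>2) * M"
      using l[OF u] sc[of u] unfolding M_def by algebra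
    moreover have "(l1 u)\<^sup>2 + (l2 u)\<^sup>2 = M"
    proof -
      have "r2 u * ((l2 u)\<^sup>2 + (l1 u)\<^sup>2) = r2 u + (a u)\<^sup>2"
        using l_form[OF u r2_nz[OF u]] by (simp add: kx)
      then have "r2 u * ((l1 u)\<^sup>2 + (l2 u)\<^sup>2) = r2 u * M"
        using D2[OF u] a[OF u] r2[OF u] unfolding M_def h_def by algebra
      then show ?thesis
        using r2_nz[OF u] by simp
    qed
    \<comment> \<open>The signs come from \<open>\<rho> * l = - Y * q\<close>: the phase of
      \<open>q\<close> is the negative of \<open>w = X / Y\<close>.\<close>
    ultimately show "(- Re w)\<^sup>2 + (- Im w)\<^sup>2 = 1"
      using \<open>M > 0\<close> by simp
  next
    fix u assume u: "u \<in> U"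
    define M where "M = (H * \<rho> u)\<^sup>2 + (D u)\<^sup>2"
    have "M > 0"
      using D(1)[OF u] by (simp add: M_def add_nonneg_pos)
    have "M * q1 u = M * (\<rho> u * (- Re w * cos (\<psi> u) - - Im w * sin (\<psi> u)))"
      "M * q2 u = M * (\<rho> u * (- Im w * cos (\<psi> u) + - Re w * sin (\<psi> u)))"
      using \<rho>l[OF u] l[OF u] unfolding M_def by algebra+
    then show "q1 u = profile_\<rho> H Cp Cm p (t u) * (- Re w * cos (\<psi> u) - - Im w * sin (\<psi> u))"
      "q2 u = profile_\<rho> H Cp Cm p (t u) * (- Im w * cos (\<psi> u) + - Re w * sin (\<psi> u))"
      using \<open>M > 0\<close> by (simp_all add: \<rho>[OF u])
  qed
qed

theorem hyperbolic_param:
  assumes "k = -1" "\<And>u. u \<in> U \<Longrightarrow> 0 < p1 u"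
  shows "given_by_hyperbolic_param H C f U"
  using hyperbolic_generic[OF assms] hyperbolic_critical[OF assms] by blast

end

section \<open>Elliptic rotations\<close>

lemma polar_arctan:
  fixes x y :: real
  assumes "0 < x"
  shows "sqrt (x\<^sup>2 + y\<^sup>2) * cos (arctan (y / x)) = x" "sqrt (x\<^sup>2 + y\<^sup>2) * sin (arctan (y / x)) = y"
proof -
  have "1 + (y / x)\<^sup>2 = (x\<^sup>2 + y\<^sup>2) / x\<^sup>2"
    using assms by (simp add: field_simps)
  then have s: "sqrt (1 + (y / x)\<^sup>2) = sqrt (x\<^sup>2 + y\<^sup>2) / x"
    using assms by (simp add: real_sqrt_divide)
  have "sqrt (x\<^sup>2 + y\<^sup>2) > 0"
    using assms by (simp add: add_pos_nonneg)
  then show "sqrt (x\<^sup>2 + y\<^sup>2) * cos (arctan (y / x)) = x" "sqrt (x\<^sup>2 + y\<^sup>2) * sin (arctan (y / x)) = y"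
    unfolding cos_arctan sin_arctan s using assms by simp_all
qed

context rotational_profile
begin

text \<open>The angle is multivalued around the axis. Turning by the angle \<open>\<theta>0\<close>
  of the point \<open>u\<close> moves it to the positive half-axis, and
  \<open>arctan (y / x)\<close> is a smooth branch on the half-plane \<open>x > 0\<close>.\<close>

lemma local_angle_P:
  assumes k: "k = 1" and u: "u \<in> U"
  obtains V \<theta> where "open V" "u \<in> V" "V \<subseteq> U" "\<And>x. x \<in> V \<Longrightarrow> (\<theta> has_derivative \<beta> x) (at x)"
    "\<And>x. x \<in> V \<Longrightarrow> p1 x = sqrt (r2 x) * cos (\<theta> x)" "\<And>x. x \<in> V \<Longrightarrow> p2 x = sqrt (r2 x) * sin (\<theta> x)"
proof -
  have r2: "(p1 x)\<^sup>2 + (p2 x)\<^sup>2 = r2 x" for x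
    unfolding r2_def by (subst k) simp
  have "(p1 u / sqrt (r2 u))\<^sup>2 + (p2 u / sqrt (r2 u))\<^sup>2 = 1"
    using r2_pos[OF u] r2[of u] by (simp add: power_divide flip: add_divide_distrib)
  then obtain \<theta>0 where "p1 u / sqrt (r2 u) = cos \<theta>0" "p2 u / sqrt (r2 u) = sin \<theta>0"
    using sincos_total_2pi by metis
  then have \<theta>0: "p1 u = sqrt (r2 u) * cos \<theta>0" "p2 u = sqrt (r2 u) * sin \<theta>0"
    using r2_pos[OF u] by (simp_all add: field_simps)
  have sc: "(sin \<theta>0)\<^sup>2 + (cos \<theta>0)\<^sup>2 = 1"
    by simp
  define x where "x w = p1 w * cos \<theta>0 + p2 w * sin \<theta>0" for w
  define y where "y w = p2 w * cos \<theta>0 - p1 w * sin \<theta>0" for w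
  have xy: "(x w)\<^sup>2 + (y w)\<^sup>2 = r2 w" "x w * cos \<theta>0 - y w * sin \<theta>0 = p1 w"
    "x w * sin \<theta>0 + y w * cos \<theta>0 = p2 w" for w
  proof -
    have "(x w)\<^sup>2 + (y w)\<^sup>2 = ((p1 w)\<^sup>2 + (p2 w)\<^sup>2) * ((sin \<theta>0)\<^sup>2 + (cos \<theta>0)\<^sup>2)"
      "x w * cos \<theta>0 - y w * sin \<theta>0 = p1 w * ((sin \<theta>0)\<^sup>2 + (cos \<theta>0)\<^sup>2)"
      "x w * sin \<theta>0 + y w * cos \<theta>0 = p2 w * ((sin \<theta>0)\<^sup>2 + (cos \<theta>0)\<^sup>2)"
      unfolding x_def y_def by algebra+
    then show "(x w)\<^sup>2 + (y w)\<^sup>2 = r2 w" "x w * cos \<theta>0 - y w * sin \<theta>0 = p1 w"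
      "x w * sin \<theta>0 + y w * cos \<theta>0 = p2 w"
      unfolding sc r2 by simp_all
  qed
  define V where "V = {w \<in> U. 0 < x w}"
  define \<theta> where "\<theta> w = \<theta>0 + arctan (y w / x w)" for w
  have "continuous_on U x"
    unfolding x_def by (intro continuous_intros continuous_on_coord)
  then have "open (U \<inter> x -` {0<..})"
    by (intro continuous_open_preimage U(1) open_greaterThan)
  moreover have "U \<inter> x -` {0<..} = V"
    by (auto simp: V_def)
  ultimately have "open V"
    by simp
  moreover have "x u = sqrt (r2 u)"
    using sc unfolding x_def \<theta>0 by algebra
  then have "u \<in> V"
    using u r2_pos[OF u] by (simp add: V_def)
  moreover have "V \<subseteq> U"
    by (auto simp: V_def)
  moreover have "(\<theta> has_derivative \<beta> w) (at w)" if w: "w \<in> V" for w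
  proof -
    have wU: "w \<in> U" and x0: "0 < x w"
      using w by (auto simp: V_def)
    have "((\<lambda>w. y w / x w) has_derivative (\<lambda>v. ((P2 (D1 f w v) * cos \<theta>0 - P1 (D1 f w v) * sin \<theta>0) * x w
        - y w * (P1 (D1 f w v) * cos \<theta>0 + P2 (D1 f w v) * sin \<theta>0)) / (x w * x w))) (at w)"
      unfolding x_def[abs_def] y_def[abs_def]
      by (rule has_derivative_divide') (use x0 in \<open>auto simp: x_def intro!: derivative_eq_intros coord_derivative[OF wU]\<close>)
    from DERIV_compose_FDERIV[OF DERIV_arctan this]
    have "((\<lambda>w. \<theta>0 + arctan (y w / x w)) has_derivative (\<lambda>v. 0 + ((P2 (D1 f w v) * cos \<theta>0 - P1 (D1 f w v) * sin \<theta>0) * x w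
        - y w * (P1 (D1 f w v) * cos \<theta>0 + P2 (D1 f w v) * sin \<theta>0)) / (x w * x w) * inverse (1 + (y w / x w)\<^sup>2))) (at w)"
      by (intro has_derivative_add has_derivative_const)
    then show ?thesis
      unfolding \<theta>_def[abs_def]
    proof (rule has_derivative_eq_rhs, intro ext)
      fix v
      have 1: "inverse (1 + (y w / x w)\<^sup>2) = (x w * x w) / r2 w"
        using x0 xy(1)[of w] by (simp add: field_simps power2_eq_square)
      have "(P2 (D1 f w v) * cos \<theta>0 - P1 (D1 f w v) * sin \<theta>0) * x w
        - y w * (P1 (D1 f w v) * cos \<theta>0 + P2 (D1 f w v) * sin \<theta>0) = p1 w * P2 (D1 f w v) - p2 w * P1 (D1 f w v)"
        using sc unfolding x_def y_def by algebra
      also have "\<dots> = \<beta> w v * r2 w"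
        unfolding coord_D1[OF wU r2_nz[OF wU]] r2_def by (simp add: power2_eq_square algebra_simps)
      finally show "0 + ((P2 (D1 f w v) * cos \<theta>0 - P1 (D1 f w v) * sin \<theta>0) * x w
        - y w * (P1 (D1 f w v) * cos \<theta>0 + P2 (D1 f w v) * sin \<theta>0)) / (x w * x w) * inverse (1 + (y w / x w)\<^sup>2) = \<beta> w v"
        unfolding 1 using x0 r2_nz[OF wU] by simp
    qed
  qed
  moreover have "p1 w = sqrt (r2 w) * cos (\<theta> w)" "p2 w = sqrt (r2 w) * sin (\<theta> w)" if w: "w \<in> V" for w
  proof -
    have "0 < x w"
      using w by (auto simp: V_def)
    from polar_arctan[OF this, of "y w", unfolded xy]
    have "x w = sqrt (r2 w) * cos (arctan (y w / x w))" "y w = sqrt (r2 w) * sin (arctan (y w / x w))"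
      by simp_all
    then show "p1 w = sqrt (r2 w) * cos (\<theta> w)" "p2 w = sqrt (r2 w) * sin (\<theta> w)"
      unfolding \<theta>_def cos_add sin_add xy(2,3)[of w, symmetric] by algebra+
  qed
  ultimately show thesis
    using that by blast
qed

theorem elliptic_param:
  assumes k: "k = 1" and q1: "\<And>u. u \<in> U \<Longrightarrow> 0 < q1 u"
    and rot: "\<And>u \<theta>. u \<in> U \<Longrightarrow>
      \<exists>u'\<in>U. f u' = comb (sqrt (r2 u) * cos \<theta>) (sqrt (r2 u) * sin \<theta>) (q1 u) (q2 u)"
  shows "given_by_elliptic_param H C f U"
proof -
  have A: "A1 = e 2" "A2 = e 3" "B1 = e 0" "B2 = e 1"
    using frame k by auto
  then have A': "x *\<^sub>R A1 = x *\<^sub>R e 2" "x *\<^sub>R A2 = x *\<^sub>R e 3" "x *\<^sub>R B1 = x *\<^sub>R e 0" "x *\<^sub>R B2 = x *\<^sub>R e 1" for x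
    by simp_all
  define w where "w u = r2 u + 1" for u
  have wk: "r2 u + k = w u" for u
    using k by (simp add: w_def)
  have w: "0 < w u" if "u \<in> U" for u
    using r2_pos[OF that] by (simp add: w_def)
  have Cpk: "0 < Cp + k"
    using Cp k by simp
  have qw: "(q1 u)\<^sup>2 - (q2 u)\<^sup>2 = w u" if "u \<in> U" for u
    using q_form[OF that] unfolding wk by (simp add: k)
  have "((\<lambda>x. hyp_angle (q1 x) (q2 x) - \<psi> x) has_derivative (\<lambda>v. 0)) (at u)" if u: "u \<in> U" for u
  proof -
    have "((\<lambda>x. hyp_angle (q1 x) (q2 x) - \<psi> x) has_derivative
        (\<lambda>v. (q1 u * Q2 (D1 f u v) - q2 u * Q1 (D1 f u v)) / w u - a u * \<tau> u v / (r2 u + k))) (at u)"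
      by (intro has_derivative_diff hyp_angle_derivative coord_derivative \<psi>_derivative u q1 qw w Cpk)
    then show ?thesis
    proof (rule has_derivative_eq_rhs, intro ext)
      fix v
      have kq: "k * q2 u = q2 u" by (simp add: k)
      have "w u * (q1 u * Q2 (D1 f u v) - q2 u * Q1 (D1 f u v)) = w u * (a u * \<tau> u v)"
        using q_derivative[OF u, of v, unfolded wk kq] qw[OF u] by algebra
      then have "q1 u * Q2 (D1 f u v) - q2 u * Q1 (D1 f u v) = a u * \<tau> u v"
        using w[OF u] by simp
      then show "(q1 u * Q2 (D1 f u v) - q2 u * Q1 (D1 f u v)) / w u - a u * \<tau> u v / (r2 u + k) = 0"
        by (simp add: wk)
    qed
  qed
  from constant_on_U[OF this] obtain c where "\<And>u. u \<in> U \<Longrightarrow> hyp_angle (q1 u) (q2 u) - \<psi> u = c"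
    by auto
  then have c: "hyp_angle (q1 u) (q2 u) = \<psi> u + c" if "u \<in> U" for u
    using that by fastforce
  define e' where "e' i = (if i = 0 then cosh c *\<^sub>R e 0 + sinh c *\<^sub>R e 1
    else if i = 1 then sinh c *\<^sub>R e 0 + cosh c *\<^sub>R e 1 else e i)" for i
  have e': "e' 0 = cosh c *\<^sub>R e 0 + sinh c *\<^sub>R e 1" "e' 1 = sinh c *\<^sub>R e 0 + cosh c *\<^sub>R e 1"
    "e' 2 = e 2" "e' 3 = e 3"
    by (simp_all add: e'_def)
  have "(cosh c)\<^sup>2 - (sinh c)\<^sup>2 = 1"
    by (simp add: cosh_square_eq)
  then have orth: "orthonormal_basis e'"
    by (intro orthonormal_basisI; simp only: e' mink_simps orthonormal_basis_mink[OF e])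
      (simp_all add: power2_eq_square algebra_simps)
  define F where "F = elliptic_param e' H C Cp Cm p"
  have F: "F (x, t u) = comb (sqrt (r2 u) * cos x) (sqrt (r2 u) * sin x) (q1 u) (q2 u)" if u: "u \<in> U" for u x
  proof -
    have \<psi>: "\<psi> u = profile_\<psi> 1 H C Cp Cm p (t u)"
      unfolding \<psi>_def by (subst k) simp
    have q: "q1 u = sqrt (w u) * cosh (\<psi> u + c)" "q2 u = sqrt (w u) * sinh (\<psi> u + c)"
      using hyp_angle_cosh[OF q1[OF u] qw[OF u] w[OF u]] hyp_angle_sinh[OF q1[OF u] qw[OF u] w[OF u]] c[OF u]
      by simp_all
    have r: "(profile_r H Cp Cm p (t u))\<^sup>2 = r2 u" "profile_r H Cp Cm p (t u) = sqrt (r2 u)"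
      using profile_r_t[OF u] by auto
    show ?thesis
      unfolding F_def elliptic_param_def Let_def prod.case r(1) unfolding r(2) \<psi>[symmetric] comb_def A' q
        in_basis_def e' cosh_add sinh_add w_def
      by (simp add: algebra_simps)
  qed
  define g where "g \<theta> u = (\<theta> u, t u)" for \<theta> :: "real \<times> real \<Rightarrow> real" and u
  define W where "W = (UNIV :: real set) \<times> t ` U"
  have loc: "\<exists>V \<theta>. open V \<and> u \<in> V \<and> V \<subseteq> U \<and> open (g \<theta> ` V) \<and> diffeomorphism V (g \<theta> ` V) (g \<theta>) \<and>
      (\<forall>x\<in>V. f x = F (g \<theta> x))" if u: "u \<in> U" for u
  proof (rule local_angle_P[OF k u])
    fix V0 \<theta> assume V0: "open V0" "u \<in> V0" "V0 \<subseteq> U" "\<And>x. x \<in> V0 \<Longrightarrow> (\<theta> has_derivative \<beta> x) (at x)"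
      and p: "\<And>x. x \<in> V0 \<Longrightarrow> p1 x = sqrt (r2 x) * cos (\<theta> x)" "\<And>x. x \<in> V0 \<Longrightarrow> p2 x = sqrt (r2 x) * sin (\<theta> x)"
    show ?thesis
    proof (rule angle_time_diffeomorphism[OF V0(1,3,2,4)])
      fix V assume V: "open V" "u \<in> V" "V \<subseteq> V0" "open ((\<lambda>x. (\<theta> x, t x)) ` V)"
        "diffeomorphism V ((\<lambda>x. (\<theta> x, t x)) ` V) (\<lambda>x. (\<theta> x, t x))"
      have "f x = F (g \<theta> x)" if x: "x \<in> V" for x
      proof -
        have xU: "x \<in> U" and x0: "x \<in> V0" using x V V0 by auto
        show ?thesis
          unfolding g_def F[OF xU] p(1)[OF x0, symmetric] p(2)[OF x0, symmetric]
          unfolding coord_defs by (rule comb_coord)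
      qed
      then show ?thesis
        using V V0(3) unfolding g_def[abs_def] by blast
    qed
  qed
  have "open (t ` U)"
  proof (rule openI)
    fix y assume "y \<in> t ` U"
    then obtain u where u: "u \<in> U" "y = t u" by auto
    obtain V \<theta> where V: "u \<in> V" "V \<subseteq> U" "open (g \<theta> ` V)"
      using loc[OF u(1)] by blast
    have "snd ` g \<theta> ` V = t ` V"
      by (auto simp: g_def image_image)
    then have "open (t ` V)" "y \<in> t ` V" "t ` V \<subseteq> t ` U"
      using V u open_image_snd[OF V(3)] by auto
    then show "\<exists>e>0. ball y e \<subseteq> t ` U"
      by (meson open_contains_ball subset_trans)
  qed
  then have "open W"
    unfolding W_def by (intro open_Times) auto
  moreover have "connected W"
    unfolding W_def
    by (intro connected_Times connected_UNIV connected_continuous_image U(2) continuous_at_imp_continuous_on ballI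
        has_derivative_continuous[OF t_derivative])
  moreover have "W \<subseteq> param_domain H Cp Cm p"
    using t_domain by (auto simp: W_def)
  moreover have "same_surface f U F W"
    unfolding same_surface_def
  proof (intro conjI ballI)
    show "f ` U = F ` W"
    proof
      show "f ` U \<subseteq> F ` W"
      proof
        fix y assume "y \<in> f ` U"
        then obtain u where u: "u \<in> U" "y = f u"
          by blast
        obtain V \<theta> where "u \<in> V" "\<forall>x\<in>V. f x = F (g \<theta> x)"
          using loc[OF u(1)] by blast
        then have "y = F (g \<theta> u)"
          using u by blast
        then show "y \<in> F ` W"
          using u by (auto simp: W_def g_def)
      qed
      show "F ` W \<subseteq> f ` U"
      proof
        fix y assume "y \<in> F ` W"
        then obtain x u where u: "u \<in> U" "y = F (x, t u)"
          by (auto simp: W_def)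
        obtain u' where "u' \<in> U" "f u' = y"
          using rot[OF u(1), of x] unfolding u(2) F[OF u(1)] by blast
        then show "y \<in> f ` U"
          by blast
      qed
    qed
  next
    fix u assume "u \<in> U"
    then obtain V \<theta> where "open V" "u \<in> V" "V \<subseteq> U" "open (g \<theta> ` V)" "diffeomorphism V (g \<theta> ` V) (g \<theta>)"
      "\<forall>x\<in>V. f x = F (g \<theta> x)"
      using loc by blast
    moreover have "g \<theta> ` V \<subseteq> W"
      using \<open>V \<subseteq> U\<close> by (auto simp: g_def W_def)
    ultimately show "\<exists>V h. open V \<and> u \<in> V \<and> V \<subseteq> U \<and> open (h ` V) \<and> h ` V \<subseteq> W \<and>
        diffeomorphism V (h ` V) h \<and> (\<forall>x\<in>V. f x = F (h x))"
      by blast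
  qed
  moreover have "admissible 1 H C Cp Cm p"
    using admissible unfolding k .
  ultimately show ?thesis
    using orth unfolding given_by_elliptic_param_def F_def by blast
qed

end

section \<open>Choice of a Lorentzian frame; umbilic surfaces\<close>

text \<open>For \<open>k = -1\<close> there is no axis, as \<open>r2 \<ge> 1\<close>, and admissible
  roots exist for every \<open>C\<close>. So tangency and the first integral are enough, which lets
  rotations and umbilic surfaces be treated alike.\<close>

lemma (in cmc_surface) hyperbolic_param_of_frame:
  assumes H: "H\<^sup>2 < 1" and e: "orthonormal_basis e" "e 0 $ 0 > 0"
    and tangency: "\<And>u. u \<in> U \<Longrightarrow> mink (n u) (e 0) * mink (f u) (e 1) = mink (n u) (e 1) * mink (f u) (e 0)"
    and C: "\<And>u. u \<in> U \<Longrightarrow> rotational_frame.a f n (-1) (e 0) (e 1) u * (-1) + H * rotational_frame.r2 f (-1) (e 0) (e 1) u = C"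
  shows "given_by_hyperbolic_param H C f U"
proof -
  interpret R: rotational_frame f U n H "-1" e "e 0" "e 1" "e 2" "e 3"
    by unfold_locales (use e tangency in auto)
  obtain Cp Cm p where "admissible (-1) H C Cp Cm p"
    using exists_admissible[OF H, of "-1" C] by auto
  then interpret R: rotational_profile f U n H "-1" e "e 0" "e 1" "e 2" "e 3" C Cp Cm p
    using H C R.r2_ge by unfold_locales (auto simp: mult.commute, force)
  show ?thesis
  proof (rule R.hyperbolic_param)
    fix u assume u: "u \<in> U"
    have "mink (f u) (e 0) < 0"
      using mink_future_neg f_mink[OF u] f_pos[OF u] e orthonormal_basis_mink[OF e(1), of 0 0] by auto
    then show "0 < R.p1 u"
      by (simp add: R.p1_def R.P1_def)
  qed simp
qed

text \<open>The constant vector \<open>g\<close> is spacelike with square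
  \<open>1 - H\<^sup>2\<close>, so a Lorentzian plane orthogonal to it exists. There the components
  of \<open>n\<close> are \<open>- H\<close> times those of \<open>f\<close>, which gives tangency
  and \<open>C = 0\<close> at once.\<close>

lemma (in cmc_surface) hyperbolic_param_of_umbilic:
  assumes H: "H\<^sup>2 < 1" and g: "\<And>u. u \<in> U \<Longrightarrow> n u + H *\<^sub>R f u = g"
  shows "given_by_hyperbolic_param H 0 f U"
proof -
  obtain u0 where u0: "u0 \<in> U"
    using U(3) by blast
  have gg: "mink g g = 1 - H\<^sup>2"
    using n_unit[OF u0] n_f[OF u0] f_mink[OF u0]
    by (simp add: g[OF u0, symmetric] mink_simps mink_commute[of "f u0" "n u0"] power2_eq_square)
  define s where "s = sqrt (1 - H\<^sup>2)"
  have s: "s > 0" "s * s = 1 - H\<^sup>2"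
    using H by (auto simp: s_def)
  define a where "a = (1 / s) *\<^sub>R g"
  have aa: "mink a a = 1"
    using s gg by (simp add: a_def mink_simps field_simps)
  obtain x where x: "mink x x = -1" "x $ 0 > 0" "mink x a = 0"
    using exists_future_orthogonal[of a 0] aa by (auto simp: mink_simps)
  obtain b where b: "mink b b = 1" "mink b x = 0" "mink b a = 0"
    using exists_unit_orthogonal_to_three[OF x(1)] by blast
  obtain e where e: "orthonormal_basis e" "e 0 = x \<or> e 0 = - x" "e 1 = b" "e 0 $ 0 > 0"
    using exists_basis_lorentzian_plane[OF b(1) x(1) b(2)] by auto
  have ge: "mink g (e 0) = 0" "mink g (e 1) = 0"
    using e x b s by (auto simp: a_def mink_simps mink_commute[of _ g])
  have n: "mink (n u) (e i) = - H * mink (f u) (e i)" if "u \<in> U" "i = 0 \<or> i = 1" for u i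
  proof -
    have "mink (n u + H *\<^sub>R f u) (e i) = 0"
      unfolding g[OF that(1)] using that(2) ge by auto
    then show ?thesis by (simp add: mink_simps)
  qed
  have tangency: "mink (n u) (e 0) * mink (f u) (e 1) = mink (n u) (e 1) * mink (f u) (e 0)" if "u \<in> U" for u
    using n[OF that] by simp
  interpret R: rotational_frame f U n H "-1" e "e 0" "e 1" "e 2" "e 3"
    by unfold_locales (use e tangency in auto)
  show ?thesis
  proof (rule hyperbolic_param_of_frame[OF H e(1,4) tangency])
    fix u assume u: "u \<in> U"
    show "R.a u * (-1) + H * R.r2 u = 0"
      using n[OF u]
      by (simp add: R.a_def R.r2_def R.coord_defs R.P1_def R.P2_def power2_eq_square algebra_simps)
  qed
qed

text \<open>Elliptic rotational surfaces with \<open>C = 0\<close> are totally umbilic. Then \<open>n + H f\<close> is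
  constant, and the surface is tangent to all hyperbolic rotations that fix this vector.\<close>

lemma (in rotational_frame) umbilic_of_vanishing_integral:
  assumes k: "k = 1" and C0: "\<And>u. u \<in> U \<Longrightarrow> k * a u + H * r2 u = 0"
  shows "\<exists>g. \<forall>u\<in>U. n u + H *\<^sub>R f u = g"
proof -
  have k1: "k * x = x" for x
    by (simp add: k)
  have a: "a u = - H * r2 u" if "u \<in> U" for u
    using C0[OF that] by (simp add: k1)
  have m: "m1 u = - H * p1 u" "m2 u = - H * p2 u" if u: "u \<in> U" for u
  proof (atomize (full), cases "r2 u = 0")
    case True
    then show "m1 u = - H * p1 u \<and> m2 u = - H * p2 u"
      using axis[OF u True] by simp
  next
    case False
    have "r2 u * m1 u = r2 u * (- H * p1 u)" "r2 u * m2 u = r2 u * (- H * p2 u)"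
      using r2_m[OF u] by (simp_all add: k1 a[OF u])
    then show "m1 u = - H * p1 u \<and> m2 u = - H * p2 u"
      using False unfolding mult_cancel_left by blast
  qed
  have zero: "N u v + H *\<^sub>R D1 f u v = 0" if u: "u \<in> U" for u v
  proof -
    have P: "P1 (N u v) = - H * P1 (D1 f u v)" "P2 (N u v) = - H * P2 (D1 f u v)"
      using derivative_eq_on_U[OF u coord_derivative(5)[OF u] has_derivative_mult_right[OF coord_derivative(1)[OF u]] m(1)]
        derivative_eq_on_U[OF u coord_derivative(6)[OF u] has_derivative_mult_right[OF coord_derivative(2)[OF u]] m(2)]
      by (meson fun_cong)+
    have Q: "Q1 (N u v) = - H * Q1 (D1 f u v)" "Q2 (N u v) = - H * Q2 (D1 f u v)"
    proof (atomize (full), cases "r2 u = 0")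
      case True
      then show "Q1 (N u v) = - H * Q1 (D1 f u v) \<and> Q2 (N u v) = - H * Q2 (D1 f u v)"
        using axis(6-9)[OF u True, of v] by simp
    next
      case False
      \<comment> \<open>Now \<open>N\<close> multiplies \<open>T\<close> by \<open>- H\<close>, just
        as it multiplies \<open>xi\<close>.\<close>
      have s: "2 * H + k * a u / r2 u = H"
        using False by (simp add: k1 a[OF u])
      show "Q1 (N u v) = - H * Q1 (D1 f u v) \<and> Q2 (N u v) = - H * Q2 (D1 f u v)"
        unfolding coord_N(3,4)[OF u False] coord_D1(3,4)[OF u False] s by (simp add: mult_ac)
    qed
    show ?thesis
      by (rule coord_eqI; simp only: coord_simps P Q) (simp_all add: P1_def P2_def Q1_def Q2_def mink_simps)
  qed
  have "((\<lambda>x. n x + H *\<^sub>R f x) has_derivative (\<lambda>v. 0)) (at u)" if u: "u \<in> U" for u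
  proof -
    have "((\<lambda>x. n x + H *\<^sub>R f x) has_derivative (\<lambda>v. N u v + H *\<^sub>R D1 f u v)) (at u)"
      by (intro derivative_intros N D1 u)
    then show ?thesis
      by (simp add: zero[OF u])
  qed
  from has_derivative_zero_unique_connected[OF U(1,2) this] U(3) show ?thesis
    by blast
qed

subsection \<open>One-parameter groups of rotations\<close>

locale rotation_group = adapted_basis +
  fixes G :: "real \<Rightarrow> real^4 \<Rightarrow> real^4"
  assumes group: "one_parameter_isometry_group G"
    and fixed: "G s B1 = B1" "G s B2 = B2"
begin

lemma G_linear: "linear (G s)" and G_mink: "mink (G s x) (G s y) = mink x y"
  and G_add: "G (s + t) x = G s (G t x)" and G_0: "G 0 x = x"
  and G_cont: "continuous_on UNIV (\<lambda>s. G s x)" and G_nontrivial: "\<exists>s. G s \<noteq> id"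
  using group by (auto simp: one_parameter_isometry_group_def)

text \<open>Together with \<open>d\<close>, the cosine and sine of the rotation for
  \<open>k = 1\<close>, the hyperbolic ones for \<open>k = -1\<close>.\<close>

definition "c s = P1 (G s A1)"
definition "d s = P2 (G s A1)"

lemma G_A: "G s A1 = comb (c s) (d s) 0 0" "G s A2 = comb (P1 (G s A2)) (P2 (G s A2)) 0 0"
proof -
  have "mink (G s A1) B1 = 0" "mink (G s A1) B2 = 0" "mink (G s A2) B1 = 0" "mink (G s A2) B2 = 0"
    using G_mink[of s A1 B1] G_mink[of s A1 B2] G_mink[of s A2 B1] G_mink[of s A2 B2]
    by (simp_all add: fixed mink_frame)
  then show "G s A1 = comb (c s) (d s) 0 0" "G s A2 = comb (P1 (G s A2)) (P2 (G s A2)) 0 0"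
    using comb_coord[of "G s A1"] comb_coord[of "G s A2"]
    by (simp_all add: c_def d_def Q1_def Q2_def)
qed

lemma cd_norm: "(c s)\<^sup>2 + k * (d s)\<^sup>2 = 1"
proof -
  have "k * (c s)\<^sup>2 + (d s)\<^sup>2 = k"
  proof -
    have "mink (comb (c s) (d s) 0 0) (comb (c s) (d s) 0 0) = k"
      using G_mink[of s A1 A1] by (simp only: G_A(1)[of s] mink_frame)
    then show ?thesis
      unfolding mink_coord coord_comb by (simp add: power2_eq_square)
  qed
  then have "k * (k * (c s)\<^sup>2 + (d s)\<^sup>2) = k * k"
    by (rule arg_cong)
  then show ?thesis
    by (simp add: kk kk_left distrib_left)
qed

lemma G_comb: "G s (comb x1 x2 y1 y2) = x1 *\<^sub>R G s A1 + x2 *\<^sub>R G s A2 + y1 *\<^sub>R B1 + y2 *\<^sub>R B2"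
  by (simp only: comb_def linear_add[OF G_linear] linear_scale[OF G_linear] fixed)

text \<open>Every element of the group is a square, so it has determinant \<open>1\<close> on the plane of rotation.\<close>

lemma G_A2: "G s A2 = comb (- k * d s) (c s) 0 0"
proof -
  define x y where "x s = P1 (G s A2)" and "y s = P2 (G s A2)" for s
  have A2: "G s A2 = comb (x s) (y s) 0 0" for s
    unfolding x_def y_def by (rule G_A)
  define \<Delta> where "\<Delta> s = c s * y s - d s * x s" for s
  have ort: "k * c s * x s + d s * y s = 0" "k * (x s)\<^sup>2 + (y s)\<^sup>2 = 1" for s
  proof -
    have "mink (comb (c s) (d s) 0 0) (comb (x s) (y s) 0 0) = 0" "mink (comb (x s) (y s) 0 0) (comb (x s) (y s) 0 0) = 1"
      using G_mink[of s A1 A2] G_mink[of s A2 A2] by (simp_all only: G_A(1)[of s] A2[of s] mink_frame)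
    then show "k * c s * x s + d s * y s = 0" "k * (x s)\<^sup>2 + (y s)\<^sup>2 = 1"
      unfolding mink_coord coord_comb by (simp_all add: power2_eq_square)
  qed
  have sq: "(\<Delta> s)\<^sup>2 = 1" for s
    using ort[of s] cd_norm[of s] kk unfolding \<Delta>_def by algebra
  have "\<Delta> (s + t) = \<Delta> s * \<Delta> t" for s t
  proof -
    have "G (s + t) A1 = c t *\<^sub>R G s A1 + d t *\<^sub>R G s A2" "G (s + t) A2 = x t *\<^sub>R G s A1 + y t *\<^sub>R G s A2"
      by (simp_all add: G_add G_A(1)[of t] A2[of t] G_comb)
    then have "c (s + t) = c t * c s + d t * x s" "d (s + t) = c t * d s + d t * y s"
      "x (s + t) = x t * c s + y t * x s" "y (s + t) = x t * d s + y t * y s"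
      unfolding c_def[of "s + t"] d_def[of "s + t"] x_def[of "s + t"] y_def[of "s + t"]
      by (simp_all add: coord_simps G_A(1)[of s] A2[of s])
    then show ?thesis
      unfolding \<Delta>_def by algebra
  qed
  from this[of "s / 2" "s / 2"] have "\<Delta> s = 1"
    using sq[of "s / 2"] by (simp add: power2_eq_square)
  then have "x s = - k * d s" "y s = c s"
    using ort[of s] cd_norm[of s] kk unfolding \<Delta>_def by algebra+
  then show ?thesis
    by (simp add: A2)
qed

lemma coord_G: "P1 (G s x) = c s * P1 x - k * d s * P2 x" "P2 (G s x) = d s * P1 x + c s * P2 x"
  "Q1 (G s x) = Q1 x" "Q2 (G s x) = Q2 x"
proof -
  have "G s x = P1 x *\<^sub>R G s A1 + P2 x *\<^sub>R G s A2 + Q1 x *\<^sub>R B1 + Q2 x *\<^sub>R B2"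
    by (subst comb_coord[of x]) (rule G_comb)
  then have "G s x = comb (c s * P1 x - k * d s * P2 x) (d s * P1 x + c s * P2 x) (Q1 x) (Q2 x)"
    by (simp add: G_A(1) G_A2 comb_def algebra_simps)
  then show "P1 (G s x) = c s * P1 x - k * d s * P2 x" "P2 (G s x) = d s * P1 x + c s * P2 x"
    "Q1 (G s x) = Q1 x" "Q2 (G s x) = Q2 x"
    by simp_all
qed

lemma coord_A1: "P1 A1 = 1" "P2 A1 = 0"
  using kk by (simp_all add: P1_def P2_def mink_frame)

lemma cd_add: "c (s + t) = c s * c t - k * d s * d t" "d (s + t) = d s * c t + c s * d t"
  unfolding c_def[of "s + t"] d_def[of "s + t"] G_add coord_G(1,2)[of s] by (simp_all add: c_def d_def)

lemma cd_0: "c 0 = 1" "d 0 = 0"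
  by (simp_all add: c_def d_def G_0 coord_A1)

lemma cd_minus: "c (- s) = c s" "d (- s) = - d s"
  using cd_add[of s "- s"] cd_norm[of s] kk by (simp_all add: cd_0) algebra+

lemma cd_cont: "continuous_on UNIV c" "continuous_on UNIV d"
  unfolding c_def[abs_def] d_def[abs_def] P1_def P2_def
  by (intro continuous_intros G_cont)+

lemma cd_nontrivial: "\<exists>s. (c s, d s) \<noteq> (1, 0)"
proof (rule ccontr)
  assume neg: "\<not> ?thesis"
  have "G s x = x" for s x
    using neg by (intro coord_eqI) (auto simp: coord_G)
  then show False
    using G_nontrivial by (auto simp: fun_eq_iff)
qed

text \<open>Continuity moves \<open>c\<close> through all values between 1 and some
  \<open>c s0 < 1\<close>, so the small angle \<open>\<theta> / n\<close> is attained for large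
  \<open>n\<close>, if necessary after replacing \<open>s\<close> by \<open>- s\<close> to correct
  the sine. The addition formulas then multiply it by \<open>n\<close>.\<close>

lemma circle_surjective:
  assumes k: "k = 1"
  shows "\<exists>s. c s = cos \<theta> \<and> d s = sin \<theta>"
proof -
  have norm: "(c s)\<^sup>2 + (d s)\<^sup>2 = 1" for s
    using cd_norm[of s] by (simp add: k)
  obtain s0 where "(c s0, d s0) \<noteq> (1, 0)"
    using cd_nontrivial by blast
  have "c s0 < 1"
  proof (rule ccontr)
    assume "\<not> c s0 < 1"
    then have "1 \<le> (c s0)\<^sup>2"
      by (simp add: one_le_power)
    then have "(d s0)\<^sup>2 \<le> 0" "(c s0)\<^sup>2 = 1"
      using norm[of s0] zero_le_power2[of "d s0"] by linarith+
    then have "d s0 = 0" "c s0 = 1"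
      using \<open>\<not> c s0 < 1\<close> by (auto simp: power2_eq_1_iff)
    then show False
      using \<open>(c s0, d s0) \<noteq> (1, 0)\<close> by simp
  qed
  note s0 = this
  have "(\<lambda>n. cos (\<theta> / real n)) \<longlonglongrightarrow> cos 0"
    by (intro tendsto_cos) (rule lim_const_over_n)
  then have "\<forall>\<^sub>F n in sequentially. c s0 < cos (\<theta> / real n)"
    using s0 by (intro order_tendstoD) auto
  then have "\<forall>\<^sub>F n in sequentially. c s0 < cos (\<theta> / real n) \<and> n > 0"
    using eventually_gt_at_top[of 0] by (rule eventually_conj)
  from eventually_happens[OF this] obtain n where n: "c s0 < cos (\<theta> / real n)" "n > 0"
    by auto
  have "connected (range c)"
    using cd_cont by (intro connected_continuous_image) auto
  then have "{c s0..c 0} \<subseteq> range c"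
    by (intro connected_contains_Icc) auto
  then obtain s1 where s1: "c s1 = cos (\<theta> / real n)"
    using n by (metis atLeastAtMost_iff cd_0(1) cos_le_one less_imp_le imageE subsetD)
  have "(d s1)\<^sup>2 = (sin (\<theta> / real n))\<^sup>2"
    using norm[of s1] s1 by (simp add: sin_squared_eq)
  then have "d s1 = sin (\<theta> / real n) \<or> d (- s1) = sin (\<theta> / real n)"
    by (auto simp: cd_minus power2_eq_iff)
  then obtain s where s: "c s = cos (\<theta> / real n)" "d s = sin (\<theta> / real n)"
    using s1 cd_minus(1) by metis
  have "c (real m * s) = cos (real m * (\<theta> / real n)) \<and> d (real m * s) = sin (real m * (\<theta> / real n))" for m
  proof (induction m)
    case 0
    then show ?case by (simp add: cd_0)
  next
    case (Suc m)
    have "real (Suc m) * s = s + real m * s" "real (Suc m) * (\<theta> / real n) = \<theta> / real n + real m * (\<theta> / real n)"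
      by (simp_all only: of_nat_Suc distrib_right mult_1_left)
    then show ?case
      using Suc by (simp only: cd_add s cos_add sin_add) (simp add: k)
  qed
  from this[of n] n(2) show ?thesis
    by (intro exI[of _ "real n * s"]) simp
qed

end

section \<open>Tangency of the infinitesimal rotation\<close>

text \<open>Otherwise each point is cut out of \<open>A\<close> by a member of a countable base, and
  different points need different members.\<close>

lemma uncountable_has_limit_point:
  fixes A :: "'a::second_countable_topology set"
  assumes "uncountable A"
  shows "\<exists>z\<in>A. z islimpt A"
proof (rule ccontr)
  assume neg: "\<not> ?thesis"
  obtain B :: "'a set set" where B: "countable B" "topological_basis B"
    using ex_countable_basis by blast
  have "\<exists>b\<in>B. z \<in> b \<and> b \<inter> A = {z}" if z: "z \<in> A" for z
  proof -
    have "\<not> z islimpt A"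
      using neg z by blast
    then obtain T where T: "open T" "z \<in> T" "\<And>y. y \<in> A \<Longrightarrow> y \<in> T \<Longrightarrow> y = z"
      unfolding islimpt_def by blast
    obtain b where b: "b \<in> B" "z \<in> b" "b \<subseteq> T"
      by (rule topological_basisE[OF B(2) T(1,2)])
    have "b \<inter> A = {z}"
      using b(2,3) T(3) z by blast
    then show ?thesis
      using b(1,2) by blast
  qed
  then have ex: "\<exists>b. b \<in> B \<and> b \<inter> A = {z}" if "z \<in> A" for z
    using that by blast
  define b where "b z = (SOME b. b \<in> B \<and> b \<inter> A = {z})" for z
  have b: "b z \<in> B" "b z \<inter> A = {z}" if "z \<in> A" for z
    using someI_ex[OF ex[OF that]] unfolding b_def by auto
  have "inj_on b A"
  proof (rule inj_onI)
    fix x y assume xy: "x \<in> A" "y \<in> A" "b x = b y"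
    have "{x} = b x \<inter> A"
      by (rule b(2)[OF xy(1), symmetric])
    also have "\<dots> = b y \<inter> A"
      by (simp only: xy(3))
    also have "\<dots> = {y}"
      by (rule b(2)[OF xy(2)])
    finally show "x = y"
      by simp
  qed
  moreover have "countable (b ` A)"
    using countable_subset[OF _ B(1), of "b ` A"] b(1) by blast
  ultimately show False
    using assms countable_image_inj_on by blast
qed

text \<open>At \<open>y = x\<close> the quotient is \<open>0 / 0 = 0\<close>.\<close>

lemma chord_direction_tendsto_tangent:
  fixes f :: "real \<times> real \<Rightarrow> real^4"
  assumes f: "(f has_derivative L) (at x)" and inj: "\<And>v. L v = 0 \<Longrightarrow> v = 0"
    and \<nu>: "\<And>v. mink \<nu> (L v) = 0"
  shows "((\<lambda>y. mink \<nu> (f y - f x) / norm (f y - f x)) \<longlongrightarrow> 0) (nhds x)"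
proof -
  have lin: "linear L"
    using f has_derivative_bounded_linear bounded_linear.linear by blast
  then have "inj L"
    using inj linear_injective_0 by blast
  then obtain m where m: "m > 0" "\<And>v. m * norm v \<le> norm (L v)"
    using linear_inj_bounded_below_pos[OF lin] by blast
  obtain K where K: "K > 0" "\<And>a b. norm (mink a b) \<le> norm a * norm b * K"
    using mink.pos_bounded by blast
  show ?thesis
  proof (rule tendstoI)
    fix e :: real assume e: "e > 0"
    define M where "M = norm \<nu> * K + 1"
    have M: "M > 0" using K by (simp add: M_def add_nonneg_pos)
    \<comment> \<open>The bound \<open>m / 2\<close> keeps the chord at least
      \<open>m / 2 * norm (y - x)\<close> long; the other one then makes the quotient at most
      \<open>e / 2\<close>.\<close>
    define e' where "e' = min (m / 2) (e * m / (4 * M))"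
    have e': "e' > 0" "e' \<le> m / 2" "e' \<le> e * m / (4 * M)"
      using e m M by (simp_all add: e'_def)
    obtain r where r: "r > 0" "\<And>y. norm (y - x) < r \<Longrightarrow> norm (f y - f x - L (y - x)) \<le> e' * norm (y - x)"
      using f e'(1) unfolding has_derivative_at_alt by blast
    have "dist (mink \<nu> (f y - f x) / norm (f y - f x)) 0 < e" if y: "dist y x < r" for y
    proof (cases "f y = f x")
      case True
      then show ?thesis using e by simp
    next
      case False
      define \<epsilon> where "\<epsilon> = f y - f x - L (y - x)"
      have \<epsilon>: "norm \<epsilon> \<le> e' * norm (y - x)"
        using r(2)[of y] y by (simp add: \<epsilon>_def dist_norm)
      have "m * norm (y - x) \<le> norm (L (y - x))"
        by (rule m)
      also have "\<dots> \<le> norm (f y - f x) + norm \<epsilon>"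
        using norm_triangle_ineq4[of "f y - f x" \<epsilon>] by (simp add: \<epsilon>_def)
      also have "norm \<epsilon> \<le> m / 2 * norm (y - x)"
        using \<epsilon> e'(2) by (meson mult_right_mono norm_ge_zero order_trans)
      finally have low: "m / 2 * norm (y - x) \<le> norm (f y - f x)"
        by simp
      have "mink \<nu> (f y - f x) = mink \<nu> \<epsilon>"
        using \<nu>[of "y - x"] by (simp add: \<epsilon>_def mink_simps)
      then have "\<bar>mink \<nu> (f y - f x)\<bar> \<le> norm \<nu> * norm \<epsilon> * K"
        using K(2)[of \<nu> \<epsilon>] by simp
      also have "\<dots> = norm \<nu> * K * norm \<epsilon>"
        by simp
      also have "\<dots> \<le> M * norm \<epsilon>"
        by (intro mult_right_mono) (simp_all add: M_def)
      also have "\<dots> \<le> M * (e * m / (4 * M) * norm (y - x))"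
        using \<epsilon> e'(3) M by (intro mult_left_mono) (meson mult_right_mono norm_ge_zero order_trans, simp)
      also have "\<dots> = e / 2 * (m / 2 * norm (y - x))"
        using M by simp
      also have "\<dots> \<le> e / 2 * norm (f y - f x)"
        using low e by (intro mult_left_mono) auto
      also have "\<dots> < e * norm (f y - f x)"
        using False e by simp
      finally show ?thesis
        using False by (simp add: field_simps)
    qed
    then show "\<forall>\<^sub>F y in nhds x. dist (mink \<nu> (f y - f x) / norm (f y - f x)) 0 < e"
      using r(1) unfolding eventually_nhds_metric by blast
  qed
qed

locale invariant_surface = surface_with_normal f U n + rotation_group k e A1 A2 B1 B2 G
  for f U n k e A1 A2 B1 B2 G +
  assumes invariant: "invariant_under G f U"
begin

definition \<phi> where "\<phi> s = (SOME \<phi>. diffeomorphism U U \<phi> \<and> (\<forall>u\<in>U. f (\<phi> u) = G s (f u)))"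

lemma \<phi>: "diffeomorphism U U (\<phi> s)" "u \<in> U \<Longrightarrow> f (\<phi> s u) = G s (f u)"
proof -
  have "\<exists>\<phi>. diffeomorphism U U \<phi> \<and> (\<forall>u\<in>U. f (\<phi> u) = G s (f u))"
    using invariant by (auto simp: invariant_under_def)
  from someI_ex[OF this]
  show "diffeomorphism U U (\<phi> s)" "u \<in> U \<Longrightarrow> f (\<phi> s u) = G s (f u)"
    unfolding \<phi>_def by auto
qed

lemma \<phi>_U: "u \<in> U \<Longrightarrow> \<phi> s u \<in> U"
  using \<phi>(1)[of s] by (auto simp: diffeomorphism_def homeomorphism_def)

lemma \<phi>_derivative:
  assumes u: "u \<in> U"
  obtains L where "(\<phi> s has_derivative L) (at u)" "\<And>w. \<exists>v. L v = w"
proof -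
  obtain g where g: "homeomorphism U U (\<phi> s) g" "\<phi> s differentiable_on U" "g differentiable_on U"
    using \<phi>(1)[of s] by (auto simp: diffeomorphism_def)
  obtain L where L: "(\<phi> s has_derivative L) (at u)"
    using g(2) u U(1) by (auto simp: differentiable_on_eq_differentiable_at differentiable_def)
  obtain M where M: "(g has_derivative M) (at (\<phi> s u))"
    using g(3) \<phi>_U[OF u] U(1) by (auto simp: differentiable_on_eq_differentiable_at differentiable_def)
  have gu: "g (\<phi> s u) = u"
    using g(1) u by (auto simp: homeomorphism_def)
  have "((\<lambda>y. \<phi> s (g y)) has_derivative (\<lambda>v. L (M v))) (at (\<phi> s u))"
    by (rule has_derivative_compose[OF M]) (simp add: gu L)
  moreover have "\<phi> s (g y) = y" if "y \<in> U" for y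
    using g(1) that by (auto simp: homeomorphism_def)
  ultimately have "(\<lambda>v. L (M v)) = (\<lambda>v. v)"
    by (rule derivative_eq_on_U[OF \<phi>_U[OF u] _ has_derivative_ident])
  then have "\<exists>v. L v = w" for w
    by metis
  then show thesis
    using that L by blast
qed

text \<open>\<open>G s\<close> carries the tangent plane at \<open>u\<close> onto the one at
  \<open>\<phi> s u\<close>, because the derivative of a diffeomorphism is onto. Hence it carries
  the normal line to the normal line; the orientation is left open.\<close>

lemma G_n:
  assumes u: "u \<in> U"
  shows "G s (n u) = mink (G s (n u)) (n (\<phi> s u)) *\<^sub>R n (\<phi> s u)"
proof -
  define x where "x = \<phi> s u"
  define X where "X = G s (n u) - mink (G s (n u)) (n x) *\<^sub>R n x"
  have x: "x \<in> U"
    by (simp add: x_def \<phi>_U u)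
  obtain L where L: "(\<phi> s has_derivative L) (at u)" "\<And>w. \<exists>v. L v = w"
    using \<phi>_derivative[OF u] by blast
  have "((\<lambda>y. f (\<phi> s y)) has_derivative (\<lambda>v. D1 f x (L v))) (at u)"
    using has_derivative_compose[OF L(1) D1[OF x[unfolded x_def]]] by (simp add: x_def)
  moreover have "((\<lambda>y. G s (f y)) has_derivative (\<lambda>v. G s (D1 f u v))) (at u)"
    using bounded_linear.has_derivative[OF _ D1[OF u]] G_linear linear_conv_bounded_linear by blast
  ultimately have eq: "(\<lambda>v. D1 f x (L v)) = (\<lambda>v. G s (D1 f u v))"
    by (rule derivative_eq_on_U[OF u]) (rule \<phi>(2))
  have Xf: "mink X (f x) = 0"
    using n_f[OF x] n_f[OF u] by (simp add: X_def mink_simps x_def \<phi>(2)[OF u] G_mink)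
  have XD: "mink X (D1 f x w) = 0" for w
  proof -
    obtain v where "w = L v"
      using L(2) by metis
    then have "D1 f x w = G s (D1 f u v)"
      using eq by (simp add: fun_eq_iff del: split_paired_All)
    then have "mink (G s (n u)) (D1 f x w) = 0"
      using n_D1[OF u] by (simp add: G_mink)
    then show ?thesis
      using n_D1[OF x] by (simp add: X_def mink_simps)
  qed
  have Xn: "mink X (n x) = 0"
    using n_unit[OF x] by (simp add: X_def mink_simps)
  have "X = 0"
  proof (rule mink_nondegenerate)
    fix y
    obtain a v c where "y = a *\<^sub>R f x + D1 f x v + c *\<^sub>R n x"
      using frame_spans[OF x] by blast
    then show "mink X y = 0"
      by (simp add: mink_simps Xf XD Xn)
  qed
  then show ?thesis
    by (simp add: X_def x_def)
qed

text \<open>The infinitesimal rotation as a linear map; \<open>xi u\<close> is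
  \<open>J (f u)\<close>.\<close>

definition "J y = comb (- k * P2 y) (P1 y) 0 0"

text \<open>A difference quotient with \<open>d \<delta>\<close> in place of the group parameter, on
  which \<open>G\<close> depends only continuously. The error term comes from
  \<open>c - 1 = - k * d\<^sup>2 / (1 + c)\<close>.\<close>

lemma G_chord:
  assumes "0 < c \<delta>" "d \<delta> \<noteq> 0"
  shows "(1 / d \<delta>) *\<^sub>R (G \<delta> y - y) = J y - (k * d \<delta> / (1 + c \<delta>)) *\<^sub>R comb (P1 y) (P2 y) 0 0"
proof -
  have "c \<delta> - 1 = - k * d \<delta> * d \<delta> / (1 + c \<delta>)"
    using cd_norm[of \<delta>] assms(1) by (simp add: field_simps power2_eq_square)
  then have 1: "(c \<delta> - 1) / d \<delta> = - (k * d \<delta> / (1 + c \<delta>))"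
    using assms(2) by simp
  have coord_diff: "P1 (x - z) = P1 x - P1 z" "P2 (x - z) = P2 x - P2 z"
    "Q1 (x - z) = Q1 x - Q1 z" "Q2 (x - z) = Q2 x - Q2 z" for x z
    by (simp_all add: P1_def P2_def Q1_def Q2_def mink_simps algebra_simps)
  have "(1 / d \<delta>) *\<^sub>R (G \<delta> y - y) = comb ((c \<delta> - 1) / d \<delta> * P1 y - k * P2 y) (P1 y + (c \<delta> - 1) / d \<delta> * P2 y) 0 0"
    by (rule coord_eqI)
      (use assms(2) in \<open>simp_all add: coord_simps coord_diff coord_G field_simps\<close>)
  then show ?thesis
    unfolding 1 by (simp add: J_def comb_def algebra_simps)
qed

text \<open>The pairs of a rotation and the moved point form an uncountable set, which therefore has a limit
  point in itself. This makes up for \<open>\<phi> s\<close> not being assumed to depend continuously on \<open>s\<close>.\<close>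

lemma exists_tangent_rotation:
  assumes u: "u \<in> U"
  shows "\<exists>s. mink (n (\<phi> s u)) (G s (J (f u))) = 0"
proof -
  \<comment> \<open>Rotations are recorded by \<open>(c, d)\<close> because parameters of a circle
    group repeat. The range is connected with two points, hence uncountable, and
    \<open>\<sigma>\<close> picks one parameter for each rotation.\<close>
  define R where "R s = (c s, d s)" for s
  define \<sigma> where "\<sigma> = inv_into UNIV R"
  have \<sigma>: "R (\<sigma> g) = g" if "g \<in> range R" for g
    unfolding \<sigma>_def using that by (rule f_inv_into_f)
  obtain s0 where "R s0 \<noteq> R 0"
    using cd_nontrivial by (auto simp: R_def cd_0)
  moreover have "connected (range R)"
    unfolding R_def by (intro connected_continuous_image continuous_intros cd_cont connected_UNIV)
  ultimately have unc: "uncountable (range R)"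
    using connected_uncountable[of "range R"] by blast
  define A where "A = (\<lambda>g. (g, \<phi> (\<sigma> g) u)) ` range R"
  have "uncountable A"
    unfolding A_def using unc countable_image_inj_on[of "\<lambda>g. (g, \<phi> (\<sigma> g) u)" "range R"]
    by (auto simp: inj_on_def)
  then obtain z where z: "z \<in> A" "z islimpt A"
    using uncountable_has_limit_point by blast
  obtain w where w: "\<And>n. w n \<in> A - {z}" "w \<longlonglongrightarrow> z"
    using z(2) unfolding islimpt_sequential by blast
  define s where "s = \<sigma> (fst z)"
  define sn where "sn i = \<sigma> (fst (w i))" for i
  define x where "x = \<phi> s u"
  define y where "y = f u"
  have zR: "z = (R s, x)"
    using z(1) by (auto simp: A_def s_def x_def \<sigma>)
  have wR: "w i = (R (sn i), \<phi> (sn i) u)" for i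
    using w(1)[of i] by (auto simp: A_def sn_def \<sigma>)
  have x: "x \<in> U"
    by (simp add: x_def \<phi>_U u)
  have Rne: "R (sn i) \<noteq> R s" for i
  proof
    assume eq: "R (sn i) = R s"
    then have "fst (w i) = fst z"
      by (simp add: wR zR)
    then have "sn i = s"
      by (simp add: sn_def s_def)
    then show False
      using w(1)[of i] by (simp add: wR zR x_def)
  qed
  have lim: "(\<lambda>i. c (sn i)) \<longlonglongrightarrow> c s" "(\<lambda>i. d (sn i)) \<longlonglongrightarrow> d s" "(\<lambda>i. \<phi> (sn i) u) \<longlonglongrightarrow> x"
    using tendsto_fst[OF tendsto_fst[OF w(2)]] tendsto_snd[OF tendsto_fst[OF w(2)]] tendsto_snd[OF w(2)]
    by (simp_all add: wR zR R_def)
  define \<delta> where "\<delta> i = sn i - s" for i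
  have cd\<delta>: "c (\<delta> i) = c (sn i) * c s + k * d (sn i) * d s" "d (\<delta> i) = d (sn i) * c s - c (sn i) * d s" for i
    using cd_add[of "sn i" "- s"] by (simp_all add: \<delta>_def cd_minus)
  have "(\<lambda>i. c (\<delta> i)) \<longlonglongrightarrow> c s * c s + k * d s * d s" "(\<lambda>i. d (\<delta> i)) \<longlonglongrightarrow> d s * c s - c s * d s"
    unfolding cd\<delta> by (intro tendsto_intros lim)+
  then have lim\<delta>: "(\<lambda>i. c (\<delta> i)) \<longlonglongrightarrow> 1" "(\<lambda>i. d (\<delta> i)) \<longlonglongrightarrow> 0"
    using cd_norm[of s] by (simp_all add: power2_eq_square mult.assoc)
  have ev: "\<forall>\<^sub>F i in sequentially. 0 < c (\<delta> i)"
    using lim\<delta>(1) by (rule order_tendstoD) simp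
  have dne: "d (\<delta> i) \<noteq> 0" if "0 < c (\<delta> i)" for i
  proof
    assume d0: "d (\<delta> i) = 0"
    then have c1: "c (\<delta> i) = 1"
      using cd_norm[of "\<delta> i"] that by (auto simp: power2_eq_1_iff)
    have "R (sn i) = R s"
      using cd_add[of "\<delta> i" s] by (simp add: R_def d0 c1) (simp add: \<delta>_def)
    then show False
      using Rne by blast
  qed
  \<comment> \<open>Chords of the surface at \<open>x\<close>, rescaled. By \<open>G_chord\<close>
    they converge to \<open>G s (J y)\<close>, while their directions become orthogonal to
    \<open>n x\<close>; since the limit is finite, it is orthogonal to \<open>n x\<close>.\<close>
  define q where "q i = (1 / d (\<delta> i)) *\<^sub>R (f (\<phi> (sn i) u) - f x)" for i
  have q_eq: "q i = G s (J y - (k * d (\<delta> i) / (1 + c (\<delta> i))) *\<^sub>R comb (P1 y) (P2 y) 0 0)" if "0 < c (\<delta> i)" for i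
  proof -
    have "f (\<phi> (sn i) u) = G s (G (\<delta> i) y)"
      by (simp add: \<phi>(2)[OF u] y_def \<delta>_def flip: G_add)
    then have "f (\<phi> (sn i) u) - f x = G s (G (\<delta> i) y - y)"
      by (simp add: x_def \<phi>(2)[OF u] y_def linear_diff[OF G_linear])
    then have "q i = G s ((1 / d (\<delta> i)) *\<^sub>R (G (\<delta> i) y - y))"
      by (simp add: q_def linear_scale[OF G_linear])
    then show ?thesis
      by (simp only: G_chord[OF that dne[OF that]])
  qed
  have "(\<lambda>i. J y - (k * d (\<delta> i) / (1 + c (\<delta> i))) *\<^sub>R comb (P1 y) (P2 y) 0 0)
      \<longlonglongrightarrow> J y - (k * 0 / (1 + 1)) *\<^sub>R comb (P1 y) (P2 y) 0 0"
    by (intro tendsto_intros lim\<delta>) simp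
  then have "(\<lambda>i. G s (J y - (k * d (\<delta> i) / (1 + c (\<delta> i))) *\<^sub>R comb (P1 y) (P2 y) 0 0)) \<longlonglongrightarrow> G s (J y)"
    using bounded_linear.tendsto[of "G s"] G_linear[of s] by (simp add: linear_conv_bounded_linear)
  then have q: "q \<longlonglongrightarrow> G s (J y)"
    by (rule Lim_transform_eventually) (use ev in \<open>auto elim!: eventually_mono simp: q_eq\<close>)
  have "(\<lambda>i. mink (n x) (f (\<phi> (sn i) u) - f x) / norm (f (\<phi> (sn i) u) - f x)) \<longlonglongrightarrow> 0"
    by (rule filterlim_compose[OF chord_direction_tendsto_tangent[OF D1[OF x]] lim(3)])
      (use D1_inj[OF x] n_D1[OF x] in auto)
  then have "(\<lambda>i. \<bar>mink (n x) (f (\<phi> (sn i) u) - f x) / norm (f (\<phi> (sn i) u) - f x)\<bar> * norm (q i)) \<longlonglongrightarrow> \<bar>0\<bar> * norm (G s (J y))"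
    by (intro tendsto_intros q)
  moreover have "\<bar>mink (n x) (f (\<phi> (sn i) u) - f x) / norm (f (\<phi> (sn i) u) - f x)\<bar> * norm (q i) = \<bar>mink (n x) (q i)\<bar>" for i
    by (cases "f (\<phi> (sn i) u) = f x") (simp_all add: q_def mink_simps abs_mult)
  ultimately have "(\<lambda>i. \<bar>mink (n x) (q i)\<bar>) \<longlonglongrightarrow> 0"
    by simp
  moreover have "(\<lambda>i. \<bar>mink (n x) (q i)\<bar>) \<longlonglongrightarrow> \<bar>mink (n x) (G s (J y))\<bar>"
    by (intro tendsto_intros mink.tendsto q)
  ultimately have "\<bar>mink (n x) (G s (J y))\<bar> = 0"
    by (rule LIMSEQ_unique[symmetric])
  then show ?thesis
    by (auto simp: x_def y_def)
qed

text \<open>Tangency was found only at some point \<open>\<phi> s u\<close> of the orbit; as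
  \<open>G s\<close> is an isometry preserving the normal line, it transports the orthogonality back
  to \<open>u\<close>.\<close>

theorem normal_orthogonal_rotation:
  assumes u: "u \<in> U"
  shows "mink (n u) A1 * mink (f u) A2 = mink (n u) A2 * mink (f u) A1"
proof -
  obtain s where s: "mink (n (\<phi> s u)) (G s (J (f u))) = 0"
    using exists_tangent_rotation[OF u] by blast
  have "mink (n u) (J (f u)) = mink (G s (n u)) (G s (J (f u)))"
    by (simp add: G_mink)
  also have "\<dots> = 0"
    by (subst G_n[OF u]) (simp add: mink_simps s)
  finally have "k * (P1 (n u) * P2 (f u)) * k = P2 (n u) * P1 (f u)"
    by (simp add: J_def mink_coord)
  then have "P1 (n u) * P2 (f u) = P2 (n u) * P1 (f u)"
    using kk by algebra
  then show ?thesis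
    using k_nz by (simp add: P1_def P2_def)
qed

end

section \<open>Elliptic and hyperbolic rotational surfaces\<close>

lemma mink_span_eq_zero:
  assumes "mink x a = 0" "mink x b = 0" "y \<in> span {a, b}"
  shows "mink x y = 0"
proof -
  obtain s t where "y - s *\<^sub>R a = t *\<^sub>R b"
    using assms(3) by (auto simp: span_insert span_singleton)
  then have "y = s *\<^sub>R a + t *\<^sub>R b"
    by (simp add: algebra_simps)
  then show ?thesis
    using assms(1,2) by (simp add: mink_simps)
qed

context cmc_surface
begin

lemma elliptic_case:
  assumes H: "H\<^sup>2 < 1" and rot: "elliptic_rotational f U"
  shows "(\<exists>C. given_by_elliptic_param H C f U) \<or> given_by_hyperbolic_param H 0 f U"
proof -
  obtain P G a b where P: "P = span {a, b}" "mink a a = 1" "mink b b = 1" "mink a b = 0"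
    and G: "rotations_in P G" "invariant_under G f U"
    using rot unfolding elliptic_rotational_def plane_of_signature_def by blast
  obtain e where e: "orthonormal_basis e" "e 2 = a" "e 3 = b" "e 0 $ 0 > 0"
    using exists_basis_spacelike_plane[OF P(2-4)] by blast
  have "mink (e i) y = 0" if "i = 0 \<or> i = 1" "y \<in> P" for i y
    using that mink_span_eq_zero[of "e i" a b y] orthonormal_basis_mink[OF e(1), of i 2]
      orthonormal_basis_mink[OF e(1), of i 3] by (auto simp: P(1) e(2,3))
  then have fixed: "G s (e 0) = e 0" "G s (e 1) = e 1" for s
    using G(1) unfolding rotations_in_def by blast+
  interpret S: invariant_surface f U n 1 e "e 2" "e 3" "e 0" "e 1" G
    by unfold_locales (use e G fixed in \<open>auto simp: rotations_in_def\<close>)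
  interpret R: rotational_frame f U n H 1 e "e 2" "e 3" "e 0" "e 1"
    by unfold_locales (rule S.normal_orthogonal_rotation)
  obtain C where C: "\<And>u. u \<in> U \<Longrightarrow> 1 * R.a u + H * R.r2 u = C"
    using R.first_integral by blast
  show ?thesis
  proof (cases "C = 0")
    case True
    then obtain g where "\<And>u. u \<in> U \<Longrightarrow> n u + H *\<^sub>R f u = g"
      using R.umbilic_of_vanishing_integral C by blast
    then show ?thesis
      using hyperbolic_param_of_umbilic[OF H] by blast
  next
    case False
    \<comment> \<open>A point of the axis has \<open>a = 0\<close> and \<open>r2 = 0\<close>, so the
      first integral would vanish.\<close>
    have r2: "R.r2 u \<noteq> 0" if u: "u \<in> U" for u
    proof
      assume r0: "R.r2 u = 0"
      then have "R.a u = 0"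
        using R.axis(2,3)[OF u r0] by (simp add: R.a_def)
      then show False
        using C[OF u] r0 False by simp
    qed
    obtain Cp Cm p where "admissible 1 H C Cp Cm p"
      using exists_admissible[OF H, of 1 C] False by auto
    then interpret R: rotational_profile f U n H 1 e "e 2" "e 3" "e 0" "e 1" C Cp Cm p
      using H C r2 by unfold_locales auto
    have "given_by_elliptic_param H C f U"
    proof (rule R.elliptic_param)
      fix u assume u: "u \<in> U"
      have "mink (f u) (e 0) < 0"
        using mink_future_neg f_mink[OF u] f_pos[OF u] e orthonormal_basis_mink[OF e(1), of 0 0] by auto
      then show "0 < R.q1 u"
        by (simp add: R.q1_def S.Q1_def)
      fix \<theta>
      \<comment> \<open>The point at angle \<open>\<theta>\<close> on the circle of
        \<open>f u\<close> is reached by a rotation through \<open>\<theta> - \<theta>0\<close>, and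
        its preimage under \<open>f\<close> is supplied by \<open>\<phi>\<close>.\<close>
      obtain \<theta>0 where \<theta>0: "R.p1 u = sqrt (R.r2 u) * cos \<theta>0" "R.p2 u = sqrt (R.r2 u) * sin \<theta>0"
        using R.local_angle_P[OF _ u] by metis
      obtain s where s: "S.c s = cos (\<theta> - \<theta>0)" "S.d s = sin (\<theta> - \<theta>0)"
        using S.circle_surjective[of "\<theta> - \<theta>0"] by auto
      have sc: "(sin \<theta>0)\<^sup>2 + (cos \<theta>0)\<^sup>2 = 1"
        by simp
      have \<theta>: "cos \<theta> = cos (\<theta> - \<theta>0) * cos \<theta>0 - sin (\<theta> - \<theta>0) * sin \<theta>0"
        "sin \<theta> = sin (\<theta> - \<theta>0) * cos \<theta>0 + cos (\<theta> - \<theta>0) * sin \<theta>0"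
        by (simp_all flip: cos_add sin_add)
      have "f (S.\<phi> s u) = S.comb (sqrt (R.r2 u) * cos \<theta>) (sqrt (R.r2 u) * sin \<theta>) (R.q1 u) (R.q2 u)"
        unfolding S.\<phi>(2)[OF u]
        by (rule S.coord_eqI; simp only: S.coord_G S.coord_comb s \<theta> \<theta>0[unfolded R.coord_defs] R.coord_defs)
          (simp_all add: algebra_simps)
      then show "\<exists>u'\<in>U. f u' = S.comb (sqrt (R.r2 u) * cos \<theta>) (sqrt (R.r2 u) * sin \<theta>) (R.q1 u) (R.q2 u)"
        using S.\<phi>_U[OF u] by blast
    qed simp
    then show ?thesis by blast
  qed
qed

lemma hyperbolic_case:
  assumes H: "H\<^sup>2 < 1" and rot: "hyperbolic_rotational f U"
  shows "\<exists>C. given_by_hyperbolic_param H C f U"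
proof -
  obtain P G a b where P: "P = span {a, b}" "mink a a = 1" "mink b b = -1" "mink a b = 0"
    and G: "rotations_in P G" "invariant_under G f U"
    using rot unfolding hyperbolic_rotational_def plane_of_signature_def by blast
  obtain e where e: "orthonormal_basis e" "e 0 = b \<or> e 0 = - b" "e 1 = a" "e 0 $ 0 > 0"
    using exists_basis_lorentzian_plane[OF P(2-4)] by blast
  have "mink (e i) y = 0" if "i = 2 \<or> i = 3" "y \<in> P" for i y
    using that e(2) mink_span_eq_zero[of "e i" a b y] orthonormal_basis_mink[OF e(1), of i 0]
      orthonormal_basis_mink[OF e(1), of i 1] by (auto simp: P(1) e(3) mink_simps)
  then have fixed: "G s (e 2) = e 2" "G s (e 3) = e 3" for s
    using G(1) unfolding rotations_in_def by blast+
  interpret S: invariant_surface f U n "-1" e "e 0" "e 1" "e 2" "e 3" G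
    by unfold_locales (use e G fixed in \<open>auto simp: rotations_in_def\<close>)
  interpret R: rotational_frame f U n H "-1" e "e 0" "e 1" "e 2" "e 3"
    by unfold_locales (rule S.normal_orthogonal_rotation)
  obtain C where C: "\<And>u. u \<in> U \<Longrightarrow> - 1 * R.a u + H * R.r2 u = C"
    using R.first_integral by blast
  have "given_by_hyperbolic_param H C f U"
    by (rule hyperbolic_param_of_frame[OF H e(1,4) S.normal_orthogonal_rotation])
      (use C in \<open>simp_all add: mult.commute\<close>)
  then show ?thesis by blast
qed

end

theorem theorem4p14:
  fixes f :: "real \<times> real \<Rightarrow> real^4" and U :: "(real \<times> real) set" and H :: real
  assumes "immersed_surface f U"
    and "constant_mean_curvature f U H"
    and "0 \<le> H" and "H\<^sup>2 < 1"
  shows "(elliptic_rotational f U \<longrightarrow>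
            (\<exists>C. given_by_elliptic_param H C f U) \<or> given_by_hyperbolic_param H 0 f U) \<and>
         (hyperbolic_rotational f U \<longrightarrow>
            (\<exists>C. given_by_hyperbolic_param H C f U))"
proof -
  obtain n where n: "unit_normal_field f U n"
    "\<And>u. u \<in> U \<Longrightarrow> \<exists>k1 k2. principal_curvatures f n u k1 k2 \<and> H = (k1 + k2) / 2"
    using assms(2) unfolding constant_mean_curvature_def by blast
  interpret cmc_surface f U n H
    by unfold_locales (use assms(1) n in auto)
  show ?thesis
    using elliptic_case[OF assms(4)] hyperbolic_case[OF assms(4)] by blast
qed

end
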